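(* Let $j\in\{1,\ldots,d\}$ be fixed and let $\alpha=(\alpha_1,\ldots,\alpha_d)$ satisfy $\alpha_j\ge-1$ and $\alpha_i\ge0$ for $i\ne j$. Then $\{\widetilde T_t^{\alpha,\mathcal L,j}\}_{t\ge0}$ is a submarkovian (but not Markovian) symmetric diffusion semigroup on $(\mathbb{R}_+^d,dx)$ satisfying, for $1\le p\le\infty$, $$\|\widetilde T_t^{\alpha,\mathcal L,j}\|_{p\to p}\le e^{-t/2}\big(\cosh(t/2)\big)^{-d},\qquad t>0.$$
   Context: Notation: $d\ge 1$, $\mathbb{R}_+=(0,\infty)$, $L^p=L^p(\mathbb{R}_+^d,dx)$, $\|\cdot\|_{p\to p}$ is the operator norm on $L^p$, $\mathbf 1$ is the constant function $1$, $e_j$ is the $j$th coordinate vector, and $I_\nu$ is the modified Bessel function of the first kind of order $\nu$. The semigroup. For $\gamma\in(-1,\infty)^d$, $t>0$ and $x,y\in\mathbb{R}_+^d$, the heat kernel associated with standard Laguerre functions is $$G_t^{\gamma,\mathcal L}(x,y)=(2\sinh(t/2))^{-d}\exp\Big(-\tfrac12\coth(t/2)\sum_{i=1}^d(x_i+y_i)\Big)\prod_{i=1}^d I_{\gamma_i}\Big(\frac{\sqrt{x_iy_i}}{\sinh(t/2)}\Big).$$ The modified semigroup is given on all $L^p(\mathbb{R}_+^d,dx)$, $1\le p\le\infty$, by $$\widetilde T_t^{\alpha,\mathcal L,j}f(x)=e^{-t/2}\int_{\mathbb{R}_+^d}G_t^{\alpha+e_j,\mathcal L}(x,y)f(y)\,dy,\quad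 x\in\mathbb{R}_+^d,\ t>0,$$ and $\widetilde T_0^{\alpha,\mathcal L,j}=\mathrm{Id}$. On $L^2$ it is the semigroup generated by a suitable self-adjoint extension of $L_{\alpha+e_j}^{\mathcal L}+\frac12$, where $L_\gamma^{\mathcal L}=-\sum_{i=1}^d\big(x_i\partial_{x_i}^2+\partial_{x_i}-\frac{x_i^2+\gamma_i^2}{4x_i}\big)$. Definitions. On a $\sigma$-finite measure space $(X,\mu)$, a symmetric diffusion semigroup is a family of linear operators $\{T_t\}_{t\ge0}$, $T_0=\mathrm{Id}$, mapping a linear subspace of the measurable functions that contains all $L^p(X,\mu)$, $1\le p\le\infty$ (e.g. $L^1+L^\infty$) into measurable functions, such that: (i) for each $1\le p\le\infty$ every $T_t$ is a contraction on $L^p$ and $\{T_t\}_{t\ge0}$ is a semigroup there; (ii) each $T_t$ is self-adjoint on $L^2$; (iii) $\lim_{t\to0^+}T_tf=f$ in $L^2$ for each $f\in L^2$. It is Markovian if in addition (iv) $T_tf\ge0$ whenever $f\ge0$, for all $t$, and (v) $T_t\mathbf 1=\mathbf 1$ for all $t$. It is submarkovian if (i)-(iv) hold and (v') $T_t\mathbf 1\le\mathbf 1$ for all $t$. *)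

theory Defs
  imports "HOL-Probability.Essential_Supremum"
begin

section \<open>Lebesgue spaces\<close>

text \<open>
  Elements of the spaces below are real-valued functions, not classes modulo equality almost
  everywhere; statements about them are therefore made almost everywhere. The exponent is an
  extended number with \<open>1 \<le> p \<le> \<infinity>\<close>.
\<close>

definition Lp_norm :: "'a measure \<Rightarrow> ennreal \<Rightarrow> ('a \<Rightarrow> real) \<Rightarrow> ennreal" where
  "Lp_norm M p f =
    (if p = \<infinity> then esssup M (\<lambda>x. ennreal \<bar>f x\<bar>)
     else let I = (\<integral>\<^sup>+ x. ennreal (\<bar>f x\<bar> powr enn2real p) \<partial>M)
          in if I = \<infinity> then \<infinity> else ennreal (enn2real I powr (1 / enn2real p)))"

definition Lp_space :: "'a measure \<Rightarrow> ennreal \<Rightarrow> ('a \<Rightarrow> real) set" where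
  "Lp_space M p = {f \<in> borel_measurable M. Lp_norm M p f < \<infinity>}"

definition L1_plus_Linf :: "'a measure \<Rightarrow> ('a \<Rightarrow> real) set" where
  "L1_plus_Linf M = {\<lambda>x. g x + h x | g h. g \<in> Lp_space M 1 \<and> h \<in> Lp_space M \<infinity>}"

definition Lp_opnorm :: "'a measure \<Rightarrow> ennreal \<Rightarrow> (('a \<Rightarrow> real) \<Rightarrow> ('a \<Rightarrow> real)) \<Rightarrow> ennreal" where
  "Lp_opnorm M p S = (SUP f \<in> {f \<in> Lp_space M p. Lp_norm M p f \<le> 1}. Lp_norm M p (S f))"


section \<open>Symmetric diffusion semigroups\<close>

text \<open>
  \<open>D\<close> is the common domain of the operators \<open>T t\<close>, \<open>t \<ge> 0\<close>; only the values of \<open>T t f\<close> for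
  \<open>t \<ge> 0\<close> and \<open>f \<in> D\<close> matter. The axiom \<open>AE_cong\<close> says that the operators act on
  classes modulo equality almost everywhere. Since the operators are bounded on all of \<open>L\<^sup>2\<close>,
  self-adjointness is symmetry with respect to the inner product.
\<close>

locale symmetric_diffusion_semigroup = sigma_finite_measure M
  for M :: "'a measure"
    and D :: "('a \<Rightarrow> real) set"
    and T :: "real \<Rightarrow> ('a \<Rightarrow> real) \<Rightarrow> ('a \<Rightarrow> real)" +
  assumes domain_measurable: "D \<subseteq> borel_measurable M"
    and domain_add: "\<And>f g. f \<in> D \<Longrightarrow> g \<in> D \<Longrightarrow> (\<lambda>x. f x + g x) \<in> D"
    and domain_scale: "\<And>c f. f \<in> D \<Longrightarrow> (\<lambda>x. c * f x) \<in> D"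
    and Lp_in_domain: "\<And>p. 1 \<le> p \<Longrightarrow> Lp_space M p \<subseteq> D"
    and measurable: "\<And>t f. 0 \<le> t \<Longrightarrow> f \<in> D \<Longrightarrow> T t f \<in> borel_measurable M"
    and AE_cong: "\<And>t f g. 0 \<le> t \<Longrightarrow> f \<in> D \<Longrightarrow> g \<in> D \<Longrightarrow> (AE x in M. f x = g x) \<Longrightarrow>
                    AE x in M. T t f x = T t g x"
    and add: "\<And>t f g. 0 \<le> t \<Longrightarrow> f \<in> D \<Longrightarrow> g \<in> D \<Longrightarrow>
                AE x in M. T t (\<lambda>x. f x + g x) x = T t f x + T t g x"
    and scale: "\<And>t c f. 0 \<le> t \<Longrightarrow> f \<in> D \<Longrightarrow>
                AE x in M. T t (\<lambda>x. c * f x) x = c * T t f x"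
    and identity: "\<And>f. f \<in> D \<Longrightarrow> AE x in M. T 0 f x = f x"
    and contraction: "\<And>p t f. 1 \<le> p \<Longrightarrow> 0 \<le> t \<Longrightarrow> f \<in> Lp_space M p \<Longrightarrow>
                        Lp_norm M p (T t f) \<le> Lp_norm M p f"
    and semigroup: "\<And>p s t f. 1 \<le> p \<Longrightarrow> 0 \<le> s \<Longrightarrow> 0 \<le> t \<Longrightarrow> f \<in> Lp_space M p \<Longrightarrow>
                      AE x in M. T (s + t) f x = T s (T t f) x"
    and self_adjoint: "\<And>t f g. 0 \<le> t \<Longrightarrow> f \<in> Lp_space M 2 \<Longrightarrow> g \<in> Lp_space M 2 \<Longrightarrow>
                         (LINT x|M. T t f x * g x) = (LINT x|M. f x * T t g x)"
    and L2_continuous: "\<And>f. f \<in> Lp_space M 2 \<Longrightarrow>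
                          ((\<lambda>t. Lp_norm M 2 (\<lambda>x. T t f x - f x)) \<longlongrightarrow> 0) (at_right 0)"

locale markovian_semigroup = symmetric_diffusion_semigroup +
  assumes positive: "\<And>t f. 0 \<le> t \<Longrightarrow> f \<in> D \<Longrightarrow> (AE x in M. 0 \<le> f x) \<Longrightarrow> AE x in M. 0 \<le> T t f x"
    and conservative: "\<And>t. 0 \<le> t \<Longrightarrow> AE x in M. T t (\<lambda>_. 1) x = 1"

locale submarkovian_semigroup = symmetric_diffusion_semigroup +
  assumes positive: "\<And>t f. 0 \<le> t \<Longrightarrow> f \<in> D \<Longrightarrow> (AE x in M. 0 \<le> f x) \<Longrightarrow> AE x in M. 0 \<le> T t f x"
    and subconservative: "\<And>t. 0 \<le> t \<Longrightarrow> AE x in M. T t (\<lambda>_. 1) x \<le> 1"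


section \<open>The modified Laguerre semigroup\<close>

text \<open>Modified Bessel function of the first kind, for order \<open>\<nu> > -1\<close> and argument \<open>z > 0\<close>.\<close>

definition bessel_I :: "real \<Rightarrow> real \<Rightarrow> real" where
  "bessel_I \<nu> z = (\<Sum>k. (z / 2) powr (2 * real k + \<nu>) / (fact k * Gamma (real k + \<nu> + 1)))"

definition Rplus :: "(real ^ 'd) set" where
  "Rplus = {x. \<forall>i. 0 < x $ i}"

definition Rplus_measure :: "(real ^ 'd) measure" where
  "Rplus_measure = restrict_space lborel Rplus"

definition laguerre_kernel :: "real ^ 'd \<Rightarrow> real \<Rightarrow> real ^ 'd \<Rightarrow> real ^ 'd \<Rightarrow> real" where
  "laguerre_kernel \<gamma> t x y =
     1 / (2 * sinh (t / 2)) ^ CARD('d)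
     * exp (- (1 / 2) * (cosh (t / 2) / sinh (t / 2)) * (\<Sum>i\<in>UNIV. x $ i + y $ i))
     * (\<Prod>i\<in>UNIV. bessel_I (\<gamma> $ i) (sqrt (x $ i * y $ i) / sinh (t / 2)))"

definition modified_laguerre_semigroup ::
    "real ^ 'd \<Rightarrow> 'd \<Rightarrow> real \<Rightarrow> (real ^ 'd \<Rightarrow> real) \<Rightarrow> (real ^ 'd \<Rightarrow> real)" where
  "modified_laguerre_semigroup \<alpha> j t f =
     (if t = 0 then f
      else (\<lambda>x. exp (- t / 2) *
                 (LINT y|Rplus_measure. laguerre_kernel (\<alpha> + axis j 1) t x y * f y)))"

end

theory Submission
  imports Defs
begin

text \<open>
  The kernel is a product of one-dimensional kernels, and for these all integrals are computed
  term by term from the power series of the Bessel function. The total mass reduces to Gamma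
  integrals whose ratios are bounded by means of the Beta integral, and the semigroup law is
  Weber's second exponential integral, which amounts to Vandermonde's identity for generalised
  binomial coefficients. Symmetry and the mass bound alone give the \<open>L\<^sup>p\<close> bounds by Young's
  inequality (a Schur test). For strong continuity in \<open>L\<^sup>2\<close> it suffices to treat indicators of open
  sets, by outer regularity and density of simple functions; for those one only needs that the mass
  starting at a point of the set stays in the set as \<open>t\<close> tends to \<open>0\<close>.
\<close>

section \<open>Gamma integrals and sums\<close>

text \<open>The hypothesis on \<open>\<alpha>\<close> says that all orders
  \<open>(\<alpha> + axis j 1) $ i\<close> are nonnegative, and the mass bound depends on this sign:
  for a negative order \<open>\<nu>\<close> the mass started at \<open>x\<close> grows like
  \<open>x powr (\<nu> / 2)\<close> as \<open>x\<close> tends to \<open>0\<close>. For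
  \<open>\<nu> > 0\<close> the mass of a one-dimensional kernel is a confluent hypergeometric
  function, in general not elementary, so it is estimated and not computed. An upper bound alone
  does not show that mass stays near the starting point, and continuity at \<open>t = 0\<close>
  needs a matching lower bound. This comes from inserting the weight
  \<open>y powr (\<nu> / 2)\<close>, for which the Gamma values cancel and every exponential moment
  is explicit. All terms are nonnegative, so the computations run in \<open>ennreal\<close>, where
  sums and integrals may be interchanged freely. The factor \<open>exp (- t / 2)\<close> is
  multiplicative in \<open>t\<close> and tends to \<open>1\<close>; it passes through the semigroup
  law and the limit at \<open>0\<close>, and makes the mass bound strictly smaller than
  \<open>1\<close>.\<close>

lemma gamma_nn_integral:
  fixes \<mu> p :: real
  assumes "\<mu> > -1" "p > 0"
  shows "(\<integral>\<^sup>+y. ennreal (y powr \<mu> * exp (- (p * y))) * indicator {0<..} y \<partial>lborel) =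
         ennreal (Gamma (\<mu> + 1) / p powr (\<mu> + 1))"
proof -
  define f where "f = (\<lambda>t::real. ennreal (indicator {0..} t * t powr \<mu> / exp t))"
  have [measurable]: "f \<in> borel_measurable borel" by (simp add: f_def)
  have "ennreal (Gamma (\<mu> + 1)) = (\<integral>\<^sup>+t. f t \<partial>lborel)"
    using Gamma_conv_nn_integral_real[of "\<mu> + 1"] assms by (simp add: f_def)
  also have "\<dots> = ennreal p * (\<integral>\<^sup>+y. f (0 + p * y) \<partial>lborel)"
    using assms nn_integral_real_affine[of f p 0] by simp
  also have "(\<integral>\<^sup>+y. f (0 + p * y) \<partial>lborel) =
      (\<integral>\<^sup>+y. ennreal (p powr \<mu>) * (ennreal (y powr \<mu> * exp (- (p * y))) * indicator {0<..} y) \<partial>lborel)"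
    using assms
    by (intro nn_integral_cong_AE eventually_mono[OF AE_lborel_singleton[of 0]])
       (auto simp: f_def indicator_def powr_mult exp_minus field_simps ennreal_mult[symmetric] zero_le_mult_iff
             simp del: ennreal_0)
  also have "\<dots> = ennreal (p powr \<mu>) * (\<integral>\<^sup>+y. ennreal (y powr \<mu> * exp (- (p * y))) * indicator {0<..} y \<partial>lborel)"
    by (rule nn_integral_cmult) simp
  finally have *: "ennreal (Gamma (\<mu> + 1)) = ennreal (p powr (\<mu> + 1)) *
      (\<integral>\<^sup>+y. ennreal (y powr \<mu> * exp (- (p * y))) * indicator {0<..} y \<partial>lborel)" (is "_ = _ * ?I")
    using assms by (simp add: powr_add ennreal_mult mult_ac)
  have "?I = ennreal (1 / p powr (\<mu> + 1)) * ennreal (Gamma (\<mu> + 1))"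
    unfolding * mult.assoc[symmetric] using assms by (simp add: ennreal_mult[symmetric])
  then show ?thesis
    using assms by (simp add: ennreal_mult[symmetric])
qed

lemma suminf_exp_ennreal:
  assumes "0 \<le> w"
  shows "(\<Sum>k. ennreal (w ^ k / fact k)) = ennreal (exp w)"
proof -
  have "(\<lambda>k. w ^ k / fact k) sums exp w"
    using exp_converges[of w] by (simp add: field_simps)
  then show ?thesis
    using assms by (subst suminf_ennreal2) (auto simp: sums_iff)
qed

text \<open>The ratio of the two Gamma values is \<open>Beta (k + a + 1) a / Gamma a\<close>.
  Inserting the Beta integral and summing under it leaves an exponential \<open>exp (w * u)\<close>
  against \<open>u powr a * (1 - u) powr (a - 1)\<close>, which is compared with a Gamma integral.
  It is used with \<open>a = \<nu> / 2\<close>.\<close>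

lemma suminf_powr_Gamma_ratio_le_exp:
  fixes a w :: real
  assumes "0 \<le> a" "0 < w"
  shows "(\<Sum>k. ennreal (w powr (real k + a) * Gamma (real k + a + 1) / (fact k * Gamma (real k + 2 * a + 1))))
         \<le> ennreal (exp w)"
proof (cases "a = 0")
  \<comment> \<open>The Beta integral has no meaning for parameter \<open>0\<close>; there the
    series is the exponential series itself and equality holds.\<close>
  case True
  have *: "w powr (real k + a) * Gamma (real k + a + 1) / (fact k * Gamma (real k + 2 * a + 1)) = w ^ k / fact k" for k
    using assms True Gamma_fact[of k, where 'a=real] by (simp add: powr_realpow add.commute[of 1])
  show ?thesis unfolding * using suminf_exp_ennreal[OF less_imp_le[OF assms(2)]] by (rule eq_refl)
next
  case False
  then have a: "a > 0" using assms by simp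
  then have [simp]: "Gamma a > 0" by (rule Gamma_real_pos)
  then have [simp]: "Gamma a \<noteq> 0" by (rule less_imp_neq[symmetric])
  define g where "g = (\<lambda>(k::nat) (u::real). ennreal (indicator {0..1} u * (u powr (real k + a) * (1 - u) powr (a - 1))))"
  have [measurable]: "g k \<in> borel_measurable borel" for k by (simp add: g_def)
  have coeff: "ennreal (w powr (real k + a) * Gamma (real k + a + 1) / (fact k * Gamma (real k + 2 * a + 1))) =
      (\<integral>\<^sup>+u. ennreal (w powr (real k + a) / (fact k * Gamma a)) * g k u \<partial>lborel)" for k
  proof -
    have "(\<integral>\<^sup>+u. g k u \<partial>lborel) = ennreal (Beta (real k + a + 1) a)"
      using nn_integral_has_integral_lebesgue[OF _ has_integral_Beta_real[of "real k + a + 1" a]] a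
      by (simp add: g_def mult_ac)
    then have "(\<integral>\<^sup>+u. ennreal (w powr (real k + a) / (fact k * Gamma a)) * g k u \<partial>lborel) =
        ennreal (w powr (real k + a) / (fact k * Gamma a)) * ennreal (Beta (real k + a + 1) a)"
      by (simp add: nn_integral_cmult)
    also have "\<dots> = ennreal (w powr (real k + a) / (fact k * Gamma a) * Beta (real k + a + 1) a)"
      using a by (subst ennreal_mult) (auto simp: Beta_def)
    also have "w powr (real k + a) / (fact k * Gamma a) * Beta (real k + a + 1) a =
        w powr (real k + a) * Gamma (real k + a + 1) / (fact k * Gamma (real k + 2 * a + 1))"
      using a by (simp add: Beta_def field_simps)
    finally show ?thesis by simp
  qed
  \<comment> \<open>The summed integrand with \<open>u powr a\<close> replaced by its bound
    \<open>1\<close> and the range enlarged from \<open>[0,1]\<close> to all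
    \<open>u \<le> 1\<close>, so that reflecting at \<open>1\<close> yields a complete Gamma
    integral.\<close>
  define h where "h = (\<lambda>u::real. ennreal (indicator {..1} u * (w powr a * (1 - u) powr (a - 1) * exp (w * u) / Gamma a)))"
  have [measurable]: "h \<in> borel_measurable borel" by (simp add: h_def)
  have "(\<Sum>k. ennreal (w powr (real k + a) * Gamma (real k + a + 1) / (fact k * Gamma (real k + 2 * a + 1)))) =
      (\<integral>\<^sup>+u. (\<Sum>k. ennreal (w powr (real k + a) / (fact k * Gamma a)) * g k u) \<partial>lborel)"
    unfolding coeff by (rule nn_integral_suminf[symmetric]) simp
  also have "\<dots> \<le> (\<integral>\<^sup>+u. h u \<partial>lborel)"
  proof (rule nn_integral_mono)
    fix u :: real
    show "(\<Sum>k. ennreal (w powr (real k + a) / (fact k * Gamma a)) * g k u) \<le> h u"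
    proof (cases "0 < u \<and> u \<le> 1")
      case True
      define c where "c = w powr a * u powr a * (1 - u) powr (a - 1) / Gamma a"
      have c: "c \<ge> 0" using a by (simp add: c_def)
      have *: "ennreal (w powr (real k + a) / (fact k * Gamma a)) * g k u = ennreal c * ennreal ((w * u) ^ k / fact k)" for k
        using True a assms
        by (simp add: g_def c_def ennreal_mult[symmetric] powr_add powr_realpow power_mult_distrib mult_ac)
      have "(\<Sum>k. ennreal (w powr (real k + a) / (fact k * Gamma a)) * g k u) = ennreal (c * exp (w * u))"
        unfolding * ennreal_suminf_cmult using True assms c by (subst suminf_exp_ennreal) (auto simp: ennreal_mult)
      also have "\<dots> \<le> h u"
      proof -
        have "u powr a \<le> 1 powr a" using True a by (intro powr_mono2) auto
        then have "w powr a * (1 - u) powr (a - 1) * exp (w * u) / Gamma a * u powr a \<le>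
            w powr a * (1 - u) powr (a - 1) * exp (w * u) / Gamma a"
          using a by (intro mult_left_le) auto
        then show ?thesis
          unfolding h_def c_def using True by (intro ennreal_leI) (simp add: mult_ac)
      qed
      finally show ?thesis .
    next
      case False
      then have "g k u = 0" for k using a by (cases "u = 0") (auto simp: g_def indicator_def)
      then show ?thesis by simp
    qed
  qed
  \<comment> \<open>Substitution \<open>v = w * (1 - u)\<close>: \<open>exp (w * u)\<close> becomes
    \<open>exp w * exp (- v)\<close>, and the half line \<open>u \<le> 1\<close> becomes
    \<open>v \<ge> 0\<close>.\<close>
  also have "\<dots> = ennreal (1 / w) * (\<integral>\<^sup>+v. h (1 + (- 1 / w) * v) \<partial>lborel)"
    using assms nn_integral_real_affine[of h "- 1 / w" 1] by simp
  also have "(\<integral>\<^sup>+v. h (1 + (- 1 / w) * v) \<partial>lborel) =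
      (\<integral>\<^sup>+v. ennreal (w * exp w / Gamma a) * (ennreal (v powr (a - 1) * exp (- (1 * v))) * indicator {0<..} v) \<partial>lborel)"
  proof (intro nn_integral_cong_AE eventually_mono[OF AE_lborel_singleton[of 0]])
    fix v :: real assume "v \<noteq> 0"
    show "h (1 + (- 1 / w) * v) = ennreal (w * exp w / Gamma a) *
        (ennreal (v powr (a - 1) * exp (- (1 * v))) * indicator {0<..} v)"
    proof (cases "v > 0")
      case True
      have "w * (1 + (- 1 / w) * v) = w + - v" using assms by (simp add: field_simps)
      then have "exp (w * (1 + (- 1 / w) * v)) = exp w * exp (- v)" by (simp only: exp_add)
      moreover have "(1 - (1 + (- 1 / w) * v)) powr (a - 1) = v powr (a - 1) / w powr (a - 1)"
        using True assms by (simp add: powr_divide)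
      moreover have "w powr a = w * w powr (a - 1)" using assms by (simp add: powr_diff)
      ultimately show ?thesis
        using True a assms by (simp add: h_def ennreal_mult[symmetric] mult_ac)
    next
      case False
      then show ?thesis using \<open>v \<noteq> 0\<close> assms by (simp add: h_def indicator_def field_simps)
    qed
  qed
  also have "\<dots> = ennreal (w * exp w / Gamma a) * ennreal (Gamma a)"
    using gamma_nn_integral[of "a - 1" 1] a by (simp add: nn_integral_cmult)
  also have "ennreal (1 / w) * \<dots> = ennreal (exp w)"
    using a assms by (simp add: ennreal_mult[symmetric])
  finally show ?thesis .
qed

text \<open>Tonelli, with one of the two sums read as an integral over the counting measure.\<close>

lemma suminf_nn_commute:
  fixes f :: "nat \<Rightarrow> nat \<Rightarrow> ennreal"
  shows "(\<Sum>i. \<Sum>j. f i j) = (\<Sum>j. \<Sum>i. f i j)"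
  using nn_integral_suminf[of "\<lambda>j i. f i j" "count_space UNIV"]
  by (simp add: nn_integral_count_space_nat)

lemma suminf_shift_ennreal:
  fixes f :: "nat \<Rightarrow> ennreal"
  shows "(\<Sum>k. if m \<le> k then f (k - m) else 0) = (\<Sum>i. f i)"
proof -
  have "(\<Sum>k. if m \<le> k then f (k - m) else 0) =
      (\<Sum>i. if m \<le> i + m then f (i + m - m) else 0) + (\<Sum>k<m. if m \<le> k then f (k - m) else 0)"
    by (rule suminf_offset) simp
  then show ?thesis by simp
qed

lemma Gamma_plus_nat_ratio:
  fixes x :: real
  assumes "x > 0"
  shows "Gamma (x + real n) = pochhammer x n * Gamma x"
proof -
  have "x \<notin> \<int>\<^sub>\<le>\<^sub>0" using assms by (auto elim!: nonpos_Ints_cases)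
  then show ?thesis
    using pochhammer_Gamma[of x n] Gamma_real_pos[OF assms] by simp
qed

lemma gbinomial_conv_Gamma_ratio:
  fixes \<nu> :: real
  assumes "\<nu> > -1" and that: "k \<le> n"
  shows "(real n + \<nu>) gchoose k = Gamma (real n + \<nu> + 1) / (fact k * Gamma (real n - real k + \<nu> + 1))"
proof -
  have "Gamma (real n - real k + \<nu> + 1 + real k) = 
     pochhammer (real n - real k + \<nu> + 1) k * Gamma (real n - real k + \<nu> + 1)"
    using that assms by (intro Gamma_plus_nat_ratio) linarith
  moreover have "Gamma (real n - real k + \<nu> + 1) > 0"
    using that assms by (intro Gamma_real_pos) linarith
  ultimately show ?thesis
    unfolding gbinomial_pochhammer' by (simp add: algebra_simps)
qed

text \<open>Vandermonde's identity with upper entries \<open>k\<close> and \<open>l + \<nu>\<close>,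
  divided by \<open>fact k * Gamma (l + \<nu> + 1)\<close>. Read from right to left it decouples
  \<open>k\<close> and \<open>l\<close>: for fixed \<open>m\<close> each summand is a function of
  \<open>k\<close> times a function of \<open>l\<close>, while
  \<open>Gamma (k + l + \<nu> + 1)\<close> mixes them.\<close>

lemma Gamma_Vandermonde:
  fixes \<nu> :: real
  assumes "\<nu> > -1"
  shows "(\<Sum>m\<in>{m. m \<le> k \<and> m \<le> l}. 1 / (fact (k - m) * fact (l - m) * fact m * Gamma (real m + \<nu> + 1))) =
     Gamma (real k + real l + \<nu> + 1) /
       (fact k * Gamma (real k + \<nu> + 1) * (fact l * Gamma (real l + \<nu> + 1)))"
proof -
  have pos: "Gamma (real n + \<nu> + 1) > 0" for n using assms by (intro Gamma_real_pos) linarith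
  have V: "(\<Sum>m\<in>{0..l}. (real k gchoose m) * ((real l + \<nu>) gchoose (l - m))) = (real k + (real l + \<nu>)) gchoose l"
    by (rule gbinomial_Vandermonde)
  have R: "(real k + (real l + \<nu>)) gchoose l =
      Gamma (real k + real l + \<nu> + 1) / (fact l * Gamma (real k + \<nu> + 1))"
    using gbinomial_conv_Gamma_ratio[OF assms, of l "k + l"] by (simp add: add_ac)
  \<comment> \<open>Terms with \<open>m > k\<close> vanish, since \<open>k\<close> is a natural
    number and \<open>k choose m\<close> is then \<open>0\<close>.\<close>
  have "(\<Sum>m\<in>{0..l}. (real k gchoose m) * ((real l + \<nu>) gchoose (l - m))) =
     (\<Sum>m\<in>{m. m \<le> k \<and> m \<le> l}. (real k gchoose m) * ((real l + \<nu>) gchoose (l - m)))"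
    by (rule sum.mono_neutral_right) (auto simp: binomial_gbinomial[symmetric] not_le)
  also have "\<dots> = (\<Sum>m\<in>{m. m \<le> k \<and> m \<le> l}. fact k * Gamma (real l + \<nu> + 1) *
      (1 / (fact (k - m) * fact (l - m) * fact m * Gamma (real m + \<nu> + 1))))"
  proof (intro sum.cong refl)
    fix m assume m: "m \<in> {m. m \<le> k \<and> m \<le> l}"
    have "real k gchoose m = fact k / (fact m * fact (k - m))"
      unfolding binomial_gbinomial[symmetric] using m by (intro binomial_fact) simp
    moreover have "(real l + \<nu>) gchoose (l - m) = Gamma (real l + \<nu> + 1) / (fact (l - m) * Gamma (real m + \<nu> + 1))"
      using gbinomial_conv_Gamma_ratio[OF assms, of "l - m" l] m by (simp add: of_nat_diff)
    ultimately show "(real k gchoose m) * ((real l + \<nu>) gchoose (l - m)) = fact k * Gamma (real l + \<nu> + 1) *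
      (1 / (fact (k - m) * fact (l - m) * fact m * Gamma (real m + \<nu> + 1)))"
      by (simp only: times_divide_times_eq times_divide_eq_right times_divide_eq_left mult_1_right divide_divide_eq_left mult_ac)
  qed
  finally have "fact k * Gamma (real l + \<nu> + 1) *
      (\<Sum>m\<in>{m. m \<le> k \<and> m \<le> l}. 1 / (fact (k - m) * fact (l - m) * fact m * Gamma (real m + \<nu> + 1))) =
      Gamma (real k + real l + \<nu> + 1) / (fact l * Gamma (real k + \<nu> + 1))"
    unfolding V R by (simp only: sum_distrib_left)
  then have "(\<Sum>m\<in>{m. m \<le> k \<and> m \<le> l}. 1 / (fact (k - m) * fact (l - m) * fact m * Gamma (real m + \<nu> + 1))) =
      Gamma (real k + real l + \<nu> + 1) / (fact l * Gamma (real k + \<nu> + 1)) / (fact k * Gamma (real l + \<nu> + 1))"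
    using pos[of l] by (subst nonzero_eq_divide_eq) (auto simp: mult_ac)
  then show ?thesis
    by (simp add: mult_ac)
qed

section \<open>Bessel series\<close>

text \<open>The function \<open>I_\<nu>(2 * sqrt u)\<close>. In this variable the exponents are
  \<open>k + \<nu> / 2\<close>, so each term is a power to which the Gamma integral applies; the
  value in \<open>ennreal\<close> makes convergence automatic.\<close>

definition bessel_series :: "real \<Rightarrow> real \<Rightarrow> ennreal" where
  "bessel_series \<nu> u = (\<Sum>k. ennreal (u powr (real k + \<nu> / 2) / (fact k * Gamma (real k + \<nu> + 1))))"

lemma bessel_series_measurable [measurable]:
  assumes [measurable]: "f \<in> borel_measurable M"
  shows "(\<lambda>x. bessel_series \<nu> (f x)) \<in> borel_measurable M"
  unfolding bessel_series_def by measurable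

lemma bessel_I_measurable [measurable]:
  assumes [measurable]: "f \<in> borel_measurable M"
  shows "(\<lambda>x. bessel_I \<nu> (f x)) \<in> borel_measurable M"
  unfolding bessel_I_def by measurable

text \<open>For \<open>\<nu> \<ge> 0\<close> the quotient
  \<open>Gamma (k + \<nu> + 1) / Gamma (\<nu> + 1)\<close> is a product of factors that are at least
  \<open>1\<close>, so the series is dominated by a multiple of the exponential series at
  \<open>(z / 2)\<^sup>2\<close>.\<close>

lemma summable_bessel_I:
  assumes "0 \<le> \<nu>" "0 < z"
  shows "summable (\<lambda>k. (z / 2) powr (2 * real k + \<nu>) / (fact k * Gamma (real k + \<nu> + 1)))"
proof (rule summable_comparison_test')
  show "summable (\<lambda>k. (z / 2) powr \<nu> / Gamma (\<nu> + 1) * (((z / 2)\<^sup>2) ^ k / fact k))"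
    using summable_exp[of "(z / 2)\<^sup>2"] by (intro summable_mult) (simp add: field_simps)
  fix k :: nat
  have G: "0 < Gamma (\<nu> + 1)" using assms by (intro Gamma_real_pos) simp
  have "1 \<le> pochhammer (\<nu> + 1) k"
    unfolding pochhammer_prod using assms by (intro prod_ge_1) auto
  then have "Gamma (\<nu> + 1) \<le> pochhammer (\<nu> + 1) k * Gamma (\<nu> + 1)"
    using G by simp
  also have "\<dots> = Gamma (real k + \<nu> + 1)"
    using Gamma_plus_nat_ratio[of "\<nu> + 1" k] assms by (simp add: add_ac)
  finally have le: "Gamma (\<nu> + 1) \<le> Gamma (real k + \<nu> + 1)" .
  have "(z / 2) powr (2 * real k + \<nu>) = (z / 2) powr \<nu> * ((z / 2)\<^sup>2) ^ k"
  proof -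
    have "((z / 2)\<^sup>2) ^ k = (z / 2) powr (2 * real k)"
      using powr_realpow[of "z / 2" "2 * k"] assms by (simp add: power_mult)
    then show ?thesis by (simp only: powr_add mult.commute)
  qed
  then have "norm ((z / 2) powr (2 * real k + \<nu>) / (fact k * Gamma (real k + \<nu> + 1))) =
      (z / 2) powr \<nu> * (((z / 2)\<^sup>2) ^ k / fact k) / Gamma (real k + \<nu> + 1)"
    using G le by simp
  also have "\<dots> \<le> (z / 2) powr \<nu> * (((z / 2)\<^sup>2) ^ k / fact k) / Gamma (\<nu> + 1)"
    using G le by (intro divide_left_mono) auto
  finally show "norm ((z / 2) powr (2 * real k + \<nu>) / (fact k * Gamma (real k + \<nu> + 1))) \<le>
      (z / 2) powr \<nu> / Gamma (\<nu> + 1) * (((z / 2)\<^sup>2) ^ k / fact k)"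
    by (simp add: mult.commute)
qed

lemma bessel_I_nonneg:
  assumes "0 \<le> \<nu>" "0 < z"
  shows "0 \<le> bessel_I \<nu> z"
  unfolding bessel_I_def using assms
  by (intro suminf_nonneg summable_bessel_I divide_nonneg_nonneg mult_nonneg_nonneg less_imp_le[OF Gamma_real_pos]) auto

text \<open>The bridge from the real-valued kernel to the \<open>ennreal\<close> calculus.
  Summability matters here: without it the real \<open>suminf\<close> in \<open>bessel_I\<close>
  would carry no information.\<close>

lemma ennreal_bessel_I:
  assumes "0 \<le> \<nu>" "0 < z"
  shows "ennreal (bessel_I \<nu> z) = bessel_series \<nu> ((z / 2)\<^sup>2)"
proof -
  have "(z / 2) powr (2 * real k + \<nu>) = ((z / 2)\<^sup>2) powr (real k + \<nu> / 2)" for k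
  proof -
    have "(z / 2)\<^sup>2 = (z / 2) powr 2" using assms by simp
    then show ?thesis by (simp only: powr_powr) (simp add: algebra_simps)
  qed
  then have "bessel_series \<nu> ((z / 2)\<^sup>2) =
      (\<Sum>k. ennreal ((z / 2) powr (2 * real k + \<nu>) / (fact k * Gamma (real k + \<nu> + 1))))"
    by (simp only: bessel_series_def)
  also have "\<dots> = ennreal (bessel_I \<nu> z)"
    unfolding bessel_I_def using assms
    by (intro suminf_ennreal2 summable_bessel_I divide_nonneg_nonneg mult_nonneg_nonneg less_imp_le[OF Gamma_real_pos]) auto
  finally show ?thesis ..
qed

text \<open>Monotone convergence. The weight \<open>w\<close> is kept general because Weber's
  integral uses this twice, the first time with a weight that contains another Bessel
  series.\<close>

lemma nn_integral_bessel_series: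
  assumes "0 < a" "0 \<le> \<nu>" and [measurable]: "w \<in> borel_measurable borel"
  shows "(\<integral>\<^sup>+y. w y * bessel_series \<nu> (a * y) * indicator {0<..} y \<partial>lborel) =
     (\<Sum>k. ennreal (a powr (real k + \<nu> / 2) / (fact k * Gamma (real k + \<nu> + 1))) *
        (\<integral>\<^sup>+y. ennreal (y powr (real k + \<nu> / 2)) * w y * indicator {0<..} y \<partial>lborel))"
proof -
  define c where "c = (\<lambda>k. a powr (real k + \<nu> / 2) / (fact k * Gamma (real k + \<nu> + 1)))"
  have c: "c k \<ge> 0" for k
    unfolding c_def using assms by (intro divide_nonneg_nonneg mult_nonneg_nonneg less_imp_le[OF Gamma_real_pos]) auto
  have "w y * bessel_series \<nu> (a * y) * indicator {0<..} y =
      (\<Sum>k. ennreal (c k) * (ennreal (y powr (real k + \<nu> / 2)) * w y * indicator {0<..} y))" for y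
  proof (cases "y > 0")
    case True
    have "ennreal ((a * y) powr (real k + \<nu> / 2) / (fact k * Gamma (real k + \<nu> + 1))) =
        ennreal (c k) * ennreal (y powr (real k + \<nu> / 2))" for k
      unfolding ennreal_mult''[OF powr_ge_zero, symmetric] using True assms by (simp add: c_def powr_mult mult_ac)
    then have "bessel_series \<nu> (a * y) = (\<Sum>k. ennreal (c k) * ennreal (y powr (real k + \<nu> / 2)))"
      by (simp only: bessel_series_def)
    then have "w y * bessel_series \<nu> (a * y) = (\<Sum>k. w y * (ennreal (c k) * ennreal (y powr (real k + \<nu> / 2))))"
      by (simp only: ennreal_suminf_cmult)
    then show ?thesis using True by (simp add: mult_ac)
  qed simp
  then have "(\<integral>\<^sup>+y. w y * bessel_series \<nu> (a * y) * indicator {0<..} y \<partial>lborel) =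
      (\<integral>\<^sup>+y. (\<Sum>k. ennreal (c k) * (ennreal (y powr (real k + \<nu> / 2)) * w y * indicator {0<..} y)) \<partial>lborel)"
    by simp
  also have "\<dots> = (\<Sum>k. \<integral>\<^sup>+y. ennreal (c k) * (ennreal (y powr (real k + \<nu> / 2)) * w y * indicator {0<..} y) \<partial>lborel)"
    by (rule nn_integral_suminf) simp
  also have "\<dots> = (\<Sum>k. ennreal (c k) * (\<integral>\<^sup>+y. ennreal (y powr (real k + \<nu> / 2)) * w y * indicator {0<..} y \<partial>lborel))"
    by (intro suminf_cong nn_integral_cmult) simp
  finally show ?thesis by (simp only: c_def)
qed

text \<open>The integral of the \<open>k\<close>-th term produces
  \<open>Gamma (k + \<nu> / 2 + 1)\<close>, whereas the coefficient carries
  \<open>Gamma (k + \<nu> + 1)\<close>. These do not cancel unless \<open>\<nu> = 0\<close>, so only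
  an upper bound is obtained.\<close>

lemma nn_integral_exp_bessel_series_le:
  assumes "0 < a" "0 < p" "0 \<le> \<nu>"
  shows "(\<integral>\<^sup>+y. ennreal (exp (- (p * y))) * bessel_series \<nu> (a * y) * indicator {0<..} y \<partial>lborel)
         \<le> ennreal (exp (a / p) / p)"
proof -
  have G: "Gamma (real k + \<nu> / 2 + 1) > 0" "Gamma (real k + \<nu> + 1) > 0" for k
    using assms by (auto intro!: Gamma_real_pos)
  have "(\<integral>\<^sup>+y. ennreal (exp (- (p * y))) * bessel_series \<nu> (a * y) * indicator {0<..} y \<partial>lborel) =
     (\<Sum>k. ennreal (a powr (real k + \<nu> / 2) / (fact k * Gamma (real k + \<nu> + 1))) *
        (\<integral>\<^sup>+y. ennreal (y powr (real k + \<nu> / 2)) * ennreal (exp (- (p * y))) * indicator {0<..} y \<partial>lborel))"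
    using assms by (intro nn_integral_bessel_series) auto
  also have "\<dots> = (\<Sum>k. ennreal (1 / p) * ennreal ((a / p) powr (real k + \<nu> / 2) * Gamma (real k + \<nu> / 2 + 1) /
      (fact k * Gamma (real k + 2 * (\<nu> / 2) + 1))))"
  proof (intro suminf_cong)
    fix k
    have "(\<integral>\<^sup>+y. ennreal (y powr (real k + \<nu> / 2)) * ennreal (exp (- (p * y))) * indicator {0<..} y \<partial>lborel) =
        ennreal (Gamma (real k + \<nu> / 2 + 1) / p powr (real k + \<nu> / 2 + 1))"
      using gamma_nn_integral[of "real k + \<nu> / 2" p] assms by (simp add: ennreal_mult)
    then show "ennreal (a powr (real k + \<nu> / 2) / (fact k * Gamma (real k + \<nu> + 1))) *
        (\<integral>\<^sup>+y. ennreal (y powr (real k + \<nu> / 2)) * ennreal (exp (- (p * y))) * indicator {0<..} y \<partial>lborel) =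
        ennreal (1 / p) * ennreal ((a / p) powr (real k + \<nu> / 2) * Gamma (real k + \<nu> / 2 + 1) /
      (fact k * Gamma (real k + 2 * (\<nu> / 2) + 1)))"
      using assms G[of k] by (simp add: powr_divide powr_add mult_ac flip: ennreal_mult)
  qed
  also have "\<dots> = ennreal (1 / p) * (\<Sum>k. ennreal ((a / p) powr (real k + \<nu> / 2) * Gamma (real k + \<nu> / 2 + 1) /
      (fact k * Gamma (real k + 2 * (\<nu> / 2) + 1))))"
    by (rule ennreal_suminf_cmult)
  also have "\<dots> \<le> ennreal (1 / p) * ennreal (exp (a / p))"
    using assms by (intro mult_left_mono suminf_powr_Gamma_ratio_le_exp) auto
  also have "\<dots> = ennreal (exp (a / p) / p)"
    using assms by (simp flip: ennreal_mult)
  finally show ?thesis .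
qed

text \<open>The extra weight raises the exponent to \<open>k + \<nu>\<close>; the Gamma integral
  then cancels the Gamma value in the coefficient exactly and an exponential series remains.\<close>

lemma nn_integral_powr_exp_bessel_series:
  assumes "0 < a" "0 < p" "0 \<le> \<nu>"
  shows "(\<integral>\<^sup>+y. ennreal (y powr (\<nu> / 2) * exp (- (p * y))) * bessel_series \<nu> (a * y) * indicator {0<..} y \<partial>lborel)
         = ennreal (a powr (\<nu> / 2) / p powr (\<nu> + 1) * exp (a / p))"
proof -
  have G: "Gamma (real k + \<nu> + 1) > 0" for k
    using assms by (auto intro!: Gamma_real_pos)
  have "(\<integral>\<^sup>+y. ennreal (y powr (\<nu> / 2) * exp (- (p * y))) * bessel_series \<nu> (a * y) * indicator {0<..} y \<partial>lborel) =
     (\<Sum>k. ennreal (a powr (real k + \<nu> / 2) / (fact k * Gamma (real k + \<nu> + 1))) *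
        (\<integral>\<^sup>+y. ennreal (y powr (real k + \<nu> / 2)) * ennreal (y powr (\<nu> / 2) * exp (- (p * y))) * indicator {0<..} y \<partial>lborel))"
    using assms by (intro nn_integral_bessel_series) auto
  also have "\<dots> = (\<Sum>k. ennreal (a powr (\<nu> / 2) / p powr (\<nu> + 1)) * ennreal ((a / p) ^ k / fact k))"
  proof (intro suminf_cong)
    fix k
    have "(\<integral>\<^sup>+y. ennreal (y powr (real k + \<nu> / 2)) * ennreal (y powr (\<nu> / 2) * exp (- (p * y))) * indicator {0<..} y \<partial>lborel) =
      (\<integral>\<^sup>+y. ennreal (y powr (real k + \<nu>) * exp (- (p * y))) * indicator {0<..} y \<partial>lborel)"
      by (intro nn_integral_cong) (auto simp: indicator_def mult.assoc add.commute simp flip: ennreal_mult powr_add)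
    also have "\<dots> = ennreal (Gamma (real k + \<nu> + 1) / p powr (real k + \<nu> + 1))"
      using gamma_nn_integral[of "real k + \<nu>" p] assms by simp
    finally show "ennreal (a powr (real k + \<nu> / 2) / (fact k * Gamma (real k + \<nu> + 1))) *
        (\<integral>\<^sup>+y. ennreal (y powr (real k + \<nu> / 2)) * ennreal (y powr (\<nu> / 2) * exp (- (p * y))) * indicator {0<..} y \<partial>lborel) =
        ennreal (a powr (\<nu> / 2) / p powr (\<nu> + 1)) * ennreal ((a / p) ^ k / fact k)"
      using assms G[of k] less_imp_neq[OF G[of k], symmetric] by (simp add: power_divide powr_add powr_realpow mult_ac flip: ennreal_mult)
  qed
  also have "\<dots> = ennreal (a powr (\<nu> / 2) / p powr (\<nu> + 1)) * ennreal (exp (a / p))"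
    unfolding ennreal_suminf_cmult using assms by (subst suminf_exp_ennreal) auto
  also have "\<dots> = ennreal (a powr (\<nu> / 2) / p powr (\<nu> + 1) * exp (a / p))"
    using assms by (simp flip: ennreal_mult)
  finally show ?thesis .
qed

text \<open>Weber's second exponential integral.\<close>

lemma nn_integral_exp_bessel_series_mult:
  assumes "0 < a" "0 < b" "0 < p" "0 \<le> \<nu>"
  shows "(\<integral>\<^sup>+y. ennreal (exp (- (p * y))) * bessel_series \<nu> (a * y) * bessel_series \<nu> (b * y) * indicator {0<..} y \<partial>lborel)
         = ennreal (exp ((a + b) / p) / p) * bessel_series \<nu> (a * b / p\<^sup>2)"
proof -
  define A B where "A = a / p" and "B = b / p"
  have AB: "A > 0" "B > 0" using assms by (auto simp: A_def B_def)
  \<comment> \<open>\<open>E w m\<close> is the exponential series of \<open>w\<close> started at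
    index \<open>m\<close>, hence with the same sum for every \<open>m\<close>; \<open>d m\<close>
    is the \<open>m\<close>-th term of the Bessel series at \<open>A * B\<close>. The coefficient of
    index \<open>(k, l)\<close> will split into the terms
    \<open>E A m k * E B m l * d m\<close>.\<close>
  define E where "E = (\<lambda>w m k. if m \<le> k then ennreal (w ^ (k - m) / fact (k - m)) else 0)"
  define d where "d = (\<lambda>m. ennreal ((A * B) powr (real m + \<nu> / 2) / (fact m * Gamma (real m + \<nu> + 1))))"
  have G: "Gamma (real k + \<nu> + 1) > 0" "Gamma (real k + real l + \<nu> + 1) > 0" for k l
    using assms by (auto intro!: Gamma_real_pos)
  have E: "(\<Sum>k. E w m k) = ennreal (exp w)" if "w > 0" for w m
    unfolding E_def using suminf_shift_ennreal[of m "\<lambda>i. ennreal (w ^ i / fact i)"] suminf_exp_ennreal[of w] that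
    by (simp only: less_imp_le)
  have coeff: "ennreal (a powr (real k + \<nu> / 2) / (fact k * Gamma (real k + \<nu> + 1))) *
      (ennreal (b powr (real l + \<nu> / 2) / (fact l * Gamma (real l + \<nu> + 1))) *
       (\<integral>\<^sup>+y. ennreal (y powr (real l + \<nu> / 2)) * (ennreal (y powr (real k + \<nu> / 2)) * ennreal (exp (- (p * y)))) * indicator {0<..} y \<partial>lborel)) =
      ennreal (1 / p) * (\<Sum>m. E A m k * (E B m l * d m))" (is "?L = _") for k l
  proof -
    have "(\<integral>\<^sup>+y. ennreal (y powr (real l + \<nu> / 2)) * (ennreal (y powr (real k + \<nu> / 2)) * ennreal (exp (- (p * y)))) * indicator {0<..} y \<partial>lborel) =
      (\<integral>\<^sup>+y. ennreal (y powr (real k + real l + \<nu>) * exp (- (p * y))) * indicator {0<..} y \<partial>lborel)"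
    proof (intro nn_integral_cong)
      fix y :: real
      have "y powr (real k + real l + \<nu>) = y powr (real l + \<nu> / 2) * y powr (real k + \<nu> / 2)"
        unfolding powr_add[symmetric] by (simp add: add_ac)
      then show "ennreal (y powr (real l + \<nu> / 2)) * (ennreal (y powr (real k + \<nu> / 2)) * ennreal (exp (- (p * y)))) * indicator {0<..} y
        = ennreal (y powr (real k + real l + \<nu>) * exp (- (p * y))) * indicator {0<..} y"
        by (simp add: ennreal_mult mult.assoc)
    qed
    also have "\<dots> = ennreal (Gamma (real k + real l + \<nu> + 1) / p powr (real k + real l + \<nu> + 1))"
      using gamma_nn_integral[of "real k + real l + \<nu>" p] assms by simp
    finally have "?L = ennreal (a powr (real k + \<nu> / 2) / (fact k * Gamma (real k + \<nu> + 1)) *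
      (b powr (real l + \<nu> / 2) / (fact l * Gamma (real l + \<nu> + 1)) * (Gamma (real k + real l + \<nu> + 1) / p powr (real k + real l + \<nu> + 1))))"
      using G[of k] G[of l] G(2)[of k l] by (simp only: ennreal_mult less_imp_le divide_nonneg_nonneg mult_nonneg_nonneg powr_ge_zero fact_ge_zero)
    also have "a powr (real k + \<nu> / 2) / (fact k * Gamma (real k + \<nu> + 1)) *
      (b powr (real l + \<nu> / 2) / (fact l * Gamma (real l + \<nu> + 1)) * (Gamma (real k + real l + \<nu> + 1) / p powr (real k + real l + \<nu> + 1)))
      = (1 / p) * (A powr (real k + \<nu> / 2) * B powr (real l + \<nu> / 2) *
         (Gamma (real k + real l + \<nu> + 1) / (fact k * Gamma (real k + \<nu> + 1) * (fact l * Gamma (real l + \<nu> + 1)))))"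
    proof -
      have "p powr (real k + real l + \<nu> + 1) = p * (p powr (real k + \<nu> / 2) * p powr (real l + \<nu> / 2))"
        using assms unfolding powr_add[symmetric] by (simp add: powr_add)
      then show ?thesis
        using assms unfolding A_def B_def by (simp add: powr_divide mult_ac)
    qed
    \<comment> \<open>The only coupling of \<open>k\<close> and \<open>l\<close> is through
      \<open>Gamma (k + l + \<nu> + 1)\<close>, and \<open>Gamma_Vandermonde\<close> removes
      it.\<close>
    also have "\<dots> = (1 / p) * (\<Sum>m\<in>{m. m \<le> k \<and> m \<le> l}. A powr (real k + \<nu> / 2) * B powr (real l + \<nu> / 2) *
        (1 / (fact (k - m) * fact (l - m) * fact m * Gamma (real m + \<nu> + 1))))"
      using assms by (subst Gamma_Vandermonde[symmetric]) (auto simp: sum_distrib_left)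
    also have "ennreal \<dots> = ennreal (1 / p) * (\<Sum>m\<in>{m. m \<le> k \<and> m \<le> l}. E A m k * (E B m l * d m))"
    proof -
      have "ennreal (A powr (real k + \<nu> / 2) * B powr (real l + \<nu> / 2) *
        (1 / (fact (k - m) * fact (l - m) * fact m * Gamma (real m + \<nu> + 1)))) = E A m k * (E B m l * d m)"
        if m: "m \<in> {m. m \<le> k \<and> m \<le> l}" for m
      proof -
        have "A powr (real k + \<nu> / 2) = A ^ (k - m) * A powr (real m + \<nu> / 2)"
             "B powr (real l + \<nu> / 2) = B ^ (l - m) * B powr (real m + \<nu> / 2)"
          using m AB by (auto simp: powr_add[symmetric] powr_realpow[symmetric] of_nat_diff)
        then show ?thesis
          using m AB G(1)[of m] by (simp add: E_def d_def powr_mult mult_ac flip: ennreal_mult)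
      qed
      moreover have "A powr (real k + \<nu> / 2) * B powr (real l + \<nu> / 2) *
        (1 / (fact (k - m) * fact (l - m) * fact m * Gamma (real m + \<nu> + 1))) \<ge> 0" for m
        using G(1)[of m] by (simp add: less_imp_le)
      ultimately show ?thesis
        using assms by (subst ennreal_mult) (auto simp: sum_nonneg simp flip: sum_ennreal)
    qed
    also have "(\<Sum>m\<in>{m. m \<le> k \<and> m \<le> l}. E A m k * (E B m l * d m)) = (\<Sum>m. E A m k * (E B m l * d m))"
      by (rule suminf_finite[symmetric]) (auto simp: E_def)
    finally show ?thesis .
  qed
  have "(\<integral>\<^sup>+y. ennreal (exp (- (p * y))) * bessel_series \<nu> (a * y) * bessel_series \<nu> (b * y) * indicator {0<..} y \<partial>lborel)
      = (\<integral>\<^sup>+y. (ennreal (exp (- (p * y))) * bessel_series \<nu> (b * y)) * bessel_series \<nu> (a * y) * indicator {0<..} y \<partial>lborel)"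
    by (simp add: mult_ac)
  also have "\<dots> = (\<Sum>k. ennreal (a powr (real k + \<nu> / 2) / (fact k * Gamma (real k + \<nu> + 1))) *
      (\<integral>\<^sup>+y. ennreal (y powr (real k + \<nu> / 2)) * (ennreal (exp (- (p * y))) * bessel_series \<nu> (b * y)) * indicator {0<..} y \<partial>lborel))"
    using assms by (intro nn_integral_bessel_series) auto
  also have "\<dots> = (\<Sum>k. ennreal (a powr (real k + \<nu> / 2) / (fact k * Gamma (real k + \<nu> + 1))) *
      (\<Sum>l. ennreal (b powr (real l + \<nu> / 2) / (fact l * Gamma (real l + \<nu> + 1))) *
       (\<integral>\<^sup>+y. ennreal (y powr (real l + \<nu> / 2)) * (ennreal (y powr (real k + \<nu> / 2)) * ennreal (exp (- (p * y)))) * indicator {0<..} y \<partial>lborel)))"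
  proof (intro suminf_cong arg_cong2[where f="(*)"] refl)
    fix k
    have "(\<integral>\<^sup>+y. ennreal (y powr (real k + \<nu> / 2)) * (ennreal (exp (- (p * y))) * bessel_series \<nu> (b * y)) * indicator {0<..} y \<partial>lborel) =
      (\<integral>\<^sup>+y. (ennreal (y powr (real k + \<nu> / 2)) * ennreal (exp (- (p * y)))) * bessel_series \<nu> (b * y) * indicator {0<..} y \<partial>lborel)"
      by (simp only: mult.assoc)
    also have "\<dots> = (\<Sum>l. ennreal (b powr (real l + \<nu> / 2) / (fact l * Gamma (real l + \<nu> + 1))) *
       (\<integral>\<^sup>+y. ennreal (y powr (real l + \<nu> / 2)) * (ennreal (y powr (real k + \<nu> / 2)) * ennreal (exp (- (p * y)))) * indicator {0<..} y \<partial>lborel))"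
      using assms by (intro nn_integral_bessel_series) auto
    finally show "(\<integral>\<^sup>+y. ennreal (y powr (real k + \<nu> / 2)) * (ennreal (exp (- (p * y))) * bessel_series \<nu> (b * y)) * indicator {0<..} y \<partial>lborel) = \<dots>" .
  qed
  also have "\<dots> = (\<Sum>k. \<Sum>l. ennreal (1 / p) * (\<Sum>m. E A m k * (E B m l * d m)))"
    by (simp only: ennreal_suminf_cmult[symmetric] coeff)
  also have "\<dots> = ennreal (1 / p) * (\<Sum>k. \<Sum>l. \<Sum>m. E A m k * (E B m l * d m))"
    by (simp only: ennreal_suminf_cmult)
  \<comment> \<open>The sum over \<open>m\<close> is moved outermost. The inner sums over
    \<open>l\<close> and \<open>k\<close> then give \<open>exp B\<close> and \<open>exp A\<close>,
    independently of \<open>m\<close>.\<close>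
  also have "(\<Sum>k. \<Sum>l. \<Sum>m. E A m k * (E B m l * d m)) = (\<Sum>k. \<Sum>m. \<Sum>l. E A m k * (E B m l * d m))"
    by (subst suminf_nn_commute) (rule refl)
  also have "\<dots> = (\<Sum>m. \<Sum>k. \<Sum>l. E A m k * (E B m l * d m))"
    by (rule suminf_nn_commute)
  also have "\<dots> = (\<Sum>m. ennreal (exp A) * (ennreal (exp B) * d m))"
    using AB by (simp only: ennreal_suminf_cmult ennreal_suminf_multc E)
  also have "\<dots> = ennreal (exp A) * (ennreal (exp B) * bessel_series \<nu> (A * B))"
    by (simp only: ennreal_suminf_cmult bessel_series_def d_def)
  also have "ennreal (1 / p) * \<dots> = ennreal (1 / p * (exp A * exp B)) * bessel_series \<nu> (A * B)"
  proof -
    have "ennreal (1 / p * (exp A * exp B)) = ennreal (1 / p) * (ennreal (exp A) * ennreal (exp B))"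
      using assms by (simp only: ennreal_mult less_imp_le divide_nonneg_nonneg zero_le_one exp_ge_zero mult_nonneg_nonneg)
    then show ?thesis by (simp only: mult.assoc)
  qed
  also have "1 / p * (exp A * exp B) = exp ((a + b) / p) / p"
    by (simp add: A_def B_def add_divide_distrib exp_add)
  also have "A * B = a * b / p\<^sup>2"
    by (simp add: A_def B_def power2_eq_square)
  finally show ?thesis .
qed

section \<open>The one-dimensional Laguerre kernel\<close>

definition laguerre_kernel_1 :: "real \<Rightarrow> real \<Rightarrow> real \<Rightarrow> real \<Rightarrow> real" where
  "laguerre_kernel_1 \<nu> t x y =
     1 / (2 * sinh (t / 2)) * exp (- (1 / 2) * (cosh (t / 2) / sinh (t / 2)) * (x + y))
     * bessel_I \<nu> (sqrt (x * y) / sinh (t / 2))"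

lemma laguerre_kernel_1_measurable [measurable]:
  assumes [measurable]: "f \<in> borel_measurable M" "g \<in> borel_measurable M"
  shows "(\<lambda>x. laguerre_kernel_1 \<nu> t (f x) (g x)) \<in> borel_measurable M"
  unfolding laguerre_kernel_1_def by measurable

lemma laguerre_kernel_1_sym: "laguerre_kernel_1 \<nu> t x y = laguerre_kernel_1 \<nu> t y x"
  by (simp add: laguerre_kernel_1_def add.commute mult.commute)

lemma laguerre_kernel_1_nonneg:
  assumes "0 \<le> \<nu>" "0 < t" "0 < x" "0 < y"
  shows "0 \<le> laguerre_kernel_1 \<nu> t x y"
  unfolding laguerre_kernel_1_def using assms
  by (intro mult_nonneg_nonneg bessel_I_nonneg) auto

text \<open>For fixed \<open>x\<close> the dependence on \<open>y\<close> is an exponential of rate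
  \<open>C / (2 * S)\<close> times a Bessel series at a multiple of \<open>y\<close>, the shape of
  the integrals computed above. The argument comes from
  \<open>(sqrt (x * y) / (2 * S))\<^sup>2\<close>.\<close>

lemma ennreal_laguerre_kernel_1:
  assumes "0 \<le> \<nu>" "0 < t" "0 < x" "0 < y"
  defines "S \<equiv> sinh (t / 2)" and "C \<equiv> cosh (t / 2)"
  shows "ennreal (laguerre_kernel_1 \<nu> t x y) =
    ennreal (exp (- (C / (2 * S) * x)) / (2 * S)) * (ennreal (exp (- (C / (2 * S) * y))) *
      bessel_series \<nu> (x / (4 * S\<^sup>2) * y))"
proof -
  have S: "S > 0" using assms by (simp add: S_def)
  have z: "0 < sqrt (x * y) / S" using S assms by simp
  have "(sqrt (x * y) / S / 2)\<^sup>2 = x / (4 * S\<^sup>2) * y"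
    using assms by (simp add: power_divide power_mult_distrib)
  then have b1: "bessel_series \<nu> (x / (4 * S\<^sup>2) * y) = ennreal (bessel_I \<nu> (sqrt (x * y) / S))"
    using ennreal_bessel_I[OF assms(1) z] by simp
  have k1: "laguerre_kernel_1 \<nu> t x y =
      exp (- (C / (2 * S) * x)) / (2 * S) * (exp (- (C / (2 * S) * y)) * bessel_I \<nu> (sqrt (x * y) / S))"
  proof -
    have "exp (- (1 / 2) * (C / S) * (x + y)) = exp (- (C / (2 * S) * x)) * exp (- (C / (2 * S) * y))"
    proof -
      have "- (1 / 2) * (C / S) * (x + y) = - (C / (2 * S) * x) + - (C / (2 * S) * y)"
        using S by (simp add: field_simps)
      then show ?thesis by (simp only: exp_add)
    qed
    then show ?thesis unfolding laguerre_kernel_1_def S_def C_def by simp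
  qed
  have "ennreal (exp (- (C / (2 * S) * y)) * bessel_I \<nu> (sqrt (x * y) / S)) =
      ennreal (exp (- (C / (2 * S) * y))) * ennreal (bessel_I \<nu> (sqrt (x * y) / S))"
    using bessel_I_nonneg[OF assms(1) z] by (intro ennreal_mult) auto
  then show ?thesis
    unfolding k1 b1 using S bessel_I_nonneg[OF assms(1) z] by (subst ennreal_mult) auto
qed

text \<open>The prefactor \<open>1 / (2 * S)\<close> and the \<open>1 / p\<close> of the integral
  combine to \<open>1 / C\<close>. The remaining exponent is
  \<open>- (x / 2) * tanh (t / 2)\<close>, which is negative and is dropped.\<close>

lemma nn_integral_laguerre_kernel_1_le:
  assumes "0 \<le> \<nu>" "0 < t" "0 < x"
  shows "(\<integral>\<^sup>+y. ennreal (laguerre_kernel_1 \<nu> t x y) * indicator {0<..} y \<partial>lborel) \<le> ennreal (1 / cosh (t / 2))"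
proof -
  define S C where "S = sinh (t / 2)" and "C = cosh (t / 2)"
  define p a where "p = C / (2 * S)" and "a = x / (4 * S\<^sup>2)"
  have SC: "S > 0" "C > 0" "C\<^sup>2 = S\<^sup>2 + 1"
    using assms cosh_square_eq[of "t / 2"] by (auto simp: S_def C_def)
  then have pos: "p > 0" "a > 0" using assms by (auto simp: p_def a_def)
  have "(\<integral>\<^sup>+y. ennreal (laguerre_kernel_1 \<nu> t x y) * indicator {0<..} y \<partial>lborel) =
      (\<integral>\<^sup>+y. ennreal (exp (- (p * x)) / (2 * S)) *
         (ennreal (exp (- (p * y))) * bessel_series \<nu> (a * y) * indicator {0<..} y) \<partial>lborel)"
    using assms
    by (intro nn_integral_cong)
       (auto simp: indicator_def ennreal_laguerre_kernel_1 p_def a_def S_def C_def mult.assoc)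
  also have "\<dots> = ennreal (exp (- (p * x)) / (2 * S)) *
      (\<integral>\<^sup>+y. ennreal (exp (- (p * y))) * bessel_series \<nu> (a * y) * indicator {0<..} y \<partial>lborel)"
    by (rule nn_integral_cmult) simp
  also have "\<dots> \<le> ennreal (exp (- (p * x)) / (2 * S)) * ennreal (exp (a / p) / p)"
    using pos assms by (intro mult_left_mono nn_integral_exp_bessel_series_le) auto
  also have "\<dots> = ennreal (exp (- (p * x) + a / p) / (2 * S * p))"
    unfolding exp_add using pos SC by (subst ennreal_mult[symmetric]) auto
  also have "\<dots> \<le> ennreal (1 / C)"
  proof (intro ennreal_leI)
    have "- (p * x) + a / p = - (x * (C\<^sup>2 - 1) / (2 * S * C))"
      using SC(1,2) by (simp add: p_def a_def field_simps power2_eq_square)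
    also have "\<dots> \<le> 0" using SC assms by simp
    finally have "exp (- (p * x) + a / p) \<le> 1" by simp
    moreover have "2 * S * p = C" using SC by (simp add: p_def)
    ultimately show "exp (- (p * x) + a / p) / (2 * S * p) \<le> 1 / C"
      using SC by (simp add: divide_right_mono)
  qed
  finally show ?thesis by (simp add: C_def)
qed

text \<open>Weber's integral with the rates \<open>q\<close> and \<open>r\<close> of the two kernels
  added. The addition formula gives \<open>p = R / (2 * S * T)\<close> with
  \<open>R = sinh ((s + t) / 2)\<close>, and this single identity turns prefactor, exponents and
  Bessel argument into those of time \<open>s + t\<close>.\<close>

lemma laguerre_kernel_1_chapman_kolmogorov:
  assumes "0 \<le> \<nu>" "0 < s" "0 < t" "0 < x" "0 < z"
  shows "(\<integral>\<^sup>+y. ennreal (laguerre_kernel_1 \<nu> s x y) * ennreal (laguerre_kernel_1 \<nu> t y z) * indicator {0<..} y \<partial>lborel)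
    = ennreal (laguerre_kernel_1 \<nu> (s + t) x z)"
proof -
  define S Cs T Ct R K where "S = sinh (s / 2)" and "Cs = cosh (s / 2)" and "T = sinh (t / 2)"
    and "Ct = cosh (t / 2)" and "R = sinh ((s + t) / 2)" and "K = cosh ((s + t) / 2)"
  define q r where "q = Cs / (2 * S)" and "r = Ct / (2 * T)"
  define p a b where "p = q + r" and "a = x / (4 * S\<^sup>2)" and "b = z / (4 * T\<^sup>2)"
  have pos: "S > 0" "T > 0" "Cs > 0" "Ct > 0" "R > 0"
    using assms by (auto simp: S_def Cs_def T_def Ct_def R_def)
  have R: "R = S * Ct + Cs * T" and K: "K = Cs * Ct + S * T"
    using sinh_add[of "s / 2" "t / 2"] cosh_add[of "s / 2" "t / 2"]
    by (simp_all add: R_def K_def S_def T_def Cs_def Ct_def add_divide_distrib)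
  have sq: "Cs\<^sup>2 = S\<^sup>2 + 1" "Ct\<^sup>2 = T\<^sup>2 + 1"
    by (simp_all add: S_def T_def Cs_def Ct_def cosh_square_eq)
  have p: "p = R / (2 * (S * T))"
    using pos by (simp add: p_def q_def r_def R field_simps)
  have pp: "p > 0" "a > 0" "b > 0" using pos assms by (auto simp: p a_def b_def)
  have ex: "- (q * x) + a / p = - (K / (2 * R) * x)"
  proof -
    \<comment> \<open>The addition formulas for \<open>R\<close> and \<open>K\<close> together with
      \<open>Cs\<^sup>2 = S\<^sup>2 + 1\<close>.\<close>
    have RK: "T - Cs * R = - (S * K)"
    proof -
      have "Cs * Cs * T = (S * S + 1) * T" using sq(1) by (simp add: power2_eq_square)
      then show ?thesis unfolding R K by (simp add: algebra_simps)
    qed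
    have "x * (T - Cs * R) / (2 * S * R) = - (K / (2 * R) * x)"
      unfolding RK using pos by (simp add: field_simps)
    moreover have "- (q * x) + a / p = x * (T - Cs * R) / (2 * S * R)"
      using pos unfolding p q_def a_def by (simp add: field_simps power2_eq_square)
    ultimately show ?thesis by simp
  qed
  have ez: "- (r * z) + b / p = - (K / (2 * R) * z)"
  proof -
    have RK: "S - Ct * R = - (T * K)"
    proof -
      have "Ct * Ct * S = (T * T + 1) * S" using sq(2) by (simp add: power2_eq_square)
      then show ?thesis unfolding R K by (simp add: algebra_simps)
    qed
    have "z * (S - Ct * R) / (2 * T * R) = - (K / (2 * R) * z)"
      unfolding RK using pos by (simp add: field_simps)
    moreover have "- (r * z) + b / p = z * (S - Ct * R) / (2 * T * R)"
      using pos unfolding p r_def b_def by (simp add: field_simps power2_eq_square)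
    ultimately show ?thesis by simp
  qed
  have ab: "a * b / p\<^sup>2 = x / (4 * R\<^sup>2) * z"
    using pos unfolding p a_def b_def by (simp add: field_simps power2_eq_square)
  have "(\<integral>\<^sup>+y. ennreal (laguerre_kernel_1 \<nu> s x y) * ennreal (laguerre_kernel_1 \<nu> t y z) * indicator {0<..} y \<partial>lborel) =
      (\<integral>\<^sup>+y. ennreal (exp (- (q * x)) / (2 * S) * (exp (- (r * z)) / (2 * T))) *
        (ennreal (exp (- (p * y))) * bessel_series \<nu> (a * y) * bessel_series \<nu> (b * y) * indicator {0<..} y) \<partial>lborel)"
  proof (intro nn_integral_cong)
    fix y :: real
    show "ennreal (laguerre_kernel_1 \<nu> s x y) * ennreal (laguerre_kernel_1 \<nu> t y z) * indicator {0<..} y =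
      ennreal (exp (- (q * x)) / (2 * S) * (exp (- (r * z)) / (2 * T))) *
        (ennreal (exp (- (p * y))) * bessel_series \<nu> (a * y) * bessel_series \<nu> (b * y) * indicator {0<..} y)"
    proof (cases "y > 0")
      case True
      have "ennreal (laguerre_kernel_1 \<nu> s x y) =
          ennreal (exp (- (q * x)) / (2 * S)) * (ennreal (exp (- (q * y))) * bessel_series \<nu> (a * y))"
        using ennreal_laguerre_kernel_1[of \<nu> s x y] assms True by (simp add: q_def a_def S_def Cs_def)
      moreover have "ennreal (laguerre_kernel_1 \<nu> t y z) =
          ennreal (exp (- (r * z)) / (2 * T)) * (ennreal (exp (- (r * y))) * bessel_series \<nu> (b * y))"
        using ennreal_laguerre_kernel_1[of \<nu> t z y] assms True laguerre_kernel_1_sym[of \<nu> t y z]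
        by (simp add: r_def b_def T_def Ct_def)
      moreover have "ennreal (exp (- (p * y))) = ennreal (exp (- (q * y))) * ennreal (exp (- (r * y)))"
        by (simp add: p_def distrib_right exp_add[symmetric] flip: ennreal_mult)
      moreover have "ennreal (exp (- (q * x)) / (2 * S) * (exp (- (r * z)) / (2 * T))) =
          ennreal (exp (- (q * x)) / (2 * S)) * ennreal (exp (- (r * z)) / (2 * T))"
        using pos by (intro ennreal_mult) auto
      ultimately show ?thesis using True by (simp only: mult_ac)
    qed simp
  qed
  also have "\<dots> = ennreal (exp (- (q * x)) / (2 * S) * (exp (- (r * z)) / (2 * T))) *
      (\<integral>\<^sup>+y. ennreal (exp (- (p * y))) * bessel_series \<nu> (a * y) * bessel_series \<nu> (b * y) * indicator {0<..} y \<partial>lborel)"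
    by (rule nn_integral_cmult) simp
  also have "\<dots> = ennreal (exp (- (q * x)) / (2 * S) * (exp (- (r * z)) / (2 * T))) *
      (ennreal (exp ((a + b) / p) / p) * bessel_series \<nu> (a * b / p\<^sup>2))"
    using pp assms by (subst nn_integral_exp_bessel_series_mult) auto
  also have "\<dots> = ennreal (exp (- (q * x)) / (2 * S) * (exp (- (r * z)) / (2 * T)) * (exp ((a + b) / p) / p)) *
      bessel_series \<nu> (a * b / p\<^sup>2)"
    unfolding mult.assoc[symmetric] using pos pp by (subst ennreal_mult[symmetric]) auto
  also have "exp (- (q * x)) / (2 * S) * (exp (- (r * z)) / (2 * T)) * (exp ((a + b) / p) / p) =
      exp (- (K / (2 * R) * x)) / (2 * R) * exp (- (K / (2 * R) * z))"
  proof -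
    have "exp (- (K / (2 * R) * x)) * exp (- (K / (2 * R) * z)) = exp (- (q * x)) * exp (- (r * z)) * exp ((a + b) / p)"
      unfolding ex[symmetric] ez[symmetric] exp_add[symmetric] by (simp add: add_divide_distrib)
    moreover have "4 * S * T * p = 2 * R" using pos by (simp add: p)
    ultimately show ?thesis using pos pp by (simp add: field_simps)
  qed
  also have "ennreal \<dots> * bessel_series \<nu> (a * b / p\<^sup>2) = ennreal (laguerre_kernel_1 \<nu> (s + t) x z)"
  proof -
    have "ennreal (exp (- (K / (2 * R) * x)) / (2 * R) * exp (- (K / (2 * R) * z))) =
        ennreal (exp (- (K / (2 * R) * x)) / (2 * R)) * ennreal (exp (- (K / (2 * R) * z)))"
      using pos by (intro ennreal_mult) auto
    then show ?thesis
      using ennreal_laguerre_kernel_1[of \<nu> "s + t" x z] assms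
      by (simp only: ab R_def[symmetric] K_def[symmetric] mult.assoc add_pos_pos)
  qed
  finally show ?thesis .
qed

text \<open>The image of \<open>y powr (\<nu> / 2) * exp (- (l * y))\<close> under the
  one-dimensional kernel, in closed form. For \<open>l = 1 / 2\<close> that function is the lowest
  Laguerre function, and the formula reduces to multiplication by the eigenvalue
  \<open>exp (- (\<nu> + 1) * t / 2)\<close>.\<close>

definition laguerre_moment :: "real \<Rightarrow> real \<Rightarrow> real \<Rightarrow> real \<Rightarrow> real" where
  "laguerre_moment \<nu> l x t = x powr (\<nu> / 2) * (cosh (t / 2) + 2 * l * sinh (t / 2)) powr (- (\<nu> + 1)) *
     exp (- (x * (sinh (t / 2) + 2 * l * cosh (t / 2)) / (2 * (cosh (t / 2) + 2 * l * sinh (t / 2)))))"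

text \<open>The factor \<open>exp (- (l * y))\<close> only shifts the rate of the kernel from
  \<open>q\<close> to \<open>q + l = D / (2 * S)\<close>; this is where the combination
  \<open>D = C + 2 * l * S\<close> in the closed form originates.\<close>

lemma nn_integral_laguerre_kernel_1_moment:
  assumes "0 \<le> \<nu>" "0 < t" "0 < x" "0 \<le> l"
  shows "(\<integral>\<^sup>+y. ennreal (laguerre_kernel_1 \<nu> t x y) * ennreal (y powr (\<nu> / 2) * exp (- (l * y))) * indicator {0<..} y \<partial>lborel)
    = ennreal (laguerre_moment \<nu> l x t)"
proof -
  define S C where "S = sinh (t / 2)" and "C = cosh (t / 2)"
  define q a where "q = C / (2 * S)" and "a = x / (4 * S\<^sup>2)"
  define p D where "p = q + l" and "D = C + 2 * l * S"
  have SC: "S > 0" "C > 0" "C\<^sup>2 = S\<^sup>2 + 1"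
    using assms cosh_square_eq[of "t / 2"] by (auto simp: S_def C_def)
  have D: "D > 0" using SC assms by (simp add: D_def add_pos_nonneg)
  have p: "p = D / (2 * S)" using SC by (simp add: p_def q_def D_def field_simps)
  have pos: "p > 0" "a > 0" using SC D assms by (auto simp: p a_def)
  have "(\<integral>\<^sup>+y. ennreal (laguerre_kernel_1 \<nu> t x y) * ennreal (y powr (\<nu> / 2) * exp (- (l * y))) * indicator {0<..} y \<partial>lborel) =
      (\<integral>\<^sup>+y. ennreal (exp (- (q * x)) / (2 * S)) *
         (ennreal (y powr (\<nu> / 2) * exp (- (p * y))) * bessel_series \<nu> (a * y) * indicator {0<..} y) \<partial>lborel)"
  proof (intro nn_integral_cong)
    fix y :: real
    show "ennreal (laguerre_kernel_1 \<nu> t x y) * ennreal (y powr (\<nu> / 2) * exp (- (l * y))) * indicator {0<..} y =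
       ennreal (exp (- (q * x)) / (2 * S)) *
         (ennreal (y powr (\<nu> / 2) * exp (- (p * y))) * bessel_series \<nu> (a * y) * indicator {0<..} y)"
    proof (cases "y > 0")
      case True
      have "ennreal (y powr (\<nu> / 2) * exp (- (p * y))) =
          ennreal (exp (- (q * y))) * ennreal (y powr (\<nu> / 2) * exp (- (l * y)))"
        by (simp add: p_def distrib_right exp_diff exp_minus field_simps flip: ennreal_mult)
      moreover have "ennreal (laguerre_kernel_1 \<nu> t x y) =
          ennreal (exp (- (q * x)) / (2 * S)) * (ennreal (exp (- (q * y))) * bessel_series \<nu> (a * y))"
        using ennreal_laguerre_kernel_1[of \<nu> t x y] assms True by (simp add: q_def a_def S_def C_def)
      ultimately show ?thesis using True by (simp only: mult_ac)
    qed simp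
  qed
  also have "\<dots> = ennreal (exp (- (q * x)) / (2 * S)) *
      (\<integral>\<^sup>+y. ennreal (y powr (\<nu> / 2) * exp (- (p * y))) * bessel_series \<nu> (a * y) * indicator {0<..} y \<partial>lborel)"
    by (rule nn_integral_cmult) simp
  also have "\<dots> = ennreal (exp (- (q * x)) / (2 * S)) * ennreal (a powr (\<nu> / 2) / p powr (\<nu> + 1) * exp (a / p))"
    using pos assms by (subst nn_integral_powr_exp_bessel_series) auto
  also have "\<dots> = ennreal (exp (- (q * x)) / (2 * S) * (a powr (\<nu> / 2) / p powr (\<nu> + 1) * exp (a / p)))"
    using SC by (simp flip: ennreal_mult)
  also have "exp (- (q * x)) / (2 * S) * (a powr (\<nu> / 2) / p powr (\<nu> + 1) * exp (a / p)) = laguerre_moment \<nu> l x t"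
  proof -
    have a1: "a powr (\<nu> / 2) = x powr (\<nu> / 2) / (2 * S) powr \<nu>"
    proof -
      have "4 * S\<^sup>2 = (2 * S) powr 2" using SC by (simp add: power_mult_distrib)
      then have "(4 * S\<^sup>2) powr (\<nu> / 2) = (2 * S) powr \<nu>" by (simp only: powr_powr) simp
      then show ?thesis using SC assms by (simp add: a_def powr_divide)
    qed
    have p1: "p powr (\<nu> + 1) = D powr (\<nu> + 1) / ((2 * S) powr \<nu> * (2 * S))"
      using SC D unfolding p by (simp add: powr_divide powr_add)
    have "- (q * x) + a / p = - (x * (S + 2 * l * C) / (2 * D))"
    proof -
      have "- (q * x) + a / p = x * (1 - C * D) / (2 * S * D)"
        using SC D unfolding p q_def a_def by (simp add: field_simps power2_eq_square)
      also have "1 - C * D = - (S * (S + 2 * l * C))"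
        using SC(3) by (simp add: D_def algebra_simps power2_eq_square)
      finally show ?thesis using SC D by simp
    qed
    then have e1: "exp (- (x * (S + 2 * l * C) / (2 * D))) = exp (- (q * x)) * exp (a / p)"
      by (simp only: exp_add[symmetric])
    \<comment> \<open>All powers of \<open>2 * S\<close> cancel: \<open>\<nu>\<close> of them
      between \<open>a powr (\<nu> / 2)\<close> and \<open>p powr (\<nu> + 1)\<close>, and the last
      one against the prefactor of the kernel.\<close>
    have rearrange: "e / s * (w / u / (d / (u * s)) * f) = w * inverse d * (e * f)"
      if "u \<noteq> 0" "d \<noteq> 0" "s \<noteq> 0" for e f s w u d :: real
      using that by (simp add: field_simps)
    show ?thesis
      unfolding laguerre_moment_def S_def[symmetric] C_def[symmetric] D_def[symmetric] a1 p1 e1 powr_minus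
      using SC D by (intro rearrange) auto
  qed
  finally show ?thesis .
qed

lemma laguerre_moment_nonneg: "0 \<le> laguerre_moment \<nu> l x t"
  by (simp add: laguerre_moment_def)

lemma tendsto_laguerre_moment:
  "(laguerre_moment \<nu> l x \<longlongrightarrow> x powr (\<nu> / 2) * exp (- (l * x))) (at_right 0)"
proof -
  have "((\<lambda>t. x powr (\<nu> / 2) * (cosh (t / 2) + 2 * l * sinh (t / 2)) powr (- (\<nu> + 1)) *
     exp (- (x * (sinh (t / 2) + 2 * l * cosh (t / 2)) / (2 * (cosh (t / 2) + 2 * l * sinh (t / 2)))))) \<longlongrightarrow>
     x powr (\<nu> / 2) * (cosh (0 / 2) + 2 * l * sinh (0 / 2)) powr (- (\<nu> + 1)) *
     exp (- (x * (sinh (0 / 2) + 2 * l * cosh (0 / 2)) / (2 * (cosh (0 / 2) + 2 * l * sinh (0 / 2)))))) (at_right 0)"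
    by (intro tendsto_intros) auto
  then show ?thesis
    unfolding laguerre_moment_def[abs_def] by (simp add: mult.commute)
qed

text \<open>Concentration at the diagonal is a Chebyshev estimate for the statistic \<open>exp (- y)\<close> under
  the weight \<open>y powr (\<nu> / 2)\<close>, against which the kernel has explicit exponential moments.\<close>

lemma laguerre_kernel_1_near_diagonal_ge:
  assumes "0 \<le> \<nu>" "0 < x" "0 < \<delta>" "0 < t"
  defines "E \<equiv> \<lambda>l. laguerre_moment \<nu> l x t"
  defines "\<eta> \<equiv> (exp (- x) - exp (- (x + \<delta>)))\<^sup>2"
  shows "ennreal ((E 0 - (E 2 - 2 * exp (- x) * E 1 + exp (- 2 * x) * E 0) / \<eta>) / (x + \<delta>) powr (\<nu> / 2)) \<le>
    (\<integral>\<^sup>+y. ennreal (laguerre_kernel_1 \<nu> t x y) * indicator {x - \<delta><..<x + \<delta>} y * indicator {0<..} y \<partial>lborel)"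
    (is "_ \<le> ?m")
proof -
  define h where "h = (\<lambda>l y. ennreal (y powr (\<nu> / 2) * exp (- (l * y))))"
  define k where "k = (\<lambda>y. ennreal (laguerre_kernel_1 \<nu> t x y) * indicator {0<..} y)"
  define F where "F = - {x - \<delta><..<x + \<delta>}"
  have [measurable]: "h l \<in> borel_measurable borel" "k \<in> borel_measurable borel" "F \<in> sets borel" for l
    unfolding h_def k_def F_def by measurable
  have moment: "(\<integral>\<^sup>+y. k y * h l y \<partial>lborel) = ennreal (E l)" if "0 \<le> l" for l
    using nn_integral_laguerre_kernel_1_moment[of \<nu> t x l] assms that by (simp add: h_def k_def mult_ac)
  have E: "0 \<le> E l" for l by (simp add: E_def laguerre_moment_nonneg)
  have \<eta>: "0 < \<eta>" using assms by (simp add: \<eta>_def)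
  \<comment> \<open>The weighted mass outside the \<open>\<delta>\<close>-interval around
    \<open>x\<close>; it is shown finite first so that it can later be subtracted.\<close>
  define far where "far = (\<integral>\<^sup>+y. k y * h 0 y * indicator F y \<partial>lborel)"
  have far_fin: "far \<le> ennreal (E 0)"
    unfolding far_def moment[symmetric, OF order_refl] by (intro nn_integral_mono) (simp add: indicator_def)
  then obtain \<phi> where \<phi>: "0 \<le> \<phi>" "far = ennreal \<phi>"
    by (cases far) (auto simp: top_unique)
  \<comment> \<open>The integral of
    \<open>\<eta> * indicator F y \<le> (exp (- y) - exp (- x))\<^sup>2\<close> against the weighted
    kernel. The square is expanded and its cross term stands on the left, since
    \<open>ennreal\<close> has no negative numbers.\<close>
  have "ennreal \<eta> * far + ennreal (2 * exp (- x)) * ennreal (E 1) =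
      (\<integral>\<^sup>+y. ennreal \<eta> * (k y * h 0 y * indicator F y) + ennreal (2 * exp (- x)) * (k y * h 1 y) \<partial>lborel)"
    by (simp add: far_def moment[symmetric] nn_integral_add nn_integral_cmult)
  also have "\<dots> \<le> (\<integral>\<^sup>+y. k y * h 2 y + ennreal (exp (- 2 * x)) * (k y * h 0 y) \<partial>lborel)"
  proof (intro nn_integral_mono)
    fix y :: real
    have "\<eta> * indicator F y + 2 * exp (- x) * exp (- y) \<le> exp (- (2 * y)) + exp (- 2 * x)"
    proof -
      have "\<eta> * indicator F y \<le> (exp (- y) - exp (- x))\<^sup>2"
      proof (cases "y \<in> F")
        case True
        then consider "y \<ge> x + \<delta>" | "y \<le> x - \<delta>" by (auto simp: F_def)
        then show ?thesis
        proof cases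
          case 1
          then have "(exp (- x) - exp (- (x + \<delta>)))\<^sup>2 \<le> (exp (- x) - exp (- y))\<^sup>2"
            using assms by (intro power_mono) auto
          then show ?thesis using True by (simp add: \<eta>_def power2_commute)
        next
          case 2
          \<comment> \<open>On the left of \<open>x\<close> the exponential changes faster: the gap
            at \<open>x - \<delta>\<close> is \<open>exp \<delta>\<close> times the gap at
            \<open>x + \<delta>\<close>. Hence \<open>\<eta>\<close>, defined by the right end,
            serves for both sides.\<close>
          have "exp (- x) - exp (- (x + \<delta>)) \<le> exp \<delta> * (exp (- x) - exp (- (x + \<delta>)))"
            using assms by (simp add: mult_le_cancel_right1)
          also have "\<dots> = exp (- (x - \<delta>)) - exp (- x)"
            by (simp add: right_diff_distrib flip: exp_add)
          also have "\<dots> \<le> exp (- y) - exp (- x)" using 2 by simp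
          finally have "(exp (- x) - exp (- (x + \<delta>)))\<^sup>2 \<le> (exp (- y) - exp (- x))\<^sup>2"
            using assms by (intro power_mono) auto
          then show ?thesis using True by (simp add: \<eta>_def)
        qed
      qed simp
      also have "\<dots> = exp (- (2 * y)) + exp (- 2 * x) - 2 * exp (- x) * exp (- y)"
        by (simp add: power2_diff exp_double[symmetric])
      finally show ?thesis by simp
    qed
    then have "y powr (\<nu> / 2) * (\<eta> * indicator F y + 2 * exp (- x) * exp (- y)) \<le>
        y powr (\<nu> / 2) * (exp (- (2 * y)) + exp (- 2 * x))"
      by (intro mult_left_mono) auto
    then have "ennreal (y powr (\<nu> / 2) * (\<eta> * indicator F y + 2 * exp (- x) * exp (- y))) \<le>
        ennreal (y powr (\<nu> / 2) * (exp (- (2 * y)) + exp (- 2 * x)))" by (rule ennreal_leI)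
    also have "ennreal (y powr (\<nu> / 2) * (\<eta> * indicator F y + 2 * exp (- x) * exp (- y))) =
        ennreal \<eta> * (h 0 y * indicator F y) + ennreal (2 * exp (- x)) * h 1 y"
      using \<eta> by (simp add: h_def distrib_left ennreal_mult ennreal_indicator mult_ac)
    also have "ennreal (y powr (\<nu> / 2) * (exp (- (2 * y)) + exp (- 2 * x))) = h 2 y + ennreal (exp (- 2 * x)) * h 0 y"
      by (simp add: h_def distrib_left ennreal_mult mult_ac)
    finally have "k y * (ennreal \<eta> * (h 0 y * indicator F y) + ennreal (2 * exp (- x)) * h 1 y) \<le>
        k y * (h 2 y + ennreal (exp (- 2 * x)) * h 0 y)" by (intro mult_left_mono) auto
    then show "ennreal \<eta> * (k y * h 0 y * indicator F y) + ennreal (2 * exp (- x)) * (k y * h 1 y) \<le>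
        k y * h 2 y + ennreal (exp (- 2 * x)) * (k y * h 0 y)"
      by (simp only: distrib_left mult_ac)
  qed
  also have "\<dots> = ennreal (E 2) + ennreal (exp (- 2 * x)) * ennreal (E 0)"
    by (simp add: moment[symmetric] nn_integral_add nn_integral_cmult)
  finally have "ennreal (\<eta> * \<phi> + 2 * exp (- x) * E 1) \<le> ennreal (E 2 + exp (- 2 * x) * E 0)"
    using \<phi> \<eta> E by (simp add: ennreal_mult)
  then have "\<eta> * \<phi> + 2 * exp (- x) * E 1 \<le> E 2 + exp (- 2 * x) * E 0"
    using E by (subst (asm) ennreal_le_iff) auto
  then have \<phi>_le: "\<phi> \<le> (E 2 - 2 * exp (- x) * E 1 + exp (- 2 * x) * E 0) / \<eta>"
    using \<eta> by (simp add: field_simps)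
  show ?thesis
  proof (cases ?m)
    case top
    then show ?thesis by (simp only: top_greatest)
  next
    case (real \<mu>)
    \<comment> \<open>The weighted mass splits into near and far part. Bounding the weight by
      \<open>(x + \<delta>) powr (\<nu> / 2)\<close> on the near part converts the weighted estimate
      into one for the mass itself.\<close>
    have "ennreal (E 0) = (\<integral>\<^sup>+y. k y * h 0 y * indicator {x - \<delta><..<x + \<delta>} y + k y * h 0 y * indicator F y \<partial>lborel)"
      unfolding moment[symmetric, OF order_refl]
      by (intro nn_integral_cong) (auto simp: indicator_def F_def)
    also have "\<dots> = (\<integral>\<^sup>+y. k y * h 0 y * indicator {x - \<delta><..<x + \<delta>} y \<partial>lborel) + far"
      unfolding far_def by (rule nn_integral_add) auto
    finally have split: "ennreal (E 0) = (\<integral>\<^sup>+y. k y * h 0 y * indicator {x - \<delta><..<x + \<delta>} y \<partial>lborel) + ennreal \<phi>"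
      unfolding \<phi>(2) .
    have "(\<integral>\<^sup>+y. k y * h 0 y * indicator {x - \<delta><..<x + \<delta>} y \<partial>lborel) \<le>
        (\<integral>\<^sup>+y. ennreal ((x + \<delta>) powr (\<nu> / 2)) *
          (ennreal (laguerre_kernel_1 \<nu> t x y) * indicator {x - \<delta><..<x + \<delta>} y * indicator {0<..} y) \<partial>lborel)"
    proof (intro nn_integral_mono)
      fix y :: real
      show "k y * h 0 y * indicator {x - \<delta><..<x + \<delta>} y \<le> ennreal ((x + \<delta>) powr (\<nu> / 2)) *
          (ennreal (laguerre_kernel_1 \<nu> t x y) * indicator {x - \<delta><..<x + \<delta>} y * indicator {0<..} y)"
      proof (cases "0 < y \<and> y \<in> {x - \<delta><..<x + \<delta>}")
        case True
        then have "h 0 y \<le> ennreal ((x + \<delta>) powr (\<nu> / 2))"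
          unfolding h_def using assms by (intro ennreal_leI) (auto intro!: powr_mono2)
        from mult_left_mono[OF this, of "ennreal (laguerre_kernel_1 \<nu> t x y)"]
        show ?thesis using True by (simp add: k_def mult.commute)
      qed (auto simp: k_def indicator_def)
    qed
    also have "\<dots> = ennreal ((x + \<delta>) powr (\<nu> / 2)) * ennreal \<mu>"
      unfolding real(2)[symmetric] by (rule nn_integral_cmult) simp
    also have "\<dots> = ennreal ((x + \<delta>) powr (\<nu> / 2) * \<mu>)"
      using real(1) by (subst ennreal_mult) auto
    finally have "ennreal (E 0) \<le> ennreal ((x + \<delta>) powr (\<nu> / 2) * \<mu>) + ennreal \<phi>"
      unfolding split by (rule add_right_mono)
    also have "\<dots> = ennreal ((x + \<delta>) powr (\<nu> / 2) * \<mu> + \<phi>)"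
      using \<phi>(1) real(1) by (subst ennreal_plus) auto
    finally have "E 0 - \<phi> \<le> (x + \<delta>) powr (\<nu> / 2) * \<mu>"
      using \<phi>(1) real(1) by (subst (asm) ennreal_le_iff) auto
    then have "E 0 - (E 2 - 2 * exp (- x) * E 1 + exp (- 2 * x) * E 0) / \<eta> \<le> (x + \<delta>) powr (\<nu> / 2) * \<mu>"
      using \<phi>_le by linarith
    then have "(E 0 - (E 2 - 2 * exp (- x) * E 1 + exp (- 2 * x) * E 0) / \<eta>) / (x + \<delta>) powr (\<nu> / 2) \<le> \<mu>"
      using assms by (simp add: divide_le_eq mult.commute)
    then show ?thesis unfolding real(2) by (rule ennreal_leI)
  qed
qed

lemma laguerre_kernel_1_near_diagonal_le_1:
  assumes "0 \<le> \<nu>" "0 < x" "0 < t" and [measurable]: "A \<in> sets borel"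
  shows "(\<integral>\<^sup>+y. ennreal (laguerre_kernel_1 \<nu> t x y) * indicator A y * indicator {0<..} y \<partial>lborel) \<le> 1"
proof -
  have "(\<integral>\<^sup>+y. ennreal (laguerre_kernel_1 \<nu> t x y) * indicator A y * indicator {0<..} y \<partial>lborel) \<le>
      (\<integral>\<^sup>+y. ennreal (laguerre_kernel_1 \<nu> t x y) * indicator {0<..} y \<partial>lborel)"
    by (intro nn_integral_mono) (simp add: indicator_def)
  also have "\<dots> \<le> ennreal (1 / cosh (t / 2))"
    using assms by (intro nn_integral_laguerre_kernel_1_le) auto
  also have "\<dots> \<le> ennreal 1"
    using cosh_real_ge_1[of "t / 2"] by (intro ennreal_leI) (simp add: divide_le_eq)
  finally show ?thesis by simp
qed

text \<open>The mass is at most \<open>1\<close>. From below, the Chebyshev bound tends to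
  \<open>(x / (x + \<delta>)) powr (\<nu> / 2)\<close>, which stays below \<open>1\<close> when
  \<open>\<nu> > 0\<close>; hence \<open>\<delta>\<close> is fixed first, close enough to
  \<open>0\<close> for the given \<open>r\<close>, and only then \<open>t\<close> tends to
  \<open>0\<close>. Real values instead of \<open>ennreal\<close> are used because finite products
  of these limits are taken later.\<close>

lemma laguerre_kernel_1_concentrates:
  assumes "0 \<le> \<nu>" "0 < x" and "open A" "x \<in> A"
  shows "((\<lambda>t. enn2real (\<integral>\<^sup>+y. ennreal (laguerre_kernel_1 \<nu> t x y) * indicator A y * indicator {0<..} y \<partial>lborel)) \<longlongrightarrow> 1) (at_right 0)"
    (is "((\<lambda>t. enn2real (?m t)) \<longlongrightarrow> 1) _")
proof (rule order_tendstoI)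
  have A[measurable]: "A \<in> sets borel" using assms by auto
  have le_1: "?m t \<le> 1" if "0 < t" for t
    using assms that by (intro laguerre_kernel_1_near_diagonal_le_1) auto
  have t_pos: "eventually (\<lambda>t::real. 0 < t) (at_right 0)" by (rule eventually_at_right_less)
  {
    fix r :: real assume "1 < r"
    show "eventually (\<lambda>t. enn2real (?m t) < r) (at_right 0)"
      using t_pos
    proof eventually_elim
      case (elim t)
      have "enn2real (?m t) \<le> 1" using enn2real_mono[OF le_1[OF elim]] by simp
      then show ?case using \<open>1 < r\<close> by simp
    qed
  next
    fix r :: real assume r: "r < 1"
    obtain e where e: "0 < e" "ball x e \<subseteq> A" using assms open_contains_ball by blast
    have "((\<lambda>\<delta>. (x / (x + \<delta>)) powr (\<nu> / 2)) \<longlongrightarrow> (x / (x + 0)) powr (\<nu> / 2)) (at_right 0)"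
      using assms by (intro tendsto_intros) auto
    then have "eventually (\<lambda>\<delta>. r < (x / (x + \<delta>)) powr (\<nu> / 2)) (at_right 0)"
      using r assms by (intro order_tendstoD(1)) auto
    moreover have "eventually (\<lambda>\<delta>. \<delta> \<in> {0<..<e}) (at_right 0)"
      using e by (intro eventually_at_right_real) 
    ultimately have "eventually (\<lambda>\<delta>. r < (x / (x + \<delta>)) powr (\<nu> / 2) \<and> \<delta> \<in> {0<..<e}) (at_right 0)"
      by (rule eventually_conj)
    then obtain \<delta> where \<delta>: "r < (x / (x + \<delta>)) powr (\<nu> / 2)" "0 < \<delta>" "\<delta> < e"
      by (force dest: eventually_happens' [rotated])
    define E where "E = (\<lambda>l. laguerre_moment \<nu> l x)"
    define \<eta> where "\<eta> = (exp (- x) - exp (- (x + \<delta>)))\<^sup>2"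
    define L where "L = (\<lambda>t. (E 0 t - (E 2 t - 2 * exp (- x) * E 1 t + exp (- 2 * x) * E 0 t) / \<eta>) / (x + \<delta>) powr (\<nu> / 2))"
    have E: "(E l \<longlongrightarrow> x powr (\<nu> / 2) * exp (- (l * x))) (at_right 0)" for l
      unfolding E_def by (rule tendsto_laguerre_moment)
    have \<eta>: "\<eta> \<noteq> 0" using \<delta> by (simp add: \<eta>_def)
    have L: "(L \<longlongrightarrow> (x powr (\<nu> / 2) * exp (- (0 * x)) - (x powr (\<nu> / 2) * exp (- (2 * x)) -
        2 * exp (- x) * (x powr (\<nu> / 2) * exp (- (1 * x))) + exp (- 2 * x) * (x powr (\<nu> / 2) * exp (- (0 * x)))) / \<eta>)
        / (x + \<delta>) powr (\<nu> / 2)) (at_right 0)"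
      unfolding L_def using \<eta> assms \<delta> by (intro tendsto_intros E) auto
    \<comment> \<open>In the limit the weighted second moment of \<open>exp (- y)\<close> about
      \<open>exp (- x)\<close> vanishes, so the Chebyshev error disappears for fixed
      \<open>\<delta>\<close>.\<close>
    have num: "x powr (\<nu> / 2) * exp (- (2 * x)) - 2 * exp (- x) * (x powr (\<nu> / 2) * exp (- (1 * x))) +
        exp (- 2 * x) * (x powr (\<nu> / 2) * exp (- (0 * x))) = 0"
    proof -
      have "exp (- (2 * x)) = exp (- x) * exp (- x)" "exp (- 2 * x) = exp (- x) * exp (- x)"
        by (simp_all flip: exp_add)
      then show ?thesis by (simp only: mult_1_left mult_zero_left) (simp add: algebra_simps)
    qed
    have "(L \<longlongrightarrow> x powr (\<nu> / 2) / (x + \<delta>) powr (\<nu> / 2)) (at_right 0)"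
      using L unfolding num by simp
    moreover have "r < x powr (\<nu> / 2) / (x + \<delta>) powr (\<nu> / 2)"
      using \<delta> assms by (simp add: powr_divide)
    ultimately have "eventually (\<lambda>t. r < L t) (at_right 0)" by (rule order_tendstoD(1))
    then show "eventually (\<lambda>t. r < enn2real (?m t)) (at_right 0)"
      using t_pos
    proof eventually_elim
      case (elim t)
      have "ennreal (L t) \<le> (\<integral>\<^sup>+y. ennreal (laguerre_kernel_1 \<nu> t x y) * indicator {x - \<delta><..<x + \<delta>} y * indicator {0<..} y \<partial>lborel)"
        unfolding L_def E_def \<eta>_def using assms \<delta> elim by (intro laguerre_kernel_1_near_diagonal_ge) auto
      also have "\<dots> \<le> ?m t"
      proof (intro nn_integral_mono)
        fix y :: real
        have "y \<in> A" if "y \<in> {x - \<delta><..<x + \<delta>}"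
          using that \<delta> e by (auto simp: dist_real_def subset_iff)
        then show "ennreal (laguerre_kernel_1 \<nu> t x y) * indicator {x - \<delta><..<x + \<delta>} y * indicator {0<..} y \<le>
            ennreal (laguerre_kernel_1 \<nu> t x y) * indicator A y * indicator {0<..} y"
          by (auto simp: indicator_def)
      qed
      finally have "L t \<le> enn2real (?m t)"
        using le_1[of t] elim by (cases "?m t") (auto simp: top_unique ennreal_le_iff2)
      then show ?case using elim by simp
    qed
  }
qed

section \<open>Semigroups of symmetric kernels\<close>

text \<open>The convex function \<open>u powr p\<close> lies above its tangent at \<open>a\<close>;
  the inequality is solved for \<open>u\<close>. The point of tangency is a free parameter, which
  allows a Jensen inequality for measures that are not normalised.\<close>

lemma powr_le_tangent:
  fixes a u p :: real
  assumes "0 < a" "0 \<le> u" "1 \<le> p"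
  shows "u \<le> a powr (1 - p) / p * u powr p + a * (1 - 1 / p)"
proof (cases "u = 0")
  case True
  then show ?thesis using assms by simp
next
  case False
  then have u: "u > 0" using assms by simp
  have "((u / a) powr p) powr (1 / p) * 1 powr (1 - 1 / p) \<le> 1 / p * (u / a) powr p + (1 - 1 / p) * 1"
    using u assms by (intro Youngs_inequality_0) auto
  then have "u / a \<le> 1 / p * (u / a) powr p + (1 - 1 / p)"
    using u assms by (simp add: powr_powr)
  then have "a * (u / a) \<le> a * (1 / p * (u / a) powr p + (1 - 1 / p))"
    using assms by (intro mult_left_mono) auto
  also have "\<dots> = a powr (1 - p) / p * u powr p + a * (1 - 1 / p)"
    using u assms by (simp add: powr_divide powr_diff algebra_simps)
  finally show ?thesis using assms by simp
qed

section \<open>Membership in Lebesgue spaces and in the sum of L1 and Linf\<close>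

lemma mem_L1_iff:
  "f \<in> Lp_space M 1 \<longleftrightarrow> f \<in> borel_measurable M \<and> (\<integral>\<^sup>+x. ennreal \<bar>f x\<bar> \<partial>M) < \<infinity>"
  by (auto simp: Lp_space_def Lp_norm_def Let_def less_top)

lemma mem_Linf_iff:
  "f \<in> Lp_space M top \<longleftrightarrow> f \<in> borel_measurable M \<and> (\<exists>c. AE x in M. \<bar>f x\<bar> \<le> c)"
proof (cases "f \<in> borel_measurable M")
  case True
  have "esssup M (\<lambda>x. ennreal \<bar>f x\<bar>) < \<infinity> \<longleftrightarrow> (\<exists>c. AE x in M. \<bar>f x\<bar> \<le> c)"
  proof
    assume "esssup M (\<lambda>x. ennreal \<bar>f x\<bar>) < \<infinity>"
    then obtain c where c: "c \<ge> 0" "esssup M (\<lambda>x. ennreal \<bar>f x\<bar>) = ennreal c"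
      by (cases "esssup M (\<lambda>x. ennreal \<bar>f x\<bar>)") auto
    have "AE x in M. \<bar>f x\<bar> \<le> c"
      using esssup_AE[of "\<lambda>x. ennreal \<bar>f x\<bar>" M] c by (auto elim!: eventually_mono)
    then show "\<exists>c. AE x in M. \<bar>f x\<bar> \<le> c" ..
  next
    assume "\<exists>c. AE x in M. \<bar>f x\<bar> \<le> c"
    then obtain c where "AE x in M. \<bar>f x\<bar> \<le> c" ..
    then have "esssup M (\<lambda>x. ennreal \<bar>f x\<bar>) \<le> ennreal c"
      using True by (intro esssup_I) (auto intro: ennreal_leI elim!: eventually_mono)
    then show "esssup M (\<lambda>x. ennreal \<bar>f x\<bar>) < \<infinity>" by (simp add: le_less_trans)
  qed
  then show ?thesis using True by (simp add: Lp_space_def Lp_norm_def)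
qed (simp add: Lp_space_def)

lemma Lp_space_finite_iff:
  assumes "1 \<le> p" "p \<noteq> \<infinity>"
  shows "f \<in> Lp_space M p \<longleftrightarrow>
    f \<in> borel_measurable M \<and> (\<integral>\<^sup>+x. ennreal (\<bar>f x\<bar> powr enn2real p) \<partial>M) < \<infinity>"
  using assms by (auto simp: Lp_space_def Lp_norm_def Let_def less_top)

lemma mem_L2_iff:
  "f \<in> Lp_space M 2 \<longleftrightarrow> f \<in> borel_measurable M \<and> (\<integral>\<^sup>+x. ennreal ((f x)\<^sup>2) \<partial>M) < \<infinity>"
  by (subst Lp_space_finite_iff) auto

lemma one_le_enn2real: "1 \<le> p \<Longrightarrow> p \<noteq> \<infinity> \<Longrightarrow> 1 \<le> enn2real p"
  by (cases p) auto

lemma L1_plus_LinfI: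
  assumes "g \<in> Lp_space M 1" "h \<in> Lp_space M top" "\<And>x. f x = g x + h x"
  shows "f \<in> L1_plus_Linf M"
proof -
  have "f = (\<lambda>x. g x + h x)" using assms(3) by (rule ext)
  then show ?thesis unfolding L1_plus_Linf_def using assms(1,2) by auto
qed

lemma L1_plus_Linf_add:
  assumes "f \<in> L1_plus_Linf M" "f' \<in> L1_plus_Linf M"
  shows "(\<lambda>x. f x + f' x) \<in> L1_plus_Linf M"
proof -
  obtain g h where gh: "f = (\<lambda>x. g x + h x)" "g \<in> Lp_space M 1" "h \<in> Lp_space M \<infinity>"
    using assms(1) by (auto simp: L1_plus_Linf_def)
  obtain g' h' where gh': "f' = (\<lambda>x. g' x + h' x)" "g' \<in> Lp_space M 1" "h' \<in> Lp_space M \<infinity>"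
    using assms(2) by (auto simp: L1_plus_Linf_def)
  have [measurable]: "g \<in> borel_measurable M" "g' \<in> borel_measurable M"
    using gh gh' by (auto simp: mem_L1_iff)
  have "(\<integral>\<^sup>+x. ennreal \<bar>g x + g' x\<bar> \<partial>M) \<le> (\<integral>\<^sup>+x. ennreal \<bar>g x\<bar> + ennreal \<bar>g' x\<bar> \<partial>M)"
    by (intro nn_integral_mono) (simp flip: ennreal_plus)
  also have "\<dots> < \<infinity>"
    using gh gh' by (subst nn_integral_add) (auto simp: mem_L1_iff)
  finally have "(\<lambda>x. g x + g' x) \<in> Lp_space M 1" by (simp add: mem_L1_iff)
  moreover have "(\<lambda>x. h x + h' x) \<in> Lp_space M top"
  proof -
    obtain c c' where "AE x in M. \<bar>h x\<bar> \<le> c" "AE x in M. \<bar>h' x\<bar> \<le> c'"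
      using gh gh' by (auto simp: mem_Linf_iff)
    then have "AE x in M. \<bar>h x + h' x\<bar> \<le> c + c'" by eventually_elim simp
    then show ?thesis using gh gh' by (auto simp: mem_Linf_iff)
  qed
  ultimately show ?thesis by (rule L1_plus_LinfI) (simp add: gh gh')
qed

lemma L1_plus_Linf_scale:
  assumes "f \<in> L1_plus_Linf M"
  shows "(\<lambda>x. c * f x) \<in> L1_plus_Linf M"
proof -
  obtain g h where gh: "f = (\<lambda>x. g x + h x)" "g \<in> Lp_space M 1" "h \<in> Lp_space M \<infinity>"
    using assms(1) by (auto simp: L1_plus_Linf_def)
  then have [measurable]: "g \<in> borel_measurable M" by (auto simp: mem_L1_iff)
  have "(\<integral>\<^sup>+x. ennreal \<bar>c * g x\<bar> \<partial>M) = ennreal \<bar>c\<bar> * (\<integral>\<^sup>+x. ennreal \<bar>g x\<bar> \<partial>M)"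
    by (subst nn_integral_cmult[symmetric]) (auto simp: abs_mult ennreal_mult)
  also have "\<dots> < \<infinity>" using gh by (simp add: mem_L1_iff ennreal_mult_less_top)
  finally have "(\<lambda>x. c * g x) \<in> Lp_space M 1" by (simp add: mem_L1_iff)
  moreover have "(\<lambda>x. c * h x) \<in> Lp_space M top"
  proof -
    obtain b where "AE x in M. \<bar>h x\<bar> \<le> b"
      using gh by (auto simp: mem_Linf_iff)
    then have "AE x in M. \<bar>c * h x\<bar> \<le> \<bar>c\<bar> * b"
      by eventually_elim (simp add: abs_mult mult_left_mono)
    then show ?thesis using gh by (auto simp: mem_Linf_iff)
  qed
  ultimately show ?thesis by (rule L1_plus_LinfI) (simp add: gh distrib_left)
qed

text \<open>Cut at height \<open>1\<close>: where \<open>\<bar>f x\<bar> > 1\<close> the value is at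
  most \<open>\<bar>f x\<bar> powr r\<close>, hence integrable, and the rest is bounded.\<close>

lemma Lp_subset_L1_plus_Linf:
  assumes "1 \<le> p"
  shows "Lp_space M p \<subseteq> L1_plus_Linf M"
proof
  fix f assume f: "f \<in> Lp_space M p"
  show "f \<in> L1_plus_Linf M"
  proof (cases "p = \<infinity>")
    case True
    have "(\<lambda>x. 0) \<in> Lp_space M 1" by (simp add: mem_L1_iff)
    then show ?thesis using f True by (intro L1_plus_LinfI[of "\<lambda>_. 0" M f]) auto
  next
    case False
    define r where "r = enn2real p"
    have r: "1 \<le> r" using one_le_enn2real[OF assms False] by (simp add: r_def)
    have [measurable]: "f \<in> borel_measurable M" and
      I: "(\<integral>\<^sup>+x. ennreal (\<bar>f x\<bar> powr r) \<partial>M) < \<infinity>"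
      using f Lp_space_finite_iff[OF assms False, of f M] by (auto simp: r_def)
    define g where "g = (\<lambda>x. if \<bar>f x\<bar> \<le> 1 then 0 else f x)"
    define h where "h = (\<lambda>x. if \<bar>f x\<bar> \<le> 1 then f x else 0)"
    have [measurable]: "g \<in> borel_measurable M" "h \<in> borel_measurable M"
      unfolding g_def h_def by measurable
    have "(\<integral>\<^sup>+x. ennreal \<bar>g x\<bar> \<partial>M) \<le> (\<integral>\<^sup>+x. ennreal (\<bar>f x\<bar> powr r) \<partial>M)"
    proof (intro nn_integral_mono ennreal_leI)
      fix x
      show "\<bar>g x\<bar> \<le> \<bar>f x\<bar> powr r"
        using powr_mono[of 1 r "\<bar>f x\<bar>"] r by (auto simp: g_def)
    qed
    then have "g \<in> Lp_space M 1" using I by (simp add: mem_L1_iff)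
    moreover have "h \<in> Lp_space M top"
      by (auto simp: mem_Linf_iff h_def intro!: exI[of _ 1])
    ultimately show ?thesis by (intro L1_plus_LinfI) (auto simp: g_def h_def)
  qed
qed

lemma L1_plus_Linf_measurable: "f \<in> L1_plus_Linf M \<Longrightarrow> f \<in> borel_measurable M"
  by (auto simp: L1_plus_Linf_def Lp_space_def)

text \<open>Everything after the kernel computations depends on these properties only.
  \<open>concentrating\<close> is a substitute for topology: in the application \<open>U\<close> is
  an open set from outer regularity, and open sets are those in which mass started inside stays for
  small times.\<close>

locale symmetric_kernel_semigroup = sigma_finite_measure M for M :: "'a measure" +
  fixes P :: "real \<Rightarrow> 'a \<Rightarrow> 'a \<Rightarrow> real" and C :: "real \<Rightarrow> real"
  assumes kernel_measurable: "\<And>t. 0 < t \<Longrightarrow> case_prod (P t) \<in> borel_measurable (M \<Otimes>\<^sub>M M)"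
    and kernel_nonneg: "\<And>t x y. 0 < t \<Longrightarrow> x \<in> space M \<Longrightarrow> y \<in> space M \<Longrightarrow> 0 \<le> P t x y"
    and kernel_sym: "\<And>t x y. 0 < t \<Longrightarrow> x \<in> space M \<Longrightarrow> y \<in> space M \<Longrightarrow> P t x y = P t y x"
    and kernel_mass: "\<And>t x. 0 < t \<Longrightarrow> x \<in> space M \<Longrightarrow> (\<integral>\<^sup>+y. ennreal (P t x y) \<partial>M) \<le> ennreal (C t)"
    and mass_pos: "\<And>t. 0 < t \<Longrightarrow> 0 < C t" and mass_le_1: "\<And>t. 0 < t \<Longrightarrow> C t \<le> 1"
    and chapman_kolmogorov: "\<And>s t x z. 0 < s \<Longrightarrow> 0 < t \<Longrightarrow> x \<in> space M \<Longrightarrow> z \<in> space M \<Longrightarrow>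
      (\<integral>\<^sup>+y. ennreal (P s x y) * ennreal (P t y z) \<partial>M) = ennreal (P (s + t) x z)"
    and concentrating: "\<And>A \<epsilon>. A \<in> sets M \<Longrightarrow> 0 < \<epsilon> \<Longrightarrow>
      \<exists>U\<in>sets M. A \<subseteq> U \<and> emeasure M (U - A) \<le> ennreal \<epsilon> \<and>
        (\<forall>x\<in>U. ((\<lambda>t. \<integral>\<^sup>+y. ennreal (P t x y) * indicator U y \<partial>M) \<longlongrightarrow> 1) (at_right 0))"
begin

sublocale MM: pair_sigma_finite M M ..

definition semigroup_op :: "real \<Rightarrow> ('a \<Rightarrow> real) \<Rightarrow> 'a \<Rightarrow> real" where
  "semigroup_op t f = (if t = 0 then f else (\<lambda>x. LINT y|M. P t x y * f y))"

lemma kernel_measurable2 [measurable (raw)]: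
  assumes "0 < t" and [measurable]: "f \<in> measurable N M" "g \<in> measurable N M"
  shows "(\<lambda>x. P t (f x) (g x)) \<in> borel_measurable N"
proof -
  have [measurable]: "case_prod (P t) \<in> borel_measurable (M \<Otimes>\<^sub>M M)" using assms by (intro kernel_measurable)
  have "(\<lambda>x. case_prod (P t) (f x, g x)) \<in> borel_measurable N" by measurable
  then show ?thesis by simp
qed

lemma semigroup_op_measurable:
  assumes "0 \<le> t" and [measurable]: "f \<in> borel_measurable M"
  shows "semigroup_op t f \<in> borel_measurable M"
proof (cases "t = 0")
  case False
  then have t: "0 < t" using assms by simp
  have "(\<lambda>x. LINT y|M. P t x y * f y) \<in> borel_measurable M"
    using t by measurable
  then show ?thesis using False by (simp add: semigroup_op_def)
qed (simp add: semigroup_op_def)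

section \<open>Pointwise estimates and operator norm bounds\<close>

lemma abs_semigroup_op_le:
  assumes t: "0 < t" and x: "x \<in> space M" and [measurable]: "f \<in> borel_measurable M"
  shows "ennreal \<bar>semigroup_op t f x\<bar> \<le> (\<integral>\<^sup>+y. ennreal (P t x y) * ennreal \<bar>f y\<bar> \<partial>M)"
proof (cases "integrable M (\<lambda>y. P t x y * f y)")
  case True
  have "ennreal (norm (semigroup_op t f x)) \<le> (\<integral>\<^sup>+y. norm (P t x y * f y) \<partial>M)"
    using integral_norm_bound_ennreal[OF True] t by (simp add: semigroup_op_def)
  also have "\<dots> = (\<integral>\<^sup>+y. ennreal (P t x y) * ennreal \<bar>f y\<bar> \<partial>M)"
    using t x by (intro nn_integral_cong) (simp add: abs_mult kernel_nonneg ennreal_mult)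
  finally show ?thesis by simp
next
  \<comment> \<open>A Bochner integral that does not exist has the default value \<open>0\<close>,
    so the bound holds at such points as well.\<close>
  case False
  then show ?thesis using t by (simp add: semigroup_op_def not_integrable_integral_eq)
qed

text \<open>After Tonelli the integration runs over the first variable, and by symmetry the column
  masses obey the same bound as the row masses.\<close>

lemma nn_integral_kernel_le:
  assumes t: "0 < t" and [measurable]: "g \<in> borel_measurable M"
  shows "(\<integral>\<^sup>+x. \<integral>\<^sup>+y. ennreal (P t x y) * g y \<partial>M \<partial>M) \<le> ennreal (C t) * (\<integral>\<^sup>+y. g y \<partial>M)"
proof -
  have "(\<integral>\<^sup>+x. \<integral>\<^sup>+y. ennreal (P t x y) * g y \<partial>M \<partial>M) = (\<integral>\<^sup>+y. \<integral>\<^sup>+x. ennreal (P t x y) * g y \<partial>M \<partial>M)"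
    using t by (intro MM.Fubini'[symmetric]) measurable
  also have "\<dots> = (\<integral>\<^sup>+y. (\<integral>\<^sup>+x. ennreal (P t y x) \<partial>M) * g y \<partial>M)"
  proof (intro nn_integral_cong)
    fix y assume y: "y \<in> space M"
    have "(\<integral>\<^sup>+x. ennreal (P t x y) * g y \<partial>M) = (\<integral>\<^sup>+x. ennreal (P t y x) * g y \<partial>M)"
      using t y by (intro nn_integral_cong) (simp add: kernel_sym)
    also have "\<dots> = (\<integral>\<^sup>+x. ennreal (P t y x) \<partial>M) * g y"
      using t y by (intro nn_integral_multc) measurable
    finally show "(\<integral>\<^sup>+x. ennreal (P t x y) * g y \<partial>M) = (\<integral>\<^sup>+x. ennreal (P t y x) \<partial>M) * g y" .
  qed
  also have "\<dots> \<le> (\<integral>\<^sup>+y. ennreal (C t) * g y \<partial>M)"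
    using t by (intro nn_integral_mono mult_right_mono kernel_mass) auto
  also have "\<dots> = ennreal (C t) * (\<integral>\<^sup>+y. g y \<partial>M)"
    by (rule nn_integral_cmult) simp
  finally show ?thesis .
qed

text \<open>Jensen's inequality for the measure with density \<open>P t x\<close>, whose total mass
  is at most \<open>C t\<close>; the missing normalisation costs the factor
  \<open>C t powr (p - 1)\<close>.\<close>

lemma semigroup_op_powr_le:
  assumes t: "0 < t" and x: "x \<in> space M" and [measurable]: "f \<in> borel_measurable M" and p: "1 \<le> p"
  shows "ennreal (\<bar>semigroup_op t f x\<bar> powr p) \<le>
    ennreal (C t powr (p - 1)) * (\<integral>\<^sup>+y. ennreal (P t x y) * ennreal (\<bar>f y\<bar> powr p) \<partial>M)"
    (is "_ \<le> _ * ?Q")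
proof -
  define h where "h = \<bar>semigroup_op t f x\<bar>"
  have C: "0 < C t" using mass_pos[OF t] .
  \<comment> \<open>The degenerate cases are split off so that the tangent point below is positive
    and real subtraction is available.\<close>
  consider "?Q = \<infinity>" | "h = 0" | "?Q < \<infinity>" "h > 0" by (fastforce simp: h_def less_top)
  then show ?thesis
  proof cases
    case 1
    then show ?thesis using C by (simp add: ennreal_mult_top)
  next
    case 2
    then show ?thesis by (simp add: h_def)
  next
    case 3
    then obtain q where q: "q \<ge> 0" "?Q = ennreal q" by (cases ?Q) auto
    \<comment> \<open>The point of tangency that makes \<open>d * C t = h - h / p\<close>: the
      unknown \<open>h\<close> reappears on the right with a coefficient smaller than
      \<open>1\<close> and is absorbed.\<close>
    define a where "a = h / C t"
    have a: "a > 0" using 3 C by (simp add: a_def)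
    define b where "b = a powr (1 - p) / p"
    define d where "d = a * (1 - 1 / p)"
    have b: "b \<ge> 0" and d: "d \<ge> 0" using a p by (auto simp: b_def d_def)
    have "ennreal h \<le> (\<integral>\<^sup>+y. ennreal (P t x y) * ennreal \<bar>f y\<bar> \<partial>M)"
      unfolding h_def using t x by (intro abs_semigroup_op_le) auto
    also have "\<dots> \<le> (\<integral>\<^sup>+y. ennreal b * (ennreal (P t x y) * ennreal (\<bar>f y\<bar> powr p)) + ennreal d * ennreal (P t x y) \<partial>M)"
    proof (intro nn_integral_mono)
      fix y assume "y \<in> space M"
      have "ennreal \<bar>f y\<bar> \<le> ennreal (b * \<bar>f y\<bar> powr p + d)"
        using powr_le_tangent[OF a _ p, of "\<bar>f y\<bar>"] by (intro ennreal_leI) (simp add: b_def d_def)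
      then have "ennreal (P t x y) * ennreal \<bar>f y\<bar> \<le> ennreal (P t x y) * ennreal (b * \<bar>f y\<bar> powr p + d)"
        by (intro mult_left_mono) auto
      also have "\<dots> = ennreal b * (ennreal (P t x y) * ennreal (\<bar>f y\<bar> powr p)) + ennreal d * ennreal (P t x y)"
        using b d by (simp add: ennreal_mult distrib_left mult_ac)
      finally show "ennreal (P t x y) * ennreal \<bar>f y\<bar> \<le> \<dots>" .
    qed
    also have "\<dots> = ennreal b * ?Q + ennreal d * (\<integral>\<^sup>+y. ennreal (P t x y) \<partial>M)"
      using t x by (simp add: nn_integral_add nn_integral_cmult)
    also have "\<dots> \<le> ennreal b * ennreal q + ennreal d * ennreal (C t)"
      using kernel_mass[OF t x] q by (intro add_mono mult_left_mono) auto
    also have "\<dots> = ennreal (b * q + d * C t)"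
      using b d q C by (simp add: ennreal_mult)
    finally have "h \<le> b * q + d * C t"
      using b d q C by (subst (asm) ennreal_le_iff) auto
    also have "d * C t = h - h / p"
      using C by (simp add: d_def a_def algebra_simps)
    finally have "h / p \<le> a powr (1 - p) * q / p" by (simp add: b_def)
    then have "h \<le> a powr (1 - p) * q" using p by (simp add: divide_le_cancel)
    then have "a powr (p - 1) * h \<le> a powr (p - 1) * (a powr (1 - p) * q)"
      by (intro mult_left_mono) auto
    also have "\<dots> = q" using a by (simp flip: powr_add mult.assoc)
    also have "a powr (p - 1) * h = h powr p / C t powr (p - 1)"
      using 3 C by (simp add: a_def powr_divide powr_diff)
    finally have "h powr p \<le> C t powr (p - 1) * q" using C by (simp add: field_simps)
    then have "ennreal (h powr p) \<le> ennreal (C t powr (p - 1) * q)" by (rule ennreal_leI)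
    then show ?thesis using q by (simp add: h_def ennreal_mult)
  qed
qed

text \<open>The row masses contribute \<open>C t powr (p - 1)\<close> through Jensen and the column
  masses one more factor \<open>C t\<close>, so the \<open>p\<close>-th root gives the bound
  \<open>C t\<close> for every exponent.\<close>

lemma nn_integral_semigroup_op_powr_le:
  assumes t: "0 < t" and [measurable]: "f \<in> borel_measurable M" and p: "1 \<le> p"
  shows "(\<integral>\<^sup>+x. ennreal (\<bar>semigroup_op t f x\<bar> powr p) \<partial>M) \<le>
    ennreal (C t powr p) * (\<integral>\<^sup>+x. ennreal (\<bar>f x\<bar> powr p) \<partial>M)"
proof -
  have C: "0 < C t" using mass_pos[OF t] .
  have "(\<integral>\<^sup>+x. ennreal (\<bar>semigroup_op t f x\<bar> powr p) \<partial>M) \<le>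
     (\<integral>\<^sup>+x. ennreal (C t powr (p - 1)) * (\<integral>\<^sup>+y. ennreal (P t x y) * ennreal (\<bar>f y\<bar> powr p) \<partial>M) \<partial>M)"
    using t p by (intro nn_integral_mono semigroup_op_powr_le) auto
  also have "\<dots> = ennreal (C t powr (p - 1)) * (\<integral>\<^sup>+x. (\<integral>\<^sup>+y. ennreal (P t x y) * ennreal (\<bar>f y\<bar> powr p) \<partial>M) \<partial>M)"
    using t by (intro nn_integral_cmult) measurable
  also have "\<dots> \<le> ennreal (C t powr (p - 1)) * (ennreal (C t) * (\<integral>\<^sup>+x. ennreal (\<bar>f x\<bar> powr p) \<partial>M))"
    using t by (intro mult_left_mono nn_integral_kernel_le) auto
  also have "\<dots> = ennreal (C t powr p) * (\<integral>\<^sup>+x. ennreal (\<bar>f x\<bar> powr p) \<partial>M)"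
    using C by (simp add: powr_diff flip: mult.assoc ennreal_mult)
  finally show ?thesis .
qed

lemma Lp_norm_semigroup_op_le:
  assumes t: "0 < t" and [measurable]: "f \<in> borel_measurable M" and p: "1 \<le> p"
  shows "Lp_norm M p (semigroup_op t f) \<le> ennreal (C t) * Lp_norm M p f"
proof (cases "p = \<infinity>")
  case True
  have C: "0 < C t" using mass_pos[OF t] .
  have [measurable]: "semigroup_op t f \<in> borel_measurable M"
    using t by (intro semigroup_op_measurable) auto
  define c where "c = esssup M (\<lambda>x. ennreal \<bar>f x\<bar>)"
  have ae: "AE y in M. ennreal \<bar>f y\<bar> \<le> c" unfolding c_def by (rule esssup_AE)
  have "esssup M (\<lambda>x. ennreal \<bar>semigroup_op t f x\<bar>) \<le> ennreal (C t) * c"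
  proof (rule esssup_I)
    show "AE x in M. ennreal \<bar>semigroup_op t f x\<bar> \<le> ennreal (C t) * c"
    proof (rule AE_I2)
      fix x assume x: "x \<in> space M"
      have "ennreal \<bar>semigroup_op t f x\<bar> \<le> (\<integral>\<^sup>+y. ennreal (P t x y) * ennreal \<bar>f y\<bar> \<partial>M)"
        using t x by (intro abs_semigroup_op_le) auto
      also have "\<dots> \<le> (\<integral>\<^sup>+y. ennreal (P t x y) * c \<partial>M)"
        using ae by (intro nn_integral_mono_AE) (auto intro: mult_left_mono elim!: eventually_mono)
      also have "\<dots> = (\<integral>\<^sup>+y. ennreal (P t x y) \<partial>M) * c"
        using t x by (intro nn_integral_multc) measurable
      also have "\<dots> \<le> ennreal (C t) * c"
        using t x by (intro mult_right_mono kernel_mass) auto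
      finally show "ennreal \<bar>semigroup_op t f x\<bar> \<le> ennreal (C t) * c" .
    qed
  qed simp
  then show ?thesis using True by (simp add: Lp_norm_def c_def)
next
  case False
  define r where "r = enn2real p"
  have r: "1 \<le> r" using one_le_enn2real[OF p False] by (simp add: r_def)
  have C: "0 < C t" using mass_pos[OF t] .
  show ?thesis
  proof (cases "(\<integral>\<^sup>+x. ennreal (\<bar>f x\<bar> powr r) \<partial>M)")
    case top
    then show ?thesis
      using False C by (simp add: Lp_norm_def r_def[symmetric] ennreal_mult_top)
  next
    case (real i)
    have le: "(\<integral>\<^sup>+x. ennreal (\<bar>semigroup_op t f x\<bar> powr r) \<partial>M) \<le> ennreal (C t powr r * i)"
      using nn_integral_semigroup_op_powr_le[OF t _ r, of f] real by (simp add: ennreal_mult)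
    then obtain i' where i': "i' \<ge> 0" "(\<integral>\<^sup>+x. ennreal (\<bar>semigroup_op t f x\<bar> powr r) \<partial>M) = ennreal i'"
      by (cases "(\<integral>\<^sup>+x. ennreal (\<bar>semigroup_op t f x\<bar> powr r) \<partial>M)") (auto simp: top_unique)
    have "i' powr (1 / r) \<le> (C t powr r * i) powr (1 / r)"
      using le i' real r by (intro powr_mono2) auto
    also have "\<dots> = C t * i powr (1 / r)"
      using C real r by (simp add: powr_mult powr_powr)
    finally show ?thesis
      using False C real i' by (simp add: Lp_norm_def r_def[symmetric] flip: ennreal_mult)
  qed
qed

lemma semigroup_op_contraction:
  assumes "0 \<le> t" "1 \<le> p" "f \<in> borel_measurable M"
  shows "Lp_norm M p (semigroup_op t f) \<le> Lp_norm M p f"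
proof (cases "t = 0")
  case False
  then have t: "0 < t" using assms by simp
  have "Lp_norm M p (semigroup_op t f) \<le> ennreal (C t) * Lp_norm M p f"
    using t assms by (intro Lp_norm_semigroup_op_le) auto
  also have "\<dots> \<le> 1 * Lp_norm M p f"
    using mass_le_1[OF t] by (intro mult_right_mono) auto
  finally show ?thesis by simp
qed (simp add: semigroup_op_def)

lemma Lp_opnorm_semigroup_op_le:
  assumes "0 < t" "1 \<le> p"
  shows "Lp_opnorm M p (semigroup_op t) \<le> ennreal (C t)"
  unfolding Lp_opnorm_def
proof (rule SUP_least, clarify)
  fix f assume f: "f \<in> Lp_space M p" "Lp_norm M p f \<le> 1"
  have "Lp_norm M p (semigroup_op t f) \<le> ennreal (C t) * Lp_norm M p f"
    using assms f by (intro Lp_norm_semigroup_op_le) (auto simp: Lp_space_def)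
  also have "\<dots> \<le> ennreal (C t) * 1" using f by (intro mult_left_mono) auto
  finally show "Lp_norm M p (semigroup_op t f) \<le> ennreal (C t)" by simp
qed

text \<open>For the bounded part the integral exists at every \<open>x\<close>. For the integrable
  part only its integral over \<open>x\<close> is known to be finite, so finiteness is obtained
  almost everywhere.\<close>

lemma semigroup_op_AE_integrable:
  assumes t: "0 < t" and f: "f \<in> L1_plus_Linf M"
  shows "AE x in M. integrable M (\<lambda>y. P t x y * f y)"
proof -
  obtain g h where gh: "f = (\<lambda>x. g x + h x)" "g \<in> Lp_space M 1" "h \<in> Lp_space M \<infinity>"
    using f by (auto simp: L1_plus_Linf_def)
  then have [measurable]: "g \<in> borel_measurable M" "h \<in> borel_measurable M"
    and g: "(\<integral>\<^sup>+x. ennreal \<bar>g x\<bar> \<partial>M) < \<infinity>" by (auto simp: mem_L1_iff mem_Linf_iff)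
  obtain c where c: "AE x in M. \<bar>h x\<bar> \<le> c" using gh by (auto simp: mem_Linf_iff)
  have norm_eq: "(\<integral>\<^sup>+y. norm (P t x y * k y) \<partial>M) = (\<integral>\<^sup>+y. ennreal (P t x y) * ennreal \<bar>k y\<bar> \<partial>M)"
    if "x \<in> space M" for k :: "'a \<Rightarrow> real" and x
    using t that by (intro nn_integral_cong) (simp add: abs_mult kernel_nonneg ennreal_mult)
  have "(\<integral>\<^sup>+x. \<integral>\<^sup>+y. ennreal (P t x y) * ennreal \<bar>g y\<bar> \<partial>M \<partial>M) \<le> ennreal (C t) * (\<integral>\<^sup>+x. ennreal \<bar>g x\<bar> \<partial>M)"
    using t by (intro nn_integral_kernel_le) auto
  also have "\<dots> < \<infinity>" using g by (simp add: ennreal_mult_less_top)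
  finally have "AE x in M. (\<integral>\<^sup>+y. ennreal (P t x y) * ennreal \<bar>g y\<bar> \<partial>M) \<noteq> \<infinity>"
    using t by (intro nn_integral_PInf_AE) (auto intro!: borel_measurable_nn_integral)
  moreover have "AE x in M. x \<in> space M" by simp
  ultimately show ?thesis
  proof eventually_elim
    case (elim x)
    have "integrable M (\<lambda>y. P t x y * g y)"
    proof (rule integrableI_bounded)
      show "(\<integral>\<^sup>+y. norm (P t x y * g y) \<partial>M) < \<infinity>"
        unfolding norm_eq[OF elim(2)] using elim(1) by (simp add: less_top)
    qed (use t elim in measurable)
    moreover have "integrable M (\<lambda>y. P t x y * h y)"
    proof (rule integrableI_bounded)
      have "(\<integral>\<^sup>+y. norm (P t x y * h y) \<partial>M) = (\<integral>\<^sup>+y. ennreal (P t x y) * ennreal \<bar>h y\<bar> \<partial>M)"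
        using elim by (intro norm_eq)
      also have "\<dots> \<le> (\<integral>\<^sup>+y. ennreal (P t x y) * ennreal c \<partial>M)"
        using c by (intro nn_integral_mono_AE) (auto intro!: mult_left_mono ennreal_leI elim!: eventually_mono)
      also have "\<dots> = (\<integral>\<^sup>+y. ennreal (P t x y) \<partial>M) * ennreal c"
        using t elim by (intro nn_integral_multc) measurable
      also have "\<dots> \<le> ennreal (C t) * ennreal c"
        using t elim by (intro mult_right_mono kernel_mass) auto
      also have "\<dots> < \<infinity>" by (simp add: ennreal_mult_less_top)
      finally show "(\<integral>\<^sup>+y. norm (P t x y * h y) \<partial>M) < \<infinity>" .
    qed (use t elim in measurable)
    ultimately have "integrable M (\<lambda>y. P t x y * g y + P t x y * h y)"
      by (rule Bochner_Integration.integrable_add)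
    then show ?case by (simp add: gh distrib_left)
  qed
qed

lemma semigroup_op_add:
  assumes "0 \<le> t" "f \<in> L1_plus_Linf M" "g \<in> L1_plus_Linf M"
  shows "AE x in M. semigroup_op t (\<lambda>x. f x + g x) x = semigroup_op t f x + semigroup_op t g x"
proof (cases "t = 0")
  case False
  then have t: "0 < t" using assms by simp
  show ?thesis
    using semigroup_op_AE_integrable[OF t assms(2)] semigroup_op_AE_integrable[OF t assms(3)]
    by eventually_elim (use t in \<open>simp add: semigroup_op_def distrib_left\<close>)
qed (simp add: semigroup_op_def)

lemma semigroup_op_scale: "semigroup_op t (\<lambda>x. c * f x) x = c * semigroup_op t f x"
proof -
  have "(LINT y|M. P t x y * (c * f y)) = (LINT y|M. c * (P t x y * f y))"
    by (simp add: mult_ac)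
  then show ?thesis by (simp add: semigroup_op_def)
qed

lemma semigroup_op_diff:
  assumes "0 \<le> t" "f \<in> L1_plus_Linf M" "g \<in> L1_plus_Linf M"
  shows "AE x in M. semigroup_op t (\<lambda>x. f x - g x) x = semigroup_op t f x - semigroup_op t g x"
  using semigroup_op_add[OF assms(1,2) L1_plus_Linf_scale[OF assms(3), of "-1"]]
    semigroup_op_scale[of t "-1" g] by simp

lemma semigroup_op_AE_cong:
  assumes "0 \<le> t" "f \<in> borel_measurable M" "g \<in> borel_measurable M" "AE x in M. f x = g x"
  shows "AE x in M. semigroup_op t f x = semigroup_op t g x"
proof (cases "t = 0")
  case False
  then have t: "0 < t" using assms by simp
  show ?thesis
  proof (rule AE_I2)
    fix x assume x: "x \<in> space M"
    have "(LINT y|M. P t x y * f y) = (LINT y|M. P t x y * g y)"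
      using assms t x by (intro integral_cong_AE) (auto elim!: eventually_mono)
    then show "semigroup_op t f x = semigroup_op t g x" using t by (simp add: semigroup_op_def)
  qed
qed (use assms in \<open>simp add: semigroup_op_def\<close>)

lemma semigroup_op_nonneg:
  assumes "0 \<le> t" "AE x in M. 0 \<le> f x"
  shows "AE x in M. 0 \<le> semigroup_op t f x"
proof (cases "t = 0")
  case False
  then have t: "0 < t" using assms by simp
  show ?thesis
  proof (rule AE_I2)
    fix x assume x: "x \<in> space M"
    have "AE y in M. y \<in> space M" by simp
    with assms(2) have "AE y in M. 0 \<le> P t x y * f y"
      by eventually_elim (use t x in \<open>simp add: kernel_nonneg\<close>)
    then show "0 \<le> semigroup_op t f x"
      using t by (simp add: semigroup_op_def integral_nonneg_AE)
  qed
qed (use assms in \<open>simp add: semigroup_op_def\<close>)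

lemma semigroup_op_one_le:
  assumes "0 < t" "x \<in> space M"
  shows "semigroup_op t (\<lambda>_. 1) x \<le> C t"
proof -
  have "ennreal \<bar>semigroup_op t (\<lambda>_. 1) x\<bar> \<le> (\<integral>\<^sup>+y. ennreal (P t x y) * ennreal \<bar>1\<bar> \<partial>M)"
    using assms by (intro abs_semigroup_op_le) auto
  also have "\<dots> \<le> ennreal (C t)" using kernel_mass[OF assms] by simp
  finally show ?thesis using mass_pos[OF assms(1)] by (simp add: ennreal_le_iff)
qed

text \<open>Fubini at each \<open>x\<close> where \<open>P (s + t) x\<close> times \<open>f\<close>
  is integrable. The double integral of absolute values collapses by Chapman-Kolmogorov to that one
  function, so this integrability already justifies the exchange.\<close>

lemma semigroup_op_semigroup:
  assumes s: "0 \<le> s" and t: "0 \<le> t" and f: "f \<in> L1_plus_Linf M"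
  shows "AE x in M. semigroup_op (s + t) f x = semigroup_op s (semigroup_op t f) x"
proof (cases "s = 0 \<or> t = 0")
  case True
  then show ?thesis by (auto simp: semigroup_op_def)
next
  case False
  then have s: "0 < s" and t: "0 < t" using assms by auto
  have [measurable]: "f \<in> borel_measurable M" using f by (rule L1_plus_Linf_measurable)
  have st: "0 < s + t" using s t by simp
  have "AE x in M. x \<in> space M" by simp
  with semigroup_op_AE_integrable[OF st f] show ?thesis
  proof eventually_elim
    case (elim x)
    define F where "F = (\<lambda>y z. P s x y * P t y z * f z)"
    have [measurable]: "case_prod F \<in> borel_measurable (M \<Otimes>\<^sub>M M)"
      unfolding F_def using s t elim by measurable
    have CK: "(\<integral>\<^sup>+y. ennreal (P s x y * P t y z) \<partial>M) = ennreal (P (s + t) x z)" if "z \<in> space M" for z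
    proof -
      have "(\<integral>\<^sup>+y. ennreal (P s x y * P t y z) \<partial>M) = (\<integral>\<^sup>+y. ennreal (P s x y) * ennreal (P t y z) \<partial>M)"
        using s t elim that by (intro nn_integral_cong) (simp add: ennreal_mult kernel_nonneg)
      then show ?thesis using chapman_kolmogorov[OF s t _ that] elim by simp
    qed
    have F: "integrable (M \<Otimes>\<^sub>M M) (case_prod F)"
    proof (rule integrableI_bounded)
      have "(\<integral>\<^sup>+p. norm (case_prod F p) \<partial>(M \<Otimes>\<^sub>M M)) = (\<integral>\<^sup>+z. \<integral>\<^sup>+y. norm (F y z) \<partial>M \<partial>M)"
        by (subst MM.nn_integral_snd[symmetric]) (auto simp: split_beta')
      also have "\<dots> = (\<integral>\<^sup>+z. norm (P (s + t) x z * f z) \<partial>M)"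
      proof (intro nn_integral_cong)
        fix z assume z: "z \<in> space M"
        have "(\<integral>\<^sup>+y. norm (F y z) \<partial>M) = (\<integral>\<^sup>+y. ennreal (P s x y * P t y z) * ennreal \<bar>f z\<bar> \<partial>M)"
          unfolding F_def using s t elim z
          by (intro nn_integral_cong) (simp add: abs_mult ennreal_mult kernel_nonneg)
        also have "\<dots> = (\<integral>\<^sup>+y. ennreal (P s x y * P t y z) \<partial>M) * ennreal \<bar>f z\<bar>"
          using s t elim z by (intro nn_integral_multc) measurable
        also have "\<dots> = norm (P (s + t) x z * f z)"
          using CK[OF z] elim st z by (simp add: abs_mult ennreal_mult kernel_nonneg)
        finally show "(\<integral>\<^sup>+y. norm (F y z) \<partial>M) = norm (P (s + t) x z * f z)" .
      qed
      also have "\<dots> < \<infinity>" using elim by (simp add: integrable_iff_bounded)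
      finally show "(\<integral>\<^sup>+p. norm (case_prod F p) \<partial>(M \<Otimes>\<^sub>M M)) < \<infinity>" .
    qed measurable
    have "semigroup_op s (semigroup_op t f) x = (LINT y|M. LINT z|M. F y z)"
    proof -
      have "(LINT z|M. F y z) = P s x y * (LINT z|M. P t y z * f z)" for y
        by (simp add: F_def mult.assoc)
      then show ?thesis using s t by (simp add: semigroup_op_def)
    qed
    also have "\<dots> = (LINT z|M. LINT y|M. F y z)"
      by (rule MM.Fubini_integral[OF F, symmetric])
    also have "\<dots> = (LINT z|M. P (s + t) x z * f z)"
    proof (intro Bochner_Integration.integral_cong refl)
      fix z assume z: "z \<in> space M"
      have "(LINT y|M. F y z) = (LINT y|M. P s x y * P t y z) * f z"
        by (simp add: F_def)
      also have "(LINT y|M. P s x y * P t y z) = enn2real (\<integral>\<^sup>+y. ennreal (P s x y * P t y z) \<partial>M)"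
        using s t elim z by (intro integral_eq_nn_integral) (auto simp: kernel_nonneg)
      also have "\<dots> = P (s + t) x z"
        using CK[OF z] elim st z by (simp add: kernel_nonneg)
      finally show "(LINT y|M. F y z) = P (s + t) x z * f z" .
    qed
    finally show ?case using st by (simp add: semigroup_op_def)
  qed
qed

text \<open>Fubini and symmetry of the kernel. The double integral converges because
  \<open>\<bar>g x\<bar> * \<bar>f y\<bar>\<close> is at most
  \<open>(f y)\<^sup>2 + (g x)\<^sup>2\<close>, and each square meets a bounded kernel mass.\<close>

lemma semigroup_op_symmetric:
  assumes t: "0 \<le> t" and f: "f \<in> Lp_space M 2" and g: "g \<in> Lp_space M 2"
  shows "(LINT x|M. semigroup_op t f x * g x) = (LINT x|M. f x * semigroup_op t g x)"
proof (cases "t = 0")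
  case False
  then have t: "0 < t" using assms by simp
  have [measurable]: "f \<in> borel_measurable M" "g \<in> borel_measurable M"
    and fg: "(\<integral>\<^sup>+x. ennreal ((f x)\<^sup>2) \<partial>M) < \<infinity>" "(\<integral>\<^sup>+x. ennreal ((g x)\<^sup>2) \<partial>M) < \<infinity>"
    using f g by (auto simp: mem_L2_iff)
  define F where "F = (\<lambda>x y. g x * P t x y * f y)"
  have [measurable]: "case_prod F \<in> borel_measurable (M \<Otimes>\<^sub>M M)"
    unfolding F_def using t by measurable
  have F: "integrable (M \<Otimes>\<^sub>M M) (case_prod F)"
  proof (rule integrableI_bounded)
    have "(\<integral>\<^sup>+p. norm (case_prod F p) \<partial>(M \<Otimes>\<^sub>M M)) = (\<integral>\<^sup>+x. \<integral>\<^sup>+y. norm (F x y) \<partial>M \<partial>M)"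
      by (subst nn_integral_fst[symmetric]) auto
    also have "\<dots> \<le> (\<integral>\<^sup>+x. \<integral>\<^sup>+y. ennreal (P t x y) * ennreal ((f y)\<^sup>2) + ennreal (P t x y) * ennreal ((g x)\<^sup>2) \<partial>M \<partial>M)"
    proof (intro nn_integral_mono)
      fix x y assume xy: "x \<in> space M" "y \<in> space M"
      have "2 * (\<bar>g x\<bar> * \<bar>f y\<bar>) \<le> (f y)\<^sup>2 + (g x)\<^sup>2"
        using sum_squares_bound[of "\<bar>g x\<bar>" "\<bar>f y\<bar>"] by (simp add: mult.assoc)
      then have "\<bar>g x\<bar> * \<bar>f y\<bar> \<le> (f y)\<^sup>2 + (g x)\<^sup>2"
        using mult_nonneg_nonneg[of "\<bar>g x\<bar>" "\<bar>f y\<bar>"] by linarith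
      then have "P t x y * (\<bar>g x\<bar> * \<bar>f y\<bar>) \<le> P t x y * ((f y)\<^sup>2 + (g x)\<^sup>2)"
        using kernel_nonneg[OF t xy] by (rule mult_left_mono)
      moreover have "norm (F x y) = P t x y * (\<bar>g x\<bar> * \<bar>f y\<bar>)"
        unfolding F_def using t xy by (simp add: abs_mult kernel_nonneg)
      ultimately have "norm (F x y) \<le> P t x y * ((f y)\<^sup>2 + (g x)\<^sup>2)" by simp
      then have "ennreal (norm (F x y)) \<le> ennreal (P t x y * ((f y)\<^sup>2 + (g x)\<^sup>2))"
        by (rule ennreal_leI)
      then show "ennreal (norm (F x y)) \<le> ennreal (P t x y) * ennreal ((f y)\<^sup>2) + ennreal (P t x y) * ennreal ((g x)\<^sup>2)"
        using t xy by (simp add: kernel_nonneg ennreal_mult distrib_left)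
    qed
    also have "\<dots> = (\<integral>\<^sup>+x. (\<integral>\<^sup>+y. ennreal (P t x y) * ennreal ((f y)\<^sup>2) \<partial>M) + (\<integral>\<^sup>+y. ennreal (P t x y) \<partial>M) * ennreal ((g x)\<^sup>2) \<partial>M)"
      using t by (intro nn_integral_cong) (simp add: nn_integral_add nn_integral_multc)
    also have "\<dots> \<le> (\<integral>\<^sup>+x. (\<integral>\<^sup>+y. ennreal (P t x y) * ennreal ((f y)\<^sup>2) \<partial>M) + ennreal (C t) * ennreal ((g x)\<^sup>2) \<partial>M)"
      using t by (intro nn_integral_mono add_left_mono mult_right_mono kernel_mass) auto
    also have "\<dots> = (\<integral>\<^sup>+x. (\<integral>\<^sup>+y. ennreal (P t x y) * ennreal ((f y)\<^sup>2) \<partial>M) \<partial>M) + ennreal (C t) * (\<integral>\<^sup>+x. ennreal ((g x)\<^sup>2) \<partial>M)"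
      using t by (simp add: nn_integral_add nn_integral_cmult)
    also have "\<dots> \<le> ennreal (C t) * (\<integral>\<^sup>+x. ennreal ((f x)\<^sup>2) \<partial>M) + ennreal (C t) * (\<integral>\<^sup>+x. ennreal ((g x)\<^sup>2) \<partial>M)"
      using t by (intro add_right_mono nn_integral_kernel_le) auto
    also have "\<dots> < \<infinity>" using fg by (simp add: ennreal_mult_less_top)
    finally show "(\<integral>\<^sup>+p. norm (case_prod F p) \<partial>(M \<Otimes>\<^sub>M M)) < \<infinity>" .
  qed measurable
  have "(LINT x|M. semigroup_op t f x * g x) = (LINT x|M. LINT y|M. F x y)"
  proof -
    have "(LINT y|M. F x y) = (LINT y|M. P t x y * f y) * g x" for x
      by (simp add: F_def mult.assoc)
    then show ?thesis using t by (simp add: semigroup_op_def)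
  qed
  also have "\<dots> = (LINT y|M. LINT x|M. F x y)"
    by (rule MM.Fubini_integral[OF F, symmetric])
  also have "\<dots> = (LINT y|M. f y * semigroup_op t g y)"
  proof (intro Bochner_Integration.integral_cong refl)
    fix y assume y: "y \<in> space M"
    have "(LINT x|M. F x y) = (LINT x|M. P t y x * g x) * f y"
      unfolding integral_mult_left_zero[symmetric] F_def using t y
      by (intro Bochner_Integration.integral_cong refl) (simp add: kernel_sym[of t _ y])
    then show "(LINT x|M. F x y) = f y * semigroup_op t g y"
      using t by (simp add: semigroup_op_def)
  qed
  finally show ?thesis .
qed (simp add: semigroup_op_def)

end

section \<open>Strong continuity in L2\<close>

lemma tendsto_0_ennrealI:
  fixes f :: "'b \<Rightarrow> ennreal"
  assumes "\<And>e. 0 < e \<Longrightarrow> eventually (\<lambda>x. f x \<le> ennreal e) F"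
  shows "(f \<longlongrightarrow> 0) F"
proof (rule order_tendstoI)
  fix a :: ennreal assume "0 < a"
  then obtain q where q: "0 < ennreal (real_of_rat q)" "ennreal (real_of_rat q) < a"
    using ennreal_rat_dense[of 0 a] by auto
  then have "eventually (\<lambda>x. f x \<le> ennreal (real_of_rat q)) F"
    by (intro assms) auto
  then show "eventually (\<lambda>x. f x < a) F"
    by eventually_elim (use q in \<open>auto intro: le_less_trans\<close>)
qed auto

lemma tendsto_0_ennrealD:
  fixes f :: "'b \<Rightarrow> ennreal"
  assumes "(f \<longlongrightarrow> 0) F" "0 < e"
  shows "eventually (\<lambda>x. f x \<le> ennreal e) F"
proof -
  have "eventually (\<lambda>x. f x < ennreal e) F"
    using assms by (intro order_tendstoD(2)[OF assms(1)]) auto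
  then show ?thesis by eventually_elim simp
qed

context symmetric_kernel_semigroup
begin

text \<open>The squared L2 distance, not the distance itself: integrals of squares split termwise in
  \<open>ennreal\<close>, at the price of factors \<open>2\<close> and \<open>3\<close> that do not
  affect convergence to \<open>0\<close>.\<close>

definition drift :: "real \<Rightarrow> ('a \<Rightarrow> real) \<Rightarrow> ennreal" where
  "drift t f = (\<integral>\<^sup>+x. ennreal ((semigroup_op t f x - f x)\<^sup>2) \<partial>M)"

definition L2_strongly_continuous :: "('a \<Rightarrow> real) \<Rightarrow> bool" where
  "L2_strongly_continuous f \<longleftrightarrow> f \<in> Lp_space M 2 \<and> ((\<lambda>t. drift t f) \<longlongrightarrow> 0) (at_right 0)"

lemma semigroup_op_cong:
  assumes "0 < t" "\<And>x. x \<in> space M \<Longrightarrow> f x = g x"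
  shows "semigroup_op t f = semigroup_op t g"
proof -
  have "(LINT y|M. P t x y * f y) = (LINT y|M. P t x y * g y)" for x
    using assms by (intro Bochner_Integration.integral_cong) auto
  then show ?thesis using assms(1) by (simp add: semigroup_op_def)
qed

lemma drift_cong:
  assumes "0 < t" "\<And>x. x \<in> space M \<Longrightarrow> f x = g x"
  shows "drift t f = drift t g"
proof -
  have "semigroup_op t f = semigroup_op t g" using assms by (rule semigroup_op_cong)
  then show ?thesis unfolding drift_def using assms(2) by (intro nn_integral_cong) simp
qed

lemma eventually_at_right_0_pos: "eventually (\<lambda>t::real. 0 < t) (at_right 0)"
  by (rule eventually_at_right_less)

lemma L2_strongly_continuous_cong:
  assumes f: "L2_strongly_continuous f" and eq: "\<And>x. x \<in> space M \<Longrightarrow> f x = g x"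
  shows "L2_strongly_continuous g"
proof -
  have "f \<in> borel_measurable M \<longleftrightarrow> g \<in> borel_measurable M"
    using eq by (rule measurable_cong)
  moreover have "(\<integral>\<^sup>+x. ennreal ((f x)\<^sup>2) \<partial>M) = (\<integral>\<^sup>+x. ennreal ((g x)\<^sup>2) \<partial>M)"
    using eq by (intro nn_integral_cong) simp
  ultimately have "g \<in> Lp_space M 2" using f by (simp add: L2_strongly_continuous_def mem_L2_iff)
  moreover have "((\<lambda>t. drift t g) \<longlongrightarrow> 0) (at_right 0)"
  proof (rule Lim_transform_eventually)
    show "((\<lambda>t. drift t f) \<longlongrightarrow> 0) (at_right 0)" using f by (simp add: L2_strongly_continuous_def)
    show "eventually (\<lambda>t. drift t f = drift t g) (at_right 0)"
      using eventually_at_right_0_pos by eventually_elim (rule drift_cong[OF _ eq])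
  qed
  ultimately show ?thesis by (simp add: L2_strongly_continuous_def)
qed

lemma nn_integral_semigroup_op_square_le:
  assumes t: "0 < t" and f: "f \<in> borel_measurable M"
  shows "(\<integral>\<^sup>+x. ennreal ((semigroup_op t f x)\<^sup>2) \<partial>M) \<le> (\<integral>\<^sup>+x. ennreal ((f x)\<^sup>2) \<partial>M)"
proof -
  have "(\<integral>\<^sup>+x. ennreal ((semigroup_op t f x)\<^sup>2) \<partial>M) \<le> ennreal (C t powr 2) * (\<integral>\<^sup>+x. ennreal ((f x)\<^sup>2) \<partial>M)"
    using nn_integral_semigroup_op_powr_le[OF t f, of 2] by simp
  also have "\<dots> \<le> 1 * (\<integral>\<^sup>+x. ennreal ((f x)\<^sup>2) \<partial>M)"
    using mass_pos[OF t] mass_le_1[OF t] by (intro mult_right_mono) (auto simp: power_le_one)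
  finally show ?thesis by simp
qed

lemma L2_subset: "f \<in> Lp_space M 2 \<Longrightarrow> f \<in> L1_plus_Linf M"
  using Lp_subset_L1_plus_Linf[of 2 M] by auto

lemma L2_add:
  assumes "f \<in> Lp_space M 2" "g \<in> Lp_space M 2"
  shows "(\<lambda>x. f x + g x) \<in> Lp_space M 2"
proof -
  have [measurable]: "f \<in> borel_measurable M" "g \<in> borel_measurable M"
    using assms by (auto simp: mem_L2_iff)
  have "(\<integral>\<^sup>+x. ennreal ((f x + g x)\<^sup>2) \<partial>M) \<le> (\<integral>\<^sup>+x. 2 * ennreal ((f x)\<^sup>2) + 2 * ennreal ((g x)\<^sup>2) \<partial>M)"
  proof (intro nn_integral_mono)
    fix x
    have "(f x + g x)\<^sup>2 \<le> 2 * (f x)\<^sup>2 + 2 * (g x)\<^sup>2"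
      using zero_le_power2[of "f x - g x"] by (simp add: power2_eq_square algebra_simps)
    then have "ennreal ((f x + g x)\<^sup>2) \<le> ennreal (2 * (f x)\<^sup>2 + 2 * (g x)\<^sup>2)" by (rule ennreal_leI)
    then show "ennreal ((f x + g x)\<^sup>2) \<le> 2 * ennreal ((f x)\<^sup>2) + 2 * ennreal ((g x)\<^sup>2)"
      by (simp add: ennreal_mult)
  qed
  also have "\<dots> = 2 * (\<integral>\<^sup>+x. ennreal ((f x)\<^sup>2) \<partial>M) + 2 * (\<integral>\<^sup>+x. ennreal ((g x)\<^sup>2) \<partial>M)"
    by (simp add: nn_integral_add nn_integral_cmult)
  also have "\<dots> < \<infinity>" using assms by (simp add: mem_L2_iff ennreal_mult_less_top)
  finally show ?thesis by (simp add: mem_L2_iff)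
qed

lemma L2_scale:
  assumes "f \<in> Lp_space M 2"
  shows "(\<lambda>x. c * f x) \<in> Lp_space M 2"
proof -
  have [measurable]: "f \<in> borel_measurable M" using assms by (auto simp: mem_L2_iff)
  have "(\<integral>\<^sup>+x. ennreal ((c * f x)\<^sup>2) \<partial>M) = ennreal (c\<^sup>2) * (\<integral>\<^sup>+x. ennreal ((f x)\<^sup>2) \<partial>M)"
    by (subst nn_integral_cmult[symmetric]) (auto simp: power_mult_distrib ennreal_mult)
  also have "\<dots> < \<infinity>" using assms by (simp add: mem_L2_iff ennreal_mult_less_top)
  finally show ?thesis by (simp add: mem_L2_iff)
qed

lemma L2_strongly_continuous_scale:
  assumes "L2_strongly_continuous f"
  shows "L2_strongly_continuous (\<lambda>x. c * f x)"
proof -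
  have f: "f \<in> Lp_space M 2" and lim: "((\<lambda>t. drift t f) \<longlongrightarrow> 0) (at_right 0)"
    using assms by (auto simp: L2_strongly_continuous_def)
  have [measurable]: "f \<in> borel_measurable M" using f by (auto simp: mem_L2_iff)
  have "((\<lambda>t. ennreal (c\<^sup>2) * drift t f) \<longlongrightarrow> ennreal (c\<^sup>2) * 0) (at_right 0)"
    using lim by (intro ennreal_tendsto_cmult) auto
  moreover have "eventually (\<lambda>t. ennreal (c\<^sup>2) * drift t f = drift t (\<lambda>x. c * f x)) (at_right 0)"
    using eventually_at_right_0_pos
  proof eventually_elim
    case (elim t)
    have [measurable]: "semigroup_op t f \<in> borel_measurable M"
      using elim by (intro semigroup_op_measurable) auto
    have "drift t (\<lambda>x. c * f x) = (\<integral>\<^sup>+x. ennreal (c\<^sup>2) * ennreal ((semigroup_op t f x - f x)\<^sup>2) \<partial>M)"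
      unfolding drift_def semigroup_op_scale
      by (intro nn_integral_cong) (simp add: ennreal_mult[symmetric] power_mult_distrib[symmetric] right_diff_distrib)
    also have "\<dots> = ennreal (c\<^sup>2) * drift t f"
      unfolding drift_def by (rule nn_integral_cmult) simp
    finally show ?case ..
  qed
  ultimately have "((\<lambda>t. drift t (\<lambda>x. c * f x)) \<longlongrightarrow> ennreal (c\<^sup>2) * 0) (at_right 0)"
    by (rule Lim_transform_eventually)
  then show ?thesis using L2_scale[OF f] by (simp add: L2_strongly_continuous_def)
qed

lemma drift_add_le:
  assumes t: "0 < t" and f: "f \<in> Lp_space M 2" and g: "g \<in> Lp_space M 2"
  shows "drift t (\<lambda>x. f x + g x) \<le> 2 * drift t f + 2 * drift t g"
proof -
  have [measurable]: "f \<in> borel_measurable M" "g \<in> borel_measurable M"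
    using f g by (auto simp: mem_L2_iff)
  have [measurable]: "semigroup_op t f \<in> borel_measurable M" "semigroup_op t g \<in> borel_measurable M"
    using t by (auto intro!: semigroup_op_measurable)
  have "AE x in M. semigroup_op t (\<lambda>x. f x + g x) x = semigroup_op t f x + semigroup_op t g x"
    using t f g by (intro semigroup_op_add L2_subset) auto
  then have "drift t (\<lambda>x. f x + g x) \<le>
     (\<integral>\<^sup>+x. 2 * ennreal ((semigroup_op t f x - f x)\<^sup>2) + 2 * ennreal ((semigroup_op t g x - g x)\<^sup>2) \<partial>M)"
    unfolding drift_def
  proof (intro nn_integral_mono_AE, eventually_elim)
    case (elim x)
    define a b where "a = semigroup_op t f x - f x" and "b = semigroup_op t g x - g x"
    have "(a + b)\<^sup>2 \<le> 2 * a\<^sup>2 + 2 * b\<^sup>2"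
      using zero_le_power2[of "a - b"] by (simp add: power2_eq_square algebra_simps)
    then have "ennreal ((a + b)\<^sup>2) \<le> ennreal (2 * a\<^sup>2 + 2 * b\<^sup>2)" by (rule ennreal_leI)
    also have "\<dots> = 2 * ennreal (a\<^sup>2) + 2 * ennreal (b\<^sup>2)" by (simp add: ennreal_mult)
    finally show ?case using elim by (simp add: a_def b_def algebra_simps)
  qed
  also have "\<dots> = 2 * drift t f + 2 * drift t g"
    unfolding drift_def by (simp add: nn_integral_add nn_integral_cmult)
  finally show ?thesis .
qed

lemma L2_strongly_continuous_add:
  assumes "L2_strongly_continuous f" "L2_strongly_continuous g"
  shows "L2_strongly_continuous (\<lambda>x. f x + g x)"
proof -
  have f: "f \<in> Lp_space M 2" "((\<lambda>t. drift t f) \<longlongrightarrow> 0) (at_right 0)"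
   and g: "g \<in> Lp_space M 2" "((\<lambda>t. drift t g) \<longlongrightarrow> 0) (at_right 0)"
    using assms by (auto simp: L2_strongly_continuous_def)
  have "((\<lambda>t. 2 * drift t f + 2 * drift t g) \<longlongrightarrow> 2 * 0 + 2 * 0) (at_right 0)"
    using f g by (intro tendsto_add ennreal_tendsto_cmult) auto
  then have lim: "((\<lambda>t. 2 * drift t f + 2 * drift t g) \<longlongrightarrow> 0) (at_right 0)" by simp
  have "eventually (\<lambda>t. drift t (\<lambda>x. f x + g x) \<le> 2 * drift t f + 2 * drift t g) (at_right 0)"
    using eventually_at_right_0_pos by eventually_elim (rule drift_add_le[OF _ f(1) g(1)])
  then have "((\<lambda>t. drift t (\<lambda>x. f x + g x)) \<longlongrightarrow> 0) (at_right 0)"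
    by (rule tendsto_sandwich[OF _ _ tendsto_const lim, rotated]) simp
  then show ?thesis using L2_add[OF f(1) g(1)] by (simp add: L2_strongly_continuous_def)
qed

lemma L2_strongly_continuous_zero: "L2_strongly_continuous (\<lambda>_. 0)"
proof -
  have "drift t (\<lambda>_. 0) = 0" for t by (simp add: drift_def semigroup_op_def)
  then show ?thesis by (simp add: L2_strongly_continuous_def mem_L2_iff)
qed

lemma L2_strongly_continuous_sum:
  "finite I \<Longrightarrow> (\<And>i. i \<in> I \<Longrightarrow> L2_strongly_continuous (f i)) \<Longrightarrow> L2_strongly_continuous (\<lambda>x. \<Sum>i\<in>I. f i x)"
  by (induction I rule: finite_induct) (simp_all add: L2_strongly_continuous_zero L2_strongly_continuous_add)

text \<open>With \<open>T\<close> for the operator at time \<open>t\<close>, \<open>T f - f\<close>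
  is \<open>T (f - g)\<close> plus \<open>T g - g\<close> minus \<open>f - g\<close>. The first term
  is no larger than the last by contractivity, and the middle one tends to \<open>0\<close>.\<close>

lemma L2_strongly_continuous_closed:
  assumes f: "f \<in> Lp_space M 2"
    and approx: "\<And>\<epsilon>. 0 < \<epsilon> \<Longrightarrow> \<exists>g. L2_strongly_continuous g \<and> (\<integral>\<^sup>+x. ennreal ((f x - g x)\<^sup>2) \<partial>M) \<le> ennreal \<epsilon>"
  shows "L2_strongly_continuous f"
proof -
  have [measurable]: "f \<in> borel_measurable M" using f by (auto simp: mem_L2_iff)
  have "((\<lambda>t. drift t f) \<longlongrightarrow> 0) (at_right 0)"
  proof (rule tendsto_0_ennrealI)
    fix e :: real assume e: "0 < e"
    \<comment> \<open>Three terms, each entering with the factor \<open>3\<close> of the inequality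
      for the square of a sum, account for \<open>e / 9\<close>.\<close>
    then obtain g where g: "L2_strongly_continuous g" and fg: "(\<integral>\<^sup>+x. ennreal ((f x - g x)\<^sup>2) \<partial>M) \<le> ennreal (e / 9)"
      using approx[of "e / 9"] by auto
    have g2: "g \<in> Lp_space M 2" and lim: "((\<lambda>t. drift t g) \<longlongrightarrow> 0) (at_right 0)"
      using g by (auto simp: L2_strongly_continuous_def)
    have [measurable]: "g \<in> borel_measurable M" using g2 by (auto simp: mem_L2_iff)
    have "eventually (\<lambda>t. drift t g \<le> ennreal (e / 9)) (at_right 0)"
      using e by (intro tendsto_0_ennrealD[OF lim]) auto
    then show "eventually (\<lambda>t. drift t f \<le> ennreal e) (at_right 0)"
      using eventually_at_right_0_pos
    proof eventually_elim
      case (elim t)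
      define u where "u = semigroup_op t (\<lambda>x. f x - g x)"
      have [measurable]: "semigroup_op t f \<in> borel_measurable M" "semigroup_op t g \<in> borel_measurable M" "u \<in> borel_measurable M"
        using elim unfolding u_def by (auto intro!: semigroup_op_measurable)
      have "AE x in M. u x = semigroup_op t f x - semigroup_op t g x"
        unfolding u_def using elim f g2 by (intro semigroup_op_diff L2_subset) auto
      then have "drift t f \<le> (\<integral>\<^sup>+x. 3 * ennreal ((u x)\<^sup>2) + (3 * ennreal ((semigroup_op t g x - g x)\<^sup>2) + 3 * ennreal ((f x - g x)\<^sup>2)) \<partial>M)"
        unfolding drift_def
      proof (intro nn_integral_mono_AE, eventually_elim)
        case (elim x)
        define a b c where "a = u x" and "b = semigroup_op t g x - g x" and "c = f x - g x"
        have "(a + b - c)\<^sup>2 \<le> 3 * a\<^sup>2 + (3 * b\<^sup>2 + 3 * c\<^sup>2)"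
          \<comment> \<open>The difference of the two sides is the sum of these three
            squares.\<close>
          using zero_le_power2[of "a - b"] zero_le_power2[of "a + c"] zero_le_power2[of "b + c"]
          by (simp add: power2_eq_square algebra_simps)
        then have "ennreal ((a + b - c)\<^sup>2) \<le> ennreal (3 * a\<^sup>2 + (3 * b\<^sup>2 + 3 * c\<^sup>2))" by (rule ennreal_leI)
        also have "\<dots> = 3 * ennreal (a\<^sup>2) + (3 * ennreal (b\<^sup>2) + 3 * ennreal (c\<^sup>2))" by (simp add: ennreal_mult)
        also have "a + b - c = semigroup_op t f x - f x" using elim by (simp add: a_def b_def c_def)
        finally show ?case by (simp add: a_def b_def c_def)
      qed
      also have "\<dots> = 3 * (\<integral>\<^sup>+x. ennreal ((u x)\<^sup>2) \<partial>M) + (3 * drift t g + 3 * (\<integral>\<^sup>+x. ennreal ((f x - g x)\<^sup>2) \<partial>M))"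
        unfolding drift_def by (simp add: nn_integral_add nn_integral_cmult)
      also have "\<dots> \<le> 3 * ennreal (e / 9) + (3 * ennreal (e / 9) + 3 * ennreal (e / 9))"
      proof -
        have "(\<integral>\<^sup>+x. ennreal ((u x)\<^sup>2) \<partial>M) \<le> ennreal (e / 9)"
          unfolding u_def using nn_integral_semigroup_op_square_le[of t "\<lambda>x. f x - g x"] elim fg by auto
        then show ?thesis using elim(1) fg by (intro add_mono mult_left_mono) auto
      qed
      also have "\<dots> = ennreal (3 * (e / 9) + (3 * (e / 9) + 3 * (e / 9)))"
        using e by (simp only: ennreal_plus ennreal_mult ennreal_numeral)
      finally show ?case by simp
    qed
  qed
  then show ?thesis using f by (simp add: L2_strongly_continuous_def)
qed

text \<open>The squared error of an indicator is controlled by the mass that leaves the set: the mass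
  entering it from outside is at most as large, by symmetry of the kernel.\<close>

lemma drift_indicator_le:
  assumes t: "0 < t" and [measurable]: "U \<in> sets M" and fin: "emeasure M U < \<infinity>"
  shows "drift t (indicator U) \<le>
    2 * (\<integral>\<^sup>+x. ennreal (1 - semigroup_op t (indicator U) x) * indicator U x \<partial>M)"
proof -
  define g where "g = semigroup_op t (indicator U)"
  have [measurable]: "g \<in> borel_measurable M"
    unfolding g_def using t by (intro semigroup_op_measurable) auto
  have g_eq: "0 \<le> g x" "ennreal (g x) = (\<integral>\<^sup>+y. ennreal (P t x y) * indicator U y \<partial>M)" "g x \<le> 1"
    if x: "x \<in> space M" for x
  proof -
    have le: "(\<integral>\<^sup>+y. ennreal (P t x y) * indicator U y \<partial>M) \<le> 1"
    proof -
      have "(\<integral>\<^sup>+y. ennreal (P t x y) * indicator U y \<partial>M) \<le> (\<integral>\<^sup>+y. ennreal (P t x y) \<partial>M)"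
        by (intro nn_integral_mono) (simp add: indicator_def)
      also have "\<dots> \<le> ennreal (C t)" using t x by (rule kernel_mass)
      also have "\<dots> \<le> 1" using mass_le_1[OF t] by simp
      finally show ?thesis .
    qed
    have "g x = enn2real (\<integral>\<^sup>+y. ennreal (P t x y * indicator U y) \<partial>M)"
      unfolding g_def semigroup_op_def using t x
      by (simp, intro integral_eq_nn_integral) (auto simp: kernel_nonneg)
    also have "(\<integral>\<^sup>+y. ennreal (P t x y * indicator U y) \<partial>M) = (\<integral>\<^sup>+y. ennreal (P t x y) * indicator U y \<partial>M)"
      by (intro nn_integral_cong) (simp add: indicator_def)
    finally have *: "g x = enn2real (\<integral>\<^sup>+y. ennreal (P t x y) * indicator U y \<partial>M)" .
    show "0 \<le> g x" unfolding * by simp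
    show eq: "ennreal (g x) = (\<integral>\<^sup>+y. ennreal (P t x y) * indicator U y \<partial>M)"
      unfolding * using le by (intro ennreal_enn2real) (auto simp: less_top[symmetric] top_unique)
    show "g x \<le> 1" using le unfolding eq[symmetric] by simp
  qed
  define out where "out = (\<integral>\<^sup>+x. ennreal (1 - g x) * indicator U x \<partial>M)"
  define inn where "inn = (\<integral>\<^sup>+x. ennreal (g x) * indicator (space M - U) x \<partial>M)"
  define stay where "stay = (\<integral>\<^sup>+x. ennreal (g x) * indicator U x \<partial>M)"
  \<comment> \<open>The left side is the total mass of the image of the indicator, which by the
    column masses is at most the measure of \<open>U\<close>; that measure in turn equals
    \<open>stay + out\<close>. Cancelling the finite \<open>stay\<close> compares entering with
    leaving mass.\<close>
  have "stay + inn = (\<integral>\<^sup>+x. ennreal (g x) \<partial>M)"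
    unfolding stay_def inn_def
    by (subst nn_integral_add[symmetric]) (auto intro!: nn_integral_cong simp: indicator_def)
  also have "\<dots> = (\<integral>\<^sup>+x. \<integral>\<^sup>+y. ennreal (P t x y) * indicator U y \<partial>M \<partial>M)"
    by (intro nn_integral_cong g_eq)
  also have "\<dots> \<le> ennreal (C t) * (\<integral>\<^sup>+y. indicator U y \<partial>M)"
    using t by (intro nn_integral_kernel_le) auto
  also have "\<dots> \<le> 1 * (\<integral>\<^sup>+y. indicator U y \<partial>M)"
    using mass_le_1[OF t] by (intro mult_right_mono) auto
  also have "\<dots> = (\<integral>\<^sup>+x. ennreal (g x) * indicator U x + ennreal (1 - g x) * indicator U x \<partial>M)"
    unfolding mult_1 using g_eq(1,3)
    by (intro nn_integral_cong) (auto simp: indicator_def simp flip: ennreal_plus)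
  also have "\<dots> = stay + out"
    unfolding stay_def out_def by (rule nn_integral_add) auto
  finally have "stay + inn \<le> stay + out" .
  moreover have "stay \<noteq> \<infinity>"
  proof -
    have "stay \<le> (\<integral>\<^sup>+x. indicator U x \<partial>M)"
      unfolding stay_def using g_eq(1,3) by (intro nn_integral_mono) (auto simp: indicator_def)
    then show ?thesis using fin by auto
  qed
  ultimately have io: "inn \<le> out" by (simp add: ennreal_add_left_cancel_le)
  have "drift t (indicator U) \<le> (\<integral>\<^sup>+x. ennreal (1 - g x) * indicator U x + ennreal (g x) * indicator (space M - U) x \<partial>M)"
    unfolding drift_def g_def[symmetric]
  proof (intro nn_integral_mono)
    fix x assume x: "x \<in> space M"
    \<comment> \<open>The values of \<open>g\<close> lie in \<open>[0,1]\<close>, so the error is at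
      most \<open>1\<close> in absolute value and its square is at most the error itself.\<close>
    have "(g x - indicator U x)\<^sup>2 \<le> (if x \<in> U then 1 - g x else g x)"
    proof (cases "x \<in> U")
      case True
      have "(1 - g x) * (1 - g x) \<le> (1 - g x) * 1"
        using g_eq(1,3)[OF x] by (intro mult_left_mono) auto
      then show ?thesis using True by (simp add: power2_eq_square algebra_simps)
    next
      case False
      have "g x * g x \<le> g x * 1"
        using g_eq(1,3)[OF x] by (intro mult_left_mono) auto
      then show ?thesis using False by (simp add: power2_eq_square)
    qed
    then have "ennreal ((g x - indicator U x)\<^sup>2) \<le> ennreal (if x \<in> U then 1 - g x else g x)"
      by (rule ennreal_leI)
    then show "ennreal ((g x - indicator U x)\<^sup>2) \<le> ennreal (1 - g x) * indicator U x + ennreal (g x) * indicator (space M - U) x"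
      using x by (auto simp: indicator_def)
  qed
  also have "\<dots> = out + inn"
    unfolding out_def inn_def by (rule nn_integral_add) auto
  also have "\<dots> \<le> out + out" using io by (rule add_left_mono)
  finally show ?thesis by (simp add: out_def g_def mult_2)
qed

lemma indicator_in_L2:
  "A \<in> sets M \<Longrightarrow> emeasure M A < \<infinity> \<Longrightarrow> indicator A \<in> Lp_space M 2"
proof -
  assume A: "A \<in> sets M" "emeasure M A < \<infinity>"
  have "(\<integral>\<^sup>+x. ennreal ((indicator A x)\<^sup>2) \<partial>M) = (\<integral>\<^sup>+x. indicator A x \<partial>M)"
    by (intro nn_integral_cong) (simp add: indicator_def)
  then show ?thesis using A by (simp add: mem_L2_iff)
qed

text \<open>By \<open>drift_indicator_le\<close> only the leaving mass matters. Its density tends to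
  \<open>0\<close> at each point of \<open>U\<close> and is dominated by the indicator of
  \<open>U\<close>, which is integrable.\<close>

lemma L2_strongly_continuous_indicator_concentrating:
  assumes [measurable]: "U \<in> sets M" and fin: "emeasure M U < \<infinity>"
    and lim: "\<And>x. x \<in> U \<Longrightarrow> ((\<lambda>t. \<integral>\<^sup>+y. ennreal (P t x y) * indicator U y \<partial>M) \<longlongrightarrow> 1) (at_right 0)"
  shows "L2_strongly_continuous (indicator U)"
proof -
  define W where "W = (\<lambda>t. \<integral>\<^sup>+x. ennreal (1 - semigroup_op t (indicator U) x) * indicator U x \<partial>M)"
  have op_eq: "semigroup_op t (indicator U) x = enn2real (\<integral>\<^sup>+y. ennreal (P t x y) * indicator U y \<partial>M)"
    if "0 < t" "x \<in> space M" for t x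
  proof -
    have "semigroup_op t (indicator U) x = enn2real (\<integral>\<^sup>+y. ennreal (P t x y * indicator U y) \<partial>M)"
      unfolding semigroup_op_def using that
      by (simp, intro integral_eq_nn_integral) (auto simp: kernel_nonneg)
    also have "(\<integral>\<^sup>+y. ennreal (P t x y * indicator U y) \<partial>M) = (\<integral>\<^sup>+y. ennreal (P t x y) * indicator U y \<partial>M)"
      by (intro nn_integral_cong) (simp add: indicator_def)
    finally show ?thesis .
  qed
  have "(W \<longlongrightarrow> 0) (at_right 0)"
  \<comment> \<open>Dominated convergence is applied along sequences, so the limit at
    \<open>0\<close> is first reduced to sequences; the bound \<open>b=1\<close> is
    arbitrary.\<close>
  proof (rule tendsto_at_right_sequentially[where b=1])
    fix S :: "nat \<Rightarrow> real"
    assume S: "\<And>n. 0 < S n" "S \<longlonglongrightarrow> 0"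
    have [measurable]: "semigroup_op (S n) (indicator U) \<in> borel_measurable M" for n
      using S(1)[of n] by (intro semigroup_op_measurable) auto
    have "(\<lambda>n. W (S n)) \<longlonglongrightarrow> (\<integral>\<^sup>+x. 0 \<partial>M)"
      unfolding W_def
    proof (rule nn_integral_dominated_convergence[where w="indicator U"])
      show "AE x in M. ennreal (1 - semigroup_op (S n) (indicator U) x) * indicator U x \<le> indicator U x" for n
        using S(1)[of n] by (intro AE_I2) (auto simp: indicator_def op_eq)
      show "(\<integral>\<^sup>+x. indicator U x \<partial>M) < \<infinity>" using fin by simp
      show "AE x in M. (\<lambda>n. ennreal (1 - semigroup_op (S n) (indicator U) x) * indicator U x) \<longlonglongrightarrow> 0"
      proof (rule AE_I2)
        fix x assume x: "x \<in> space M"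
        show "(\<lambda>n. ennreal (1 - semigroup_op (S n) (indicator U) x) * indicator U x) \<longlonglongrightarrow> 0"
        proof (cases "x \<in> U")
          case True
          have "S n \<noteq> 0" for n using S(1)[of n] by simp
          then have "filterlim S (at_right 0) sequentially"
            using S by (auto simp: filterlim_at)
          from filterlim_compose[OF lim[OF True] this]
          have "(\<lambda>n. enn2real (\<integral>\<^sup>+y. ennreal (P (S n) x y) * indicator U y \<partial>M)) \<longlonglongrightarrow> enn2real 1"
            by (intro tendsto_enn2real) auto
          then have "(\<lambda>n. semigroup_op (S n) (indicator U) x) \<longlonglongrightarrow> 1"
            using S x by (simp add: op_eq)
          then have "(\<lambda>n. ennreal (1 - semigroup_op (S n) (indicator U) x)) \<longlonglongrightarrow> ennreal (1 - 1)"
            by (intro tendsto_intros)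
          then show ?thesis using True by simp
        qed simp
      qed
    qed auto
    then show "(\<lambda>n. W (S n)) \<longlonglongrightarrow> 0" by simp
  qed simp
  then have "((\<lambda>t. 2 * W t) \<longlongrightarrow> 2 * 0) (at_right 0)"
    by (intro ennreal_tendsto_cmult) auto
  then have lim: "((\<lambda>t. 2 * W t) \<longlongrightarrow> 0) (at_right 0)" by simp
  have "eventually (\<lambda>t. drift t (indicator U) \<le> 2 * W t) (at_right 0)"
    using eventually_at_right_0_pos unfolding W_def by eventually_elim (rule drift_indicator_le[OF _ assms(1,2)])
  then have "((\<lambda>t. drift t (indicator U)) \<longlongrightarrow> 0) (at_right 0)"
    by (rule tendsto_sandwich[OF _ _ tendsto_const lim, rotated]) simp
  then show ?thesis using indicator_in_L2[OF assms(1,2)] by (simp add: L2_strongly_continuous_def)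
qed

lemma L2_strongly_continuous_indicator:
  assumes A[measurable]: "A \<in> sets M" and fin: "emeasure M A < \<infinity>"
  shows "L2_strongly_continuous (indicator A)"
proof (rule L2_strongly_continuous_closed[OF indicator_in_L2[OF assms]])
  fix \<epsilon> :: real assume "0 < \<epsilon>"
  from concentrating[OF A this] obtain U where U[measurable]: "U \<in> sets M" and AU: "A \<subseteq> U"
    and le: "emeasure M (U - A) \<le> ennreal \<epsilon>"
    and lim: "\<And>x. x \<in> U \<Longrightarrow> ((\<lambda>t. \<integral>\<^sup>+y. ennreal (P t x y) * indicator U y \<partial>M) \<longlongrightarrow> 1) (at_right 0)"
    by blast
  have "emeasure M U \<le> emeasure M A + emeasure M (U - A)"
    using emeasure_subadditive[of A M "U - A"] AU by (simp add: Un_absorb1)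
  also have "\<dots> < \<infinity>" using fin le by (auto simp: less_top[symmetric] top_unique)
  finally have "L2_strongly_continuous (indicator U)"
    by (intro L2_strongly_continuous_indicator_concentrating lim) auto
  moreover have "(\<integral>\<^sup>+x. ennreal ((indicator A x - indicator U x)\<^sup>2) \<partial>M) = (\<integral>\<^sup>+x. indicator (U - A) x \<partial>M)"
    using AU by (intro nn_integral_cong) (auto simp: indicator_def)
  ultimately show "\<exists>g. L2_strongly_continuous g \<and> (\<integral>\<^sup>+x. ennreal ((indicator A x - g x)\<^sup>2) \<partial>M) \<le> ennreal \<epsilon>"
    using le by (intro exI[of _ "indicator U"]) simp
qed

lemma L2_strongly_continuous_simple_function:
  fixes s :: "'a \<Rightarrow> real"
  assumes s: "simple_function M s" and s2: "s \<in> Lp_space M 2"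
  shows "L2_strongly_continuous s"
proof (rule L2_strongly_continuous_cong)
  \<comment> \<open>The value \<open>0\<close> is left out because its level set may have infinite
    measure; the other level sets are finite since \<open>s\<close> is square integrable.\<close>
  show "L2_strongly_continuous (\<lambda>x. \<Sum>c\<in>s ` space M - {0}. c * indicator (s -` {c} \<inter> space M) x)"
  proof (intro L2_strongly_continuous_sum L2_strongly_continuous_scale L2_strongly_continuous_indicator)
    show "finite (s ` space M - {0})" using s by (simp add: simple_function_def)
    fix c assume c: "c \<in> s ` space M - {0}"
    show m[measurable]: "s -` {c} \<inter> space M \<in> sets M" using s by (rule simple_functionD)
    have "ennreal (c\<^sup>2) * emeasure M (s -` {c} \<inter> space M) = (\<integral>\<^sup>+x. ennreal (c\<^sup>2) * indicator (s -` {c} \<inter> space M) x \<partial>M)"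
      by (simp add: nn_integral_cmult)
    also have "\<dots> \<le> (\<integral>\<^sup>+x. ennreal ((s x)\<^sup>2) \<partial>M)"
      by (intro nn_integral_mono) (auto simp: indicator_def)
    also have "\<dots> < \<infinity>" using s2 by (simp add: mem_L2_iff)
    finally show "emeasure M (s -` {c} \<inter> space M) < \<infinity>"
      using c by (auto simp: ennreal_mult_less_top ennreal_mult_eq_top_iff less_top)
  qed
  fix x assume x: "x \<in> space M"
  have fin: "finite (s ` space M)" using s by (simp add: simple_function_def)
  have "(\<Sum>c\<in>s ` space M - {0}. c * indicator (s -` {c} \<inter> space M) x) =
      (\<Sum>c\<in>s ` space M. c * indicator (s -` {c} \<inter> space M) x)"
    using fin by (intro sum.mono_neutral_left) auto
  also have "\<dots> = s x"
    using simple_function_indicator_representation_banach[OF s x, symmetric]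
    by (simp only: real_scaleR_def mult.commute)
  finally show "(\<Sum>c\<in>s ` space M - {0}. c * indicator (s -` {c} \<inter> space M) x) = s x" .
qed

lemma L2_strongly_continuous_L2:
  assumes f: "f \<in> Lp_space M 2"
  shows "L2_strongly_continuous f"
proof (rule L2_strongly_continuous_closed[OF f])
  fix \<epsilon> :: real assume \<epsilon>: "0 < \<epsilon>"
  have [measurable]: "f \<in> borel_measurable M" and f2: "(\<integral>\<^sup>+x. ennreal ((f x)\<^sup>2) \<partial>M) < \<infinity>"
    using f by (auto simp: mem_L2_iff)
  obtain s where s: "\<And>i. simple_function M (s i)" and lim: "\<And>x. x \<in> space M \<Longrightarrow> (\<lambda>i. s i x) \<longlonglongrightarrow> f x"
    and bound: "\<And>i x. x \<in> space M \<Longrightarrow> dist (s i x) 0 \<le> 2 * dist (f x) 0"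
    using borel_measurable_implies_sequence_metric[OF \<open>f \<in> borel_measurable M\<close>, of 0] by metis
  have [measurable]: "s i \<in> borel_measurable M" for i using s by (rule borel_measurable_simple_function)
  have L2: "s i \<in> Lp_space M 2" for i
  proof -
    have "(\<integral>\<^sup>+x. ennreal ((s i x)\<^sup>2) \<partial>M) \<le> (\<integral>\<^sup>+x. 4 * ennreal ((f x)\<^sup>2) \<partial>M)"
    proof (intro nn_integral_mono)
      fix x assume "x \<in> space M"
      then have "\<bar>s i x\<bar>\<^sup>2 \<le> (2 * \<bar>f x\<bar>)\<^sup>2"
        using bound[of x i] by (intro power_mono) auto
      then have "ennreal ((s i x)\<^sup>2) \<le> ennreal (4 * (f x)\<^sup>2)"
        by (intro ennreal_leI) (simp add: power_mult_distrib)
      then show "ennreal ((s i x)\<^sup>2) \<le> 4 * ennreal ((f x)\<^sup>2)" by (simp add: ennreal_mult)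
    qed
    also have "\<dots> < \<infinity>" using f2 by (simp add: nn_integral_cmult ennreal_mult_less_top)
    finally show ?thesis by (simp add: mem_L2_iff)
  qed
  have "(\<lambda>i. \<integral>\<^sup>+x. ennreal ((f x - s i x)\<^sup>2) \<partial>M) \<longlonglongrightarrow> (\<integral>\<^sup>+x. 0 \<partial>M)"
  \<comment> \<open>The approximants satisfy
    \<open>\<bar>s i x\<bar> \<le> 2 * \<bar>f x\<bar>\<close>, so the error is at most
    \<open>3 * \<bar>f x\<bar>\<close>, with square \<open>9 * (f x)\<^sup>2\<close>.\<close>
  proof (rule nn_integral_dominated_convergence[where w="\<lambda>x. 9 * ennreal ((f x)\<^sup>2)"])
    show "(\<integral>\<^sup>+x. 9 * ennreal ((f x)\<^sup>2) \<partial>M) < \<infinity>"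
      using f2 by (simp add: nn_integral_cmult ennreal_mult_less_top)
    show "AE x in M. ennreal ((f x - s i x)\<^sup>2) \<le> 9 * ennreal ((f x)\<^sup>2)" for i
    proof (rule AE_I2)
      fix x assume "x \<in> space M"
      then have "\<bar>f x - s i x\<bar>\<^sup>2 \<le> (3 * \<bar>f x\<bar>)\<^sup>2"
        using bound[of x i] by (intro power_mono) auto
      then have "ennreal ((f x - s i x)\<^sup>2) \<le> ennreal (9 * (f x)\<^sup>2)"
        by (intro ennreal_leI) (simp add: power_mult_distrib)
      then show "ennreal ((f x - s i x)\<^sup>2) \<le> 9 * ennreal ((f x)\<^sup>2)" by (simp add: ennreal_mult)
    qed
    show "AE x in M. (\<lambda>i. ennreal ((f x - s i x)\<^sup>2)) \<longlonglongrightarrow> 0"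
    proof (rule AE_I2)
      fix x assume "x \<in> space M"
      then have "(\<lambda>i. ennreal ((f x - s i x)\<^sup>2)) \<longlonglongrightarrow> ennreal ((f x - f x)\<^sup>2)"
        by (intro tendsto_intros lim)
      then show "(\<lambda>i. ennreal ((f x - s i x)\<^sup>2)) \<longlonglongrightarrow> 0" by simp
    qed
  qed auto
  then have "(\<lambda>i. \<integral>\<^sup>+x. ennreal ((f x - s i x)\<^sup>2) \<partial>M) \<longlonglongrightarrow> 0" by simp
  from eventually_happens'[OF _ tendsto_0_ennrealD[OF this \<epsilon>]]
  obtain i where "(\<integral>\<^sup>+x. ennreal ((f x - s i x)\<^sup>2) \<partial>M) \<le> ennreal \<epsilon>" by auto
  moreover have "L2_strongly_continuous (s i)"
    using s L2 by (rule L2_strongly_continuous_simple_function)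
  ultimately show "\<exists>g. L2_strongly_continuous g \<and> (\<integral>\<^sup>+x. ennreal ((f x - g x)\<^sup>2) \<partial>M) \<le> ennreal \<epsilon>" by blast
qed

lemma tendsto_L2_semigroup_op:
  assumes f: "f \<in> Lp_space M 2"
  shows "((\<lambda>t. Lp_norm M 2 (\<lambda>x. semigroup_op t f x - f x)) \<longlongrightarrow> 0) (at_right 0)"
proof (rule tendsto_0_ennrealI)
  fix e :: real assume e: "0 < e"
  have "((\<lambda>t. drift t f) \<longlongrightarrow> 0) (at_right 0)"
    using L2_strongly_continuous_L2[OF f] by (simp add: L2_strongly_continuous_def)
  then have "eventually (\<lambda>t. drift t f \<le> ennreal (e\<^sup>2)) (at_right 0)"
    using e by (intro tendsto_0_ennrealD) auto
  then show "eventually (\<lambda>t. Lp_norm M 2 (\<lambda>x. semigroup_op t f x - f x) \<le> ennreal e) (at_right 0)"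
  proof eventually_elim
    case (elim t)
    then obtain r where r: "r \<ge> 0" "drift t f = ennreal r" "r \<le> e\<^sup>2"
      by (cases "drift t f") (auto simp: top_unique)
    have "Lp_norm M 2 (\<lambda>x. semigroup_op t f x - f x) = ennreal (sqrt r)"
      using r by (simp add: Lp_norm_def drift_def powr_half_sqrt)
    also have "\<dots> \<le> ennreal e"
      using r e real_sqrt_le_mono[of r "e\<^sup>2"] by (intro ennreal_leI) simp
    finally show ?case .
  qed
qed

theorem submarkovian_semigroup_op:
  "submarkovian_semigroup M (L1_plus_Linf M) semigroup_op"
proof unfold_locales
  show "L1_plus_Linf M \<subseteq> borel_measurable M" by (auto dest: L1_plus_Linf_measurable)
  show "\<And>f g. f \<in> L1_plus_Linf M \<Longrightarrow> g \<in> L1_plus_Linf M \<Longrightarrow> (\<lambda>x. f x + g x) \<in> L1_plus_Linf M"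
    by (rule L1_plus_Linf_add)
  show "\<And>c f. f \<in> L1_plus_Linf M \<Longrightarrow> (\<lambda>x. c * f x) \<in> L1_plus_Linf M"
    by (rule L1_plus_Linf_scale)
  show "\<And>p. 1 \<le> p \<Longrightarrow> Lp_space M p \<subseteq> L1_plus_Linf M" by (rule Lp_subset_L1_plus_Linf)
  show "\<And>t f. 0 \<le> t \<Longrightarrow> f \<in> L1_plus_Linf M \<Longrightarrow> semigroup_op t f \<in> borel_measurable M"
    by (intro semigroup_op_measurable L1_plus_Linf_measurable)
  show "\<And>t f g. 0 \<le> t \<Longrightarrow> f \<in> L1_plus_Linf M \<Longrightarrow> g \<in> L1_plus_Linf M \<Longrightarrow> (AE x in M. f x = g x) \<Longrightarrow>
      AE x in M. semigroup_op t f x = semigroup_op t g x"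
    by (intro semigroup_op_AE_cong L1_plus_Linf_measurable)
  show "\<And>t f g. 0 \<le> t \<Longrightarrow> f \<in> L1_plus_Linf M \<Longrightarrow> g \<in> L1_plus_Linf M \<Longrightarrow>
      AE x in M. semigroup_op t (\<lambda>x. f x + g x) x = semigroup_op t f x + semigroup_op t g x"
    by (rule semigroup_op_add)
  show "\<And>t c f. AE x in M. semigroup_op t (\<lambda>x. c * f x) x = c * semigroup_op t f x"
    by (simp add: semigroup_op_scale)
  show "\<And>f. AE x in M. semigroup_op 0 f x = f x" by (simp add: semigroup_op_def)
  show "\<And>p t f. 1 \<le> p \<Longrightarrow> 0 \<le> t \<Longrightarrow> f \<in> Lp_space M p \<Longrightarrow> Lp_norm M p (semigroup_op t f) \<le> Lp_norm M p f"
    by (intro semigroup_op_contraction) (auto simp: Lp_space_def)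
  show "\<And>p s t f. 1 \<le> p \<Longrightarrow> 0 \<le> s \<Longrightarrow> 0 \<le> t \<Longrightarrow> f \<in> Lp_space M p \<Longrightarrow>
      AE x in M. semigroup_op (s + t) f x = semigroup_op s (semigroup_op t f) x"
    using Lp_subset_L1_plus_Linf by (intro semigroup_op_semigroup) auto
  show "\<And>t f g. 0 \<le> t \<Longrightarrow> f \<in> Lp_space M 2 \<Longrightarrow> g \<in> Lp_space M 2 \<Longrightarrow>
      (LINT x|M. semigroup_op t f x * g x) = (LINT x|M. f x * semigroup_op t g x)"
    by (rule semigroup_op_symmetric)
  show "\<And>f. f \<in> Lp_space M 2 \<Longrightarrow>
      ((\<lambda>t. Lp_norm M 2 (\<lambda>x. semigroup_op t f x - f x)) \<longlongrightarrow> 0) (at_right 0)"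
    by (rule tendsto_L2_semigroup_op)
  show "\<And>t f. 0 \<le> t \<Longrightarrow> (AE x in M. 0 \<le> f x) \<Longrightarrow> AE x in M. 0 \<le> semigroup_op t f x"
    by (rule semigroup_op_nonneg)
  fix t :: real assume "0 \<le> t"
  show "AE x in M. semigroup_op t (\<lambda>_. 1) x \<le> 1"
  proof (cases "t = 0")
    case False
    then have t: "0 < t" using \<open>0 \<le> t\<close> by simp
    show ?thesis
      by (rule AE_I2) (use semigroup_op_one_le[OF t] mass_le_1[OF t] in \<open>auto intro: order_trans\<close>)
  qed (simp add: semigroup_op_def)
qed

text \<open>One time with \<open>C t < 1\<close> is enough: the constant \<open>1\<close> would have
  to be fixed, but its image is at most \<open>C t\<close>. The nonzero measure rules out that both
  hold almost everywhere on a null space.\<close>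

theorem not_markovian_semigroup_op:
  assumes "emeasure M (space M) \<noteq> 0" "0 < t" "C t < 1"
  shows "\<not> markovian_semigroup M (L1_plus_Linf M) semigroup_op"
proof
  assume "markovian_semigroup M (L1_plus_Linf M) semigroup_op"
  then have "AE x in M. semigroup_op t (\<lambda>_. 1) x = 1"
    using assms(2) by (intro markovian_semigroup.conservative) auto
  moreover have "AE x in M. semigroup_op t (\<lambda>_. 1) x \<le> C t"
    using assms(2) by (intro AE_I2 semigroup_op_one_le) auto
  ultimately have "AE x in M. False"
    by eventually_elim (use assms(3) in auto)
  then show False using assms(1) by (simp add: AE_iff_null null_sets_def)
qed

end

section \<open>The multidimensional Laguerre semigroup\<close>

lemma open_Rplus: "open (Rplus :: (real ^ 'd) set)"
proof -
  have *: "(Rplus :: (real ^ 'd) set) = (\<Inter>i. {x. 0 < x $ i})" by (auto simp: Rplus_def)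
  show ?thesis
    unfolding * by (intro open_INT ballI finite_class.finite_UNIV open_Collect_less continuous_intros)
qed

lemma Rplus_borel [measurable]: "Rplus \<in> sets borel"
  by (rule borel_open[OF open_Rplus])

lemma space_Rplus_measure: "space Rplus_measure = Rplus"
  by (simp add: Rplus_measure_def space_restrict_space)

lemma component_Rplus_measurable [measurable]:
  assumes "f \<in> measurable N (Rplus_measure :: (real ^ 'd) measure)"
  shows "(\<lambda>x. f x $ i) \<in> borel_measurable N"
proof -
  have "(\<lambda>y :: real ^ 'd. y $ i) \<in> borel_measurable Rplus_measure"
    unfolding Rplus_measure_def by (rule measurable_restrict_space1) simp
  from measurable_compose[OF assms this] show ?thesis .
qed

lemma sigma_finite_Rplus_measure: "sigma_finite_measure Rplus_measure"
  unfolding Rplus_measure_def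
  by (intro sigma_finite_measure_restrict_space lborel.sigma_finite_measure_axioms) simp

text \<open>Translates between products over the Euclidean basis, in which Lebesgue measure
  factorises, and products over coordinates; \<open>inv\<close> recovers the coordinate from the
  unit vector.\<close>

lemma prod_Basis_cart:
  fixes y :: "real ^ 'd" and f :: "'d \<Rightarrow> real \<Rightarrow> 'c::comm_monoid_mult"
  shows "(\<Prod>b\<in>Basis. f (inv (\<lambda>i. axis i (1::real)) b) (y \<bullet> b)) = (\<Prod>i\<in>UNIV. f i (y $ i))"
proof -
  have inj: "inj (\<lambda>i :: 'd. axis i (1::real))" by (auto simp: inj_on_def axis_eq_axis)
  have *: "(Basis :: (real ^ 'd) set) = range (\<lambda>i. axis i 1)" by (auto simp: Basis_vec_def)
  have "(\<Prod>b\<in>Basis. f (inv (\<lambda>i. axis i (1::real)) b) (y \<bullet> b)) =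
      (\<Prod>i\<in>UNIV. f (inv (\<lambda>i. axis i (1::real)) (axis i 1)) (y \<bullet> axis i 1))"
    unfolding * by (simp only: prod.reindex[OF inj] o_def)
  also have "\<dots> = (\<Prod>i\<in>UNIV. f i (y $ i))"
    by (intro prod.cong) (simp_all add: inv_f_f[OF inj] inner_axis)
  finally show ?thesis .
qed

text \<open>The indicator of the orthant is itself a product over the coordinates and is absorbed
  into the factors before Tonelli is applied on the whole space.\<close>

lemma nn_integral_Rplus_prod:
  fixes f :: "'d::finite \<Rightarrow> real \<Rightarrow> ennreal"
  assumes [measurable]: "\<And>i. f i \<in> borel_measurable borel"
  shows "(\<integral>\<^sup>+y. (\<Prod>i\<in>UNIV. f i (y $ i)) \<partial>(Rplus_measure :: (real ^ 'd) measure)) =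
    (\<Prod>i\<in>UNIV. \<integral>\<^sup>+u. f i u * indicator {0<..} u \<partial>lborel)"
proof -
  define g where "g = (\<lambda>i u. f i u * indicator {0<..} u)"
  have [measurable]: "g i \<in> borel_measurable borel" for i unfolding g_def by measurable
  have "(\<integral>\<^sup>+y. (\<Prod>i\<in>UNIV. f i (y $ i)) \<partial>(Rplus_measure :: (real ^ 'd) measure)) =
      (\<integral>\<^sup>+y. (\<Prod>i\<in>UNIV. f i (y $ i)) * indicator Rplus y \<partial>lborel)"
    unfolding Rplus_measure_def by (rule nn_integral_restrict_space) simp
  also have "\<dots> = (\<integral>\<^sup>+y. (\<Prod>i\<in>UNIV. g i (y $ i)) \<partial>(lborel :: (real ^ 'd) measure))"
  proof (intro nn_integral_cong)
    fix y :: "real ^ 'd"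
    have "indicator Rplus y = (\<Prod>i\<in>UNIV. (indicator {0<..} (y $ i) :: ennreal))"
    proof (cases "y \<in> Rplus")
      case False
      then obtain i where "\<not> 0 < y $ i" by (auto simp: Rplus_def)
      then have "(\<Prod>i\<in>UNIV. (indicator {0<..} (y $ i) :: ennreal)) = 0"
        by (intro prod_zero bexI[of _ i]) auto
      then show ?thesis using False by simp
    qed (simp add: Rplus_def)
    then show "(\<Prod>i\<in>UNIV. f i (y $ i)) * indicator Rplus y = (\<Prod>i\<in>UNIV. g i (y $ i))"
      by (simp add: g_def prod.distrib)
  qed
  also have "\<dots> = (\<integral>\<^sup>+y. (\<Prod>b\<in>Basis. g (inv (\<lambda>i. axis i (1::real)) b) (y \<bullet> b)) \<partial>(lborel :: (real ^ 'd) measure))"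
    by (simp only: prod_Basis_cart)
  also have "\<dots> = (\<Prod>b\<in>(Basis :: (real ^ 'd) set). \<integral>\<^sup>+u. g (inv (\<lambda>i. axis i (1::real)) b) u \<partial>lborel)"
    by (rule nn_integral_lborel_prod) auto
  also have "\<dots> = (\<Prod>i\<in>UNIV. \<integral>\<^sup>+u. g i u \<partial>lborel)"
    \<comment> \<open>The factors here are constants in the coordinate, so the evaluation point
      \<open>0\<close> is an arbitrary choice.\<close>
    using prod_Basis_cart[of "\<lambda>i _. \<integral>\<^sup>+u. g i u \<partial>lborel" "0 :: real ^ 'd"] by simp
  finally show ?thesis by (simp only: g_def)
qed

lemma laguerre_kernel_eq_prod:
  fixes \<gamma> :: "real ^ 'd"
  shows "laguerre_kernel \<gamma> t x y = (\<Prod>i\<in>UNIV. laguerre_kernel_1 (\<gamma> $ i) t (x $ i) (y $ i))"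
  unfolding laguerre_kernel_def laguerre_kernel_1_def prod.distrib
  by (simp add: sum_distrib_left exp_sum power_one_over)

lemma ennreal_laguerre_kernel:
  fixes \<gamma> :: "real ^ 'd"
  assumes "\<And>i. 0 \<le> \<gamma> $ i" "0 < t" "x \<in> Rplus" "y \<in> Rplus"
  shows "ennreal (laguerre_kernel \<gamma> t x y) = (\<Prod>i\<in>UNIV. ennreal (laguerre_kernel_1 (\<gamma> $ i) t (x $ i) (y $ i)))"
  unfolding laguerre_kernel_eq_prod using assms
  by (intro prod_ennreal[symmetric] laguerre_kernel_1_nonneg) (auto simp: Rplus_def)

lemma laguerre_kernel_nonneg:
  fixes \<gamma> :: "real ^ 'd"
  assumes "\<And>i. 0 \<le> \<gamma> $ i" "0 < t" "x \<in> Rplus" "y \<in> Rplus"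
  shows "0 \<le> laguerre_kernel \<gamma> t x y"
  unfolding laguerre_kernel_eq_prod using assms
  by (intro prod_nonneg laguerre_kernel_1_nonneg) (auto simp: Rplus_def)

lemma laguerre_kernel_sym: "laguerre_kernel \<gamma> t x y = laguerre_kernel \<gamma> t y x"
  unfolding laguerre_kernel_eq_prod by (intro prod.cong refl laguerre_kernel_1_sym)

lemma laguerre_kernel_measurable [measurable]:
  fixes \<gamma> :: "real ^ 'd"
  assumes [measurable]: "f \<in> measurable N Rplus_measure" "g \<in> measurable N Rplus_measure"
  shows "(\<lambda>x. laguerre_kernel \<gamma> t (f x) (g x)) \<in> borel_measurable N"
  unfolding laguerre_kernel_eq_prod by measurable

lemma nn_integral_laguerre_kernel_le:
  fixes \<gamma> :: "real ^ 'd"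
  assumes "\<And>i. 0 \<le> \<gamma> $ i" "0 < t" "x \<in> Rplus"
  shows "(\<integral>\<^sup>+y. ennreal (laguerre_kernel \<gamma> t x y) \<partial>Rplus_measure) \<le> ennreal (1 / cosh (t / 2) ^ CARD('d))"
proof -
  have "(\<integral>\<^sup>+y. ennreal (laguerre_kernel \<gamma> t x y) \<partial>Rplus_measure) =
      (\<integral>\<^sup>+y. (\<Prod>i\<in>UNIV. ennreal (laguerre_kernel_1 (\<gamma> $ i) t (x $ i) (y $ i))) \<partial>Rplus_measure)"
    using assms by (intro nn_integral_cong ennreal_laguerre_kernel) (auto simp: space_Rplus_measure)
  also have "\<dots> = (\<Prod>i\<in>UNIV. \<integral>\<^sup>+u. ennreal (laguerre_kernel_1 (\<gamma> $ i) t (x $ i) u) * indicator {0<..} u \<partial>lborel)"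
    by (rule nn_integral_Rplus_prod) simp
  also have "\<dots> \<le> (\<Prod>i\<in>(UNIV :: 'd set). ennreal (1 / cosh (t / 2)))"
    using assms by (intro prod_mono_ennreal nn_integral_laguerre_kernel_1_le) (auto simp: Rplus_def)
  also have "\<dots> = ennreal (1 / cosh (t / 2) ^ CARD('d))"
    by (simp add: ennreal_power power_one_over)
  finally show ?thesis .
qed

lemma laguerre_kernel_chapman_kolmogorov:
  fixes \<gamma> :: "real ^ 'd"
  assumes "\<And>i. 0 \<le> \<gamma> $ i" "0 < s" "0 < t" "x \<in> Rplus" "z \<in> Rplus"
  shows "(\<integral>\<^sup>+y. ennreal (laguerre_kernel \<gamma> s x y) * ennreal (laguerre_kernel \<gamma> t y z) \<partial>Rplus_measure) =
    ennreal (laguerre_kernel \<gamma> (s + t) x z)"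
proof -
  have "(\<integral>\<^sup>+y. ennreal (laguerre_kernel \<gamma> s x y) * ennreal (laguerre_kernel \<gamma> t y z) \<partial>Rplus_measure) =
      (\<integral>\<^sup>+y. (\<Prod>i\<in>UNIV. ennreal (laguerre_kernel_1 (\<gamma> $ i) s (x $ i) (y $ i)) *
         ennreal (laguerre_kernel_1 (\<gamma> $ i) t (y $ i) (z $ i))) \<partial>Rplus_measure)"
    using assms by (intro nn_integral_cong) (simp add: ennreal_laguerre_kernel space_Rplus_measure prod.distrib)
  also have "\<dots> = (\<Prod>i\<in>UNIV. \<integral>\<^sup>+u. ennreal (laguerre_kernel_1 (\<gamma> $ i) s (x $ i) u) *
         ennreal (laguerre_kernel_1 (\<gamma> $ i) t u (z $ i)) * indicator {0<..} u \<partial>lborel)"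
    by (rule nn_integral_Rplus_prod) simp
  also have "\<dots> = (\<Prod>i\<in>UNIV. ennreal (laguerre_kernel_1 (\<gamma> $ i) (s + t) (x $ i) (z $ i)))"
    using assms by (intro prod.cong refl laguerre_kernel_1_chapman_kolmogorov) (auto simp: Rplus_def)
  also have "\<dots> = ennreal (laguerre_kernel \<gamma> (s + t) x z)"
    using assms by (intro ennreal_laguerre_kernel[symmetric]) auto
  finally show ?thesis .
qed

text \<open>An open set contains an open box around \<open>x\<close>. On the box the mass is the
  product of one-dimensional masses, each tending to \<open>1\<close>; from above the total mass is
  at most \<open>1\<close>.\<close>

lemma laguerre_kernel_concentrates:
  fixes \<gamma> :: "real ^ 'd"
  assumes \<gamma>: "\<And>i. 0 \<le> \<gamma> $ i" and U: "open U" "U \<subseteq> Rplus" "x \<in> U"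
  shows "((\<lambda>t. \<integral>\<^sup>+y. ennreal (laguerre_kernel \<gamma> t x y) * indicator U y \<partial>Rplus_measure) \<longlongrightarrow> 1) (at_right 0)"
proof -
  obtain A where A: "\<And>i. open (A i)" "\<And>i. x $ i \<in> A i" "\<And>y. (\<And>i. y $ i \<in> A i) \<Longrightarrow> y \<in> U"
    using bspec[OF U(1)[unfolded open_vec_def] U(3)] by metis
  have [measurable]: "A i \<in> sets borel" for i using A(1) by auto
  have x: "x \<in> Rplus" "\<And>i. 0 < x $ i" using U by (auto simp: Rplus_def)
  define m where "m = (\<lambda>i t. \<integral>\<^sup>+u. ennreal (laguerre_kernel_1 (\<gamma> $ i) t (x $ i) u) * indicator (A i) u * indicator {0<..} u \<partial>lborel)"
  have t_pos: "eventually (\<lambda>t::real. 0 < t) (at_right 0)" by (rule eventually_at_right_less)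
  have "((\<lambda>t. \<Prod>i\<in>UNIV. enn2real (m i t)) \<longlongrightarrow> (\<Prod>i\<in>(UNIV :: 'd set). 1)) (at_right 0)"
    unfolding m_def using \<gamma> x A by (intro tendsto_prod laguerre_kernel_1_concentrates) auto
  then have lim: "((\<lambda>t. ennreal (\<Prod>i\<in>UNIV. enn2real (m i t))) \<longlongrightarrow> 1) (at_right 0)"
    using tendsto_ennrealI by fastforce
  have "eventually (\<lambda>t. ennreal (\<Prod>i\<in>UNIV. enn2real (m i t)) \<le>
      (\<integral>\<^sup>+y. ennreal (laguerre_kernel \<gamma> t x y) * indicator U y \<partial>Rplus_measure)) (at_right 0)"
    using t_pos
  proof eventually_elim
    case (elim t)
    have "m i t \<le> 1" for i
      unfolding m_def using \<gamma> x elim by (intro laguerre_kernel_1_near_diagonal_le_1) auto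
    then have "m i t \<noteq> top" for i by (metis ennreal_one_neq_top top.extremum_uniqueI)
    then have "ennreal (\<Prod>i\<in>UNIV. enn2real (m i t)) = (\<Prod>i\<in>UNIV. m i t)"
      by (subst prod_ennreal[symmetric]) (auto simp: less_top)
    also have "\<dots> = (\<integral>\<^sup>+y. (\<Prod>i\<in>UNIV. ennreal (laguerre_kernel_1 (\<gamma> $ i) t (x $ i) (y $ i)) * indicator (A i) (y $ i)) \<partial>Rplus_measure)"
      unfolding m_def by (rule nn_integral_Rplus_prod[symmetric]) simp
    also have "\<dots> \<le> (\<integral>\<^sup>+y. ennreal (laguerre_kernel \<gamma> t x y) * indicator U y \<partial>Rplus_measure)"
    proof (intro nn_integral_mono)
      fix y :: "real ^ 'd" assume "y \<in> space Rplus_measure"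
      then have y: "y \<in> Rplus" by (simp add: space_Rplus_measure)
      have "(\<Prod>i\<in>UNIV. (indicator (A i) (y $ i) :: ennreal)) \<le> indicator U y"
      proof (cases "\<forall>i. y $ i \<in> A i")
        case True
        then show ?thesis using A(3) by simp
      next
        case False
        then obtain i where "y $ i \<notin> A i" by auto
        then have "(\<Prod>i\<in>UNIV. (indicator (A i) (y $ i) :: ennreal)) = 0" by (intro prod_zero bexI[of _ i]) auto
        then show ?thesis by (simp only: zero_le)
      qed
      then show "(\<Prod>i\<in>UNIV. ennreal (laguerre_kernel_1 (\<gamma> $ i) t (x $ i) (y $ i)) * indicator (A i) (y $ i)) \<le>
          ennreal (laguerre_kernel \<gamma> t x y) * indicator U y"
        unfolding prod.distrib ennreal_laguerre_kernel[OF \<gamma> elim x(1) y] by (intro mult_left_mono) auto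
    qed
    finally show ?case .
  qed
  moreover have "eventually (\<lambda>t. (\<integral>\<^sup>+y. ennreal (laguerre_kernel \<gamma> t x y) * indicator U y \<partial>Rplus_measure) \<le> 1) (at_right 0)"
    using t_pos
  proof eventually_elim
    case (elim t)
    have "(\<integral>\<^sup>+y. ennreal (laguerre_kernel \<gamma> t x y) * indicator U y \<partial>Rplus_measure) \<le>
        (\<integral>\<^sup>+y. ennreal (laguerre_kernel \<gamma> t x y) \<partial>Rplus_measure)"
      by (intro nn_integral_mono) (simp add: indicator_def)
    also have "\<dots> \<le> ennreal (1 / cosh (t / 2) ^ CARD('d))"
      using \<gamma> elim x(1) by (rule nn_integral_laguerre_kernel_le)
    also have "\<dots> \<le> ennreal 1"
      using one_le_power[OF cosh_real_ge_1[of "t / 2"], of "CARD('d)"] by (intro ennreal_leI) (simp add: divide_le_eq)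
    finally show ?case by simp
  qed
  ultimately show ?thesis
    by (rule tendsto_sandwich[OF _ _ lim tendsto_const])
qed

lemma symmetric_kernel_semigroup_laguerre:
  fixes \<gamma> :: "real ^ 'd"
  assumes \<gamma>: "\<And>i. 0 \<le> \<gamma> $ i"
  shows "symmetric_kernel_semigroup Rplus_measure (\<lambda>t x y. exp (- t / 2) * laguerre_kernel \<gamma> t x y)
    (\<lambda>t. exp (- t / 2) / cosh (t / 2) ^ CARD('d))"
proof -
  interpret sigma_finite_measure "Rplus_measure :: (real ^ 'd) measure"
    by (rule sigma_finite_Rplus_measure)
  have split: "ennreal (exp (- t / 2) * laguerre_kernel \<gamma> t x y) = ennreal (exp (- t / 2)) * ennreal (laguerre_kernel \<gamma> t x y)"
    for t x y by (rule ennreal_mult') simp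
  show ?thesis
  proof unfold_locales
    fix t :: real assume t: "0 < t"
    show "(\<lambda>(x, y). exp (- t / 2) * laguerre_kernel \<gamma> t x y) \<in> borel_measurable (Rplus_measure \<Otimes>\<^sub>M Rplus_measure)"
      by measurable
    show "0 < exp (- t / 2) / cosh (t / 2) ^ CARD('d)" by simp
    have "exp (- t / 2) \<le> 1" using t by simp
    also have "1 \<le> cosh (t / 2) ^ CARD('d)" by (rule one_le_power[OF cosh_real_ge_1])
    finally show "exp (- t / 2) / cosh (t / 2) ^ CARD('d) \<le> 1" by (simp add: divide_le_eq)
    fix x :: "real ^ 'd" assume x: "x \<in> space Rplus_measure"
    have "(\<integral>\<^sup>+y. ennreal (exp (- t / 2) * laguerre_kernel \<gamma> t x y) \<partial>Rplus_measure) =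
        ennreal (exp (- t / 2)) * (\<integral>\<^sup>+y. ennreal (laguerre_kernel \<gamma> t x y) \<partial>Rplus_measure)"
      unfolding split using x by (intro nn_integral_cmult) measurable
    also have "\<dots> \<le> ennreal (exp (- t / 2)) * ennreal (1 / cosh (t / 2) ^ CARD('d))"
      using \<gamma> t x by (intro mult_left_mono nn_integral_laguerre_kernel_le) (auto simp: space_Rplus_measure)
    also have "\<dots> = ennreal (exp (- t / 2) / cosh (t / 2) ^ CARD('d))"
      by (simp flip: ennreal_mult)
    finally show "(\<integral>\<^sup>+y. ennreal (exp (- t / 2) * laguerre_kernel \<gamma> t x y) \<partial>Rplus_measure) \<le>
        ennreal (exp (- t / 2) / cosh (t / 2) ^ CARD('d))" .
    fix y :: "real ^ 'd" assume y: "y \<in> space Rplus_measure"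
    show "0 \<le> exp (- t / 2) * laguerre_kernel \<gamma> t x y"
      using \<gamma> t x y by (intro mult_nonneg_nonneg laguerre_kernel_nonneg) (auto simp: space_Rplus_measure)
    show "exp (- t / 2) * laguerre_kernel \<gamma> t x y = exp (- t / 2) * laguerre_kernel \<gamma> t y x"
      by (simp only: laguerre_kernel_sym[of \<gamma> t x y])
  next
    fix s t :: real and x z :: "real ^ 'd"
    assume s: "0 < s" and t: "0 < t" and x: "x \<in> space Rplus_measure" and z: "z \<in> space Rplus_measure"
    have "(\<integral>\<^sup>+y. ennreal (exp (- s / 2) * laguerre_kernel \<gamma> s x y) * ennreal (exp (- t / 2) * laguerre_kernel \<gamma> t y z) \<partial>Rplus_measure) =
        (\<integral>\<^sup>+y. ennreal (exp (- s / 2) * exp (- t / 2)) * (ennreal (laguerre_kernel \<gamma> s x y) * ennreal (laguerre_kernel \<gamma> t y z)) \<partial>Rplus_measure)"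
      unfolding split by (subst ennreal_mult) (auto simp: mult_ac)
    also have "\<dots> = ennreal (exp (- s / 2) * exp (- t / 2)) * (\<integral>\<^sup>+y. ennreal (laguerre_kernel \<gamma> s x y) * ennreal (laguerre_kernel \<gamma> t y z) \<partial>Rplus_measure)"
      using x z by (intro nn_integral_cmult) measurable
    also have "\<dots> = ennreal (exp (- s / 2) * exp (- t / 2)) * ennreal (laguerre_kernel \<gamma> (s + t) x z)"
      using laguerre_kernel_chapman_kolmogorov[OF \<gamma> s t] x z by (simp add: space_Rplus_measure)
    also have "exp (- s / 2) * exp (- t / 2) = exp (- (s + t) / 2)"
      by (simp add: exp_add[symmetric] add_divide_distrib)
    also have "ennreal (exp (- (s + t) / 2)) * ennreal (laguerre_kernel \<gamma> (s + t) x z) =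
        ennreal (exp (- (s + t) / 2) * laguerre_kernel \<gamma> (s + t) x z)"
      by (rule split[symmetric])
    finally show "(\<integral>\<^sup>+y. ennreal (exp (- s / 2) * laguerre_kernel \<gamma> s x y) * ennreal (exp (- t / 2) * laguerre_kernel \<gamma> t y z) \<partial>Rplus_measure) =
        ennreal (exp (- (s + t) / 2) * laguerre_kernel \<gamma> (s + t) x z)" .
  next
    fix A :: "(real ^ 'd) set" and \<epsilon> :: real
    assume A: "A \<in> sets Rplus_measure" and \<epsilon>: "0 < \<epsilon>"
    have A': "A \<in> sets borel" "A \<subseteq> Rplus"
      using A by (auto simp: Rplus_measure_def sets_restrict_space_iff)
    \<comment> \<open>Outer regularity yields an open set of the full space; intersecting with the
      open orthant keeps it open and does not increase the excess measure.\<close>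
    obtain V where V: "open V" "A \<subseteq> V" "emeasure lborel (V - A) < ennreal \<epsilon>"
      using outer_regular_lborel[OF A'(1) \<epsilon>] by blast
    define U where "U = V \<inter> Rplus"
    have U: "open U" "A \<subseteq> U" "U \<subseteq> Rplus" using V open_Rplus A' by (auto simp: U_def)
    have U_sets [measurable]: "U \<in> sets Rplus_measure"
      using U by (simp add: Rplus_measure_def sets_restrict_space_iff)
    have "emeasure Rplus_measure (U - A) = emeasure lborel (U - A)"
      unfolding Rplus_measure_def using U by (intro emeasure_restrict_space) auto
    also have "\<dots> \<le> emeasure lborel (V - A)"
      using V A' by (intro emeasure_mono) (auto simp: U_def)
    finally have le: "emeasure Rplus_measure (U - A) \<le> ennreal \<epsilon>" using V by simp
    have "((\<lambda>t. \<integral>\<^sup>+y. ennreal (exp (- t / 2) * laguerre_kernel \<gamma> t x y) * indicator U y \<partial>Rplus_measure) \<longlongrightarrow> 1) (at_right 0)"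
      if x: "x \<in> U" for x
    proof (rule Lim_transform_eventually)
      \<comment> \<open>The damping factor tends to \<open>1\<close> and therefore does not disturb
        the concentration.\<close>
      have "((\<lambda>t. ennreal (exp (- t / 2))) \<longlongrightarrow> ennreal (exp (- 0 / 2))) (at_right 0)"
        by (intro tendsto_intros) simp
      then have "((\<lambda>t. ennreal (exp (- t / 2)) * (\<integral>\<^sup>+y. ennreal (laguerre_kernel \<gamma> t x y) * indicator U y \<partial>Rplus_measure)) \<longlongrightarrow> 1 * 1) (at_right 0)"
        using laguerre_kernel_concentrates[OF \<gamma> U(1,3) x] by (intro tendsto_mult_ennreal) auto
      then show "((\<lambda>t. ennreal (exp (- t / 2)) * (\<integral>\<^sup>+y. ennreal (laguerre_kernel \<gamma> t x y) * indicator U y \<partial>Rplus_measure)) \<longlongrightarrow> 1) (at_right 0)"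
        by simp
      have x': "x \<in> space Rplus_measure" using x U by (auto simp: space_Rplus_measure)
      have "ennreal (exp (- t / 2)) * (\<integral>\<^sup>+y. ennreal (laguerre_kernel \<gamma> t x y) * indicator U y \<partial>Rplus_measure) =
          (\<integral>\<^sup>+y. ennreal (exp (- t / 2) * laguerre_kernel \<gamma> t x y) * indicator U y \<partial>Rplus_measure)" for t
        unfolding split mult.assoc using x' by (intro nn_integral_cmult[symmetric]) measurable
      then show "eventually (\<lambda>t. ennreal (exp (- t / 2)) * (\<integral>\<^sup>+y. ennreal (laguerre_kernel \<gamma> t x y) * indicator U y \<partial>Rplus_measure) =
          (\<integral>\<^sup>+y. ennreal (exp (- t / 2) * laguerre_kernel \<gamma> t x y) * indicator U y \<partial>Rplus_measure)) (at_right 0)"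
        by simp
    qed
    then show "\<exists>U\<in>sets Rplus_measure. A \<subseteq> U \<and> emeasure Rplus_measure (U - A) \<le> ennreal \<epsilon> \<and>
        (\<forall>x\<in>U. ((\<lambda>t. \<integral>\<^sup>+y. ennreal (exp (- t / 2) * laguerre_kernel \<gamma> t x y) * indicator U y \<partial>Rplus_measure) \<longlongrightarrow> 1) (at_right 0))"
      using U_sets U(2) le by blast
  qed
qed

text \<open>A nonempty open set is not negligible. Negligibility refers to the completed Lebesgue
  measure, hence the passage through null sets of the completion.\<close>

lemma emeasure_Rplus_measure_nonzero: "emeasure Rplus_measure (space Rplus_measure :: (real ^ 'd) set) \<noteq> 0"
proof -
  have "(\<chi> i. 1) \<in> (Rplus :: (real ^ 'd) set)" by (simp add: Rplus_def)
  then have "emeasure lborel (Rplus :: (real ^ 'd) set) \<noteq> 0"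
    using open_not_negligible[OF open_Rplus] null_sets_completionI[of Rplus lborel]
    by (auto simp: negligible_iff_null_sets null_sets_def)
  then show ?thesis
    unfolding space_Rplus_measure Rplus_measure_def by (subst emeasure_restrict_space) auto
qed

theorem proposition3p2:
  fixes \<alpha> :: "real ^ 'd" and j :: 'd
  assumes "\<alpha> $ j \<ge> -1"
    and "\<And>i. i \<noteq> j \<Longrightarrow> \<alpha> $ i \<ge> 0"
  shows "submarkovian_semigroup Rplus_measure (L1_plus_Linf Rplus_measure)
           (modified_laguerre_semigroup \<alpha> j)
       \<and> \<not> markovian_semigroup Rplus_measure (L1_plus_Linf Rplus_measure)
           (modified_laguerre_semigroup \<alpha> j)
       \<and> (\<forall>p t. 1 \<le> p \<longrightarrow> 0 < t \<longrightarrow>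
           Lp_opnorm Rplus_measure p (modified_laguerre_semigroup \<alpha> j t)
             \<le> ennreal (exp (- t / 2) / cosh (t / 2) ^ CARD('d)))"
proof -
  define \<gamma> where "\<gamma> = \<alpha> + axis j 1"
  \<comment> \<open>The shift by \<open>axis j 1\<close> compensates the lower bound
    \<open>-1\<close> in coordinate \<open>j\<close>; the other coordinates are unchanged.\<close>
  have \<gamma>: "0 \<le> \<gamma> $ i" for i
    using assms by (cases "i = j") (auto simp: \<gamma>_def axis_def)
  interpret symmetric_kernel_semigroup Rplus_measure "\<lambda>t x y. exp (- t / 2) * laguerre_kernel \<gamma> t x y"
    "\<lambda>t. exp (- t / 2) / cosh (t / 2) ^ CARD('d)"
    using \<gamma> by (rule symmetric_kernel_semigroup_laguerre)
  \<comment> \<open>The exponential in front of the integral is moved into the kernel, so the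
    abstract operators agree with the given ones as functions, for \<open>t = 0\<close> by the
    separate branch.\<close>
  have eq: "modified_laguerre_semigroup \<alpha> j = semigroup_op"
    unfolding semigroup_op_def modified_laguerre_semigroup_def \<gamma>_def[symmetric]
    by (intro ext) (simp add: mult.assoc)
  \<comment> \<open>The mass bound at the sample time \<open>t = 1\<close>; it is strictly below
    \<open>1\<close> already because of the damping factor, and this excludes the Markov
    property.\<close>
  have "exp (- 1 / 2) < (1 :: real)" by simp
  also have "1 \<le> cosh (1 / 2 :: real) ^ CARD('d)"
    using one_le_power[OF cosh_real_ge_1] .
  finally have "exp (- 1 / 2) / cosh (1 / 2 :: real) ^ CARD('d) < 1"
    by (simp add: divide_less_eq)
  then show ?thesis
    unfolding eq
    using submarkovian_semigroup_op not_markovian_semigroup_op[of 1] Lp_opnorm_semigroup_op_le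
      emeasure_Rplus_measure_nonzero by auto
qed

end
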